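(* Let $F_1,\ldots,F_l$ be vector fields on $\mathbb{R}^n$ that are smooth and bounded together with their derivatives of each order, and that satisfy the Lie algebra strong approximating property. Let $\mathcal{U}=L^2([0,1],\mathbb{R}^l)$ and, for $u\in\mathcal{U}$, let $\Phi_u$ be the time-one flow of $\dot x=\sum_{i=1}^lF_i(x)u_i$. Let $\Psi:\mathbb{R}^n\to\mathbb{R}^n$ be a diffeomorphism diffeotopic to the identity, let $a:\mathbb{R}^n\to\mathbb{R}$ be smooth with $a\ge0$ and $a(0)=0$, and let $\mu$ be a Borel probability measure supported in a compact set $K\subset\mathbb{R}^n$. For $\beta>0$ let $$\mathcal{F}_{(\beta)}(u):=\int_{\mathbb{R}^n}a(\Phi_u(x)-\Psi(x))\,d\mu(x)+\frac\beta2\|u\|_{L^2}^2,\quad u\in\mathcal{U},$$ $$\kappa_\beta:=\sup\Big\{\int_K a(\Phi_{\tilde u}(x)-\Psi(x))\,d\mu(x)\ :\ \tilde u\in\arg\min_{\mathcal{U}}\mathcal{F}_{(\beta)}\Big\}.$$ Then $\lim_{\beta\to0^+}\kappa_\beta=0$.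
   Context: For $u\in\mathcal{U}$ and $x_0\in\mathbb{R}^n$, let $x_{u,x_0}:[0,1]\to\mathbb{R}^n$ be the unique (Carath\'eodory) solution of $\dot x(s)=\sum_{i=1}^l F_i(x(s))u_i(s)$, $x(0)=x_0$; the flow is $\Phi_u(x_0):=x_{u,x_0}(1)$. A diffeomorphism $\Psi$ is diffeotopic to the identity if there is a family of diffeomorphisms $(\Psi_s)_{s\in[0,1]}$ of $\mathbb{R}^n$ depending smoothly on $s$ with $\Psi_0=\mathrm{Id}$, $\Psi_1=\Psi$. $\mathrm{Lie}(F_1,\ldots,F_l)$ is the linear span of all iterated Lie brackets $[F_{i_s},[\ldots,[F_{i_2},F_{i_1}]\ldots]]$, $s\ge1$, $i_1,\ldots,i_s\in\{1,\ldots,l\}$ (for $s=1$ these are the fields $F_{i_1}$). For a vector field $X$ and a compact set $H\subset\mathbb{R}^n$, $\|X\|_{1,H}:=\sup_{x\in H}\big(|X(x)|_2+\sum_{i=1}^n|D_{x_i}X(x)|_2\big)$, and $\mathrm{Lie}^\delta_{1,H}(F_1,\ldots,F_l):=\{X\in\mathrm{Lie}(F_1,\ldots,F_l):\|X\|_{1,H}\le\delta\}$. The system $F_1,\ldots,F_l$ satisfies the Lie algebra strong approximating property if there exists $m\ge1$ such that for every $C^m$-regular vector field $Y:\mathbb{R}^n\to\mathbb{R}^n$ and each compact set $H\subset\mathbb{R}^n$ there exists $\delta>0$ such that $\inf\{\sup_{x\in H}|X(x)-Y(x)|_2 : X\in\mathrm{Lie}^\delta_{1,H}(F_1,\ldots,F_l)\}=0$.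 In the paper, $\mu$ arises as the weak limit of empirical measures $\mu_M=\frac1M\sum_{j=1}^M\delta_{x^{j,M}}$ of $M$ distinct points of $K$; only $\mu$ enters the statement. *)

theory Defs
  imports "HOL-Analysis.Analysis" "HOL-Probability.Probability"
begin

section \<open>Differentiability classes\<close>

abbreviation dir_deriv ::
    "'a::real_normed_vector \<Rightarrow> ('a \<Rightarrow> 'b::real_normed_vector) \<Rightarrow> 'a \<Rightarrow> 'b" where
  "dir_deriv v f \<equiv> (\<lambda>x. frechet_derivative f (at x) v)"

text \<open>Intended for open \<open>S\<close> only: the derivatives are two-sided, not relative to \<open>S\<close>.\<close>

primrec Ck_on ::
    "nat \<Rightarrow> 'a::euclidean_space set \<Rightarrow> ('a \<Rightarrow> 'b::real_normed_vector) \<Rightarrow> bool" where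
  "Ck_on 0 S f \<longleftrightarrow> continuous_on S f"
| "Ck_on (Suc k) S f \<longleftrightarrow>
     (\<forall>x\<in>S. f differentiable (at x)) \<and> (\<forall>e\<in>Basis. Ck_on k S (dir_deriv e f))"

definition smooth_on ::
    "'a::euclidean_space set \<Rightarrow> ('a \<Rightarrow> 'b::real_normed_vector) \<Rightarrow> bool" where
  "smooth_on S f \<longleftrightarrow> (\<forall>k. Ck_on k S f)"

primrec iter_deriv ::
    "'a::real_normed_vector list \<Rightarrow> ('a \<Rightarrow> 'b::real_normed_vector) \<Rightarrow> 'a \<Rightarrow> 'b" where
  "iter_deriv [] f = f"
| "iter_deriv (v # vs) f = iter_deriv vs (dir_deriv v f)"

definition smooth_bounded :: "('a::euclidean_space \<Rightarrow> 'b::real_normed_vector) \<Rightarrow> bool" where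
  "smooth_bounded f \<longleftrightarrow>
     smooth_on UNIV f \<and> (\<forall>vs\<in>lists Basis. bounded (range (iter_deriv vs f)))"


section \<open>Diffeotopies\<close>

definition diffeomorphism :: "('a::euclidean_space \<Rightarrow> 'a) \<Rightarrow> bool" where
  "diffeomorphism f \<longleftrightarrow> bij f \<and> smooth_on UNIV f \<and> smooth_on UNIV (inv f)"

text \<open>Smooth dependence on \<open>s \<in> [0,1]\<close> is joint smoothness of \<open>(s, x) \<mapsto> H s x\<close> on
  \<open>[0,1] \<times> \<real>\<^sup>n\<close>. As this set is not open, it means, as usual, smoothness on some open
  neighbourhood of it. The values of \<open>H s\<close> for \<open>s \<notin> [0,1]\<close> serve only as that extension.\<close>

definition diffeotopic_to_id :: "('a::euclidean_space \<Rightarrow> 'a) \<Rightarrow> bool" where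
  "diffeotopic_to_id \<Psi> \<longleftrightarrow>
     (\<exists>(H :: real \<Rightarrow> 'a \<Rightarrow> 'a) T.
        open T \<and> {0..1} \<times> UNIV \<subseteq> T \<and> smooth_on T (\<lambda>(s, x). H s x) \<and>
        (\<forall>s\<in>{0..1}. diffeomorphism (H s)) \<and> H 0 = id \<and> H 1 = \<Psi>)"


section \<open>Lie algebra strong approximating property\<close>

definition lie_bracket ::
    "('a::real_normed_vector \<Rightarrow> 'a) \<Rightarrow> ('a \<Rightarrow> 'a) \<Rightarrow> 'a \<Rightarrow> 'a" where
  "lie_bracket X Y = (\<lambda>x. frechet_derivative Y (at x) (X x) - frechet_derivative X (at x) (Y x))"

inductive_set iter_brackets :: "('l \<Rightarrow> 'a \<Rightarrow> 'a::real_normed_vector) \<Rightarrow> ('a \<Rightarrow> 'a) set"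
  for F :: "'l \<Rightarrow> 'a \<Rightarrow> 'a" where
  "F i \<in> iter_brackets F"
| "X \<in> iter_brackets F \<Longrightarrow> lie_bracket (F i) X \<in> iter_brackets F"

text \<open>The linear span is written out, since functions do not form an instance of
  \<^class>\<open>real_vector\<close>.\<close>

definition Lie :: "('l \<Rightarrow> 'a \<Rightarrow> 'a::real_normed_vector) \<Rightarrow> ('a \<Rightarrow> 'a) set" where
  "Lie F = {X. \<exists>B c. finite B \<and> B \<subseteq> iter_brackets F \<and> X = (\<lambda>x. \<Sum>Z\<in>B. c Z *\<^sub>R Z x)}"

text \<open>Suprema of norms are taken in \<^typ>\<open>ennreal\<close>, so that the supremum over the empty
  compact set is 0.\<close>

definition norm_C1 :: "'a::euclidean_space set \<Rightarrow> ('a \<Rightarrow> 'a) \<Rightarrow> ennreal" where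
  "norm_C1 H X = (SUP x\<in>H. ennreal (norm (X x) + (\<Sum>e\<in>Basis. norm (dir_deriv e X x))))"

definition Lie_C1 ::
    "real \<Rightarrow> 'a set \<Rightarrow> ('l \<Rightarrow> 'a \<Rightarrow> 'a::euclidean_space) \<Rightarrow> ('a \<Rightarrow> 'a) set" where
  "Lie_C1 \<delta> H F = {X \<in> Lie F. norm_C1 H X \<le> ennreal \<delta>}"

definition lie_strong_approximating :: "('l \<Rightarrow> 'a \<Rightarrow> 'a::euclidean_space) \<Rightarrow> bool" where
  "lie_strong_approximating F \<longleftrightarrow>
     (\<exists>m\<ge>1. \<forall>Y. Ck_on m UNIV Y \<longrightarrow>
        (\<forall>H. compact H \<longrightarrow>
          (\<exists>\<delta>>0. (INF X\<in>Lie_C1 \<delta> H F. SUP x\<in>H. ennreal (norm (X x - Y x))) = 0)))"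


section \<open>Controls and flows\<close>

text \<open>Elements of \<open>L\<^sup>2([0,1], \<real>\<^sup>l)\<close> are given by representatives. The flow and
  the norm depend only on the almost-everywhere class.\<close>

definition L2_controls :: "(real \<Rightarrow> real ^ 'l) set" where
  "L2_controls = {u. u \<in> borel_measurable (lebesgue_on {0..1}) \<and>
                     integrable (lebesgue_on {0..1}) (\<lambda>s. (norm (u s))\<^sup>2)}"

definition L2_norm_sq :: "(real \<Rightarrow> real ^ 'l) \<Rightarrow> real" where
  "L2_norm_sq u = (\<integral>s. (norm (u s))\<^sup>2 \<partial>lebesgue_on {0..1})"

text \<open>A division consists of finitely many nonempty compact intervals \<open>k\<close> with disjoint
  interiors; their endpoints are \<open>Inf k\<close> and \<open>Sup k\<close>.\<close>

definition abs_continuous_on :: "real set \<Rightarrow> (real \<Rightarrow> 'a::real_normed_vector) \<Rightarrow> bool" where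
  "abs_continuous_on I f \<longleftrightarrow>
     (\<forall>\<epsilon>>0. \<exists>\<delta>>0. \<forall>D S. D division_of S \<and> S \<subseteq> I \<and> (\<Sum>k\<in>D. Sup k - Inf k) < \<delta> \<longrightarrow>
        (\<Sum>k\<in>D. norm (f (Sup k) - f (Inf k))) < \<epsilon>)"

definition caratheodory_solution ::
    "('l::finite \<Rightarrow> 'a \<Rightarrow> 'a::real_normed_vector) \<Rightarrow> (real \<Rightarrow> real ^ 'l) \<Rightarrow> 'a \<Rightarrow> (real \<Rightarrow> 'a) \<Rightarrow> bool" where
  "caratheodory_solution F u x0 x \<longleftrightarrow>
     abs_continuous_on {0..1} x \<and> x 0 = x0 \<and>
     (AE s in lebesgue_on {0..1}.
        (x has_vector_derivative (\<Sum>i\<in>UNIV. (u s $ i) *\<^sub>R F i (x s))) (at s within {0..1}))"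

text \<open>Solutions are unique only on \<open>[0,1]\<close>, hence the description selects the end point
  rather than the solution as a function on the whole line.\<close>

definition flow ::
    "('l::finite \<Rightarrow> 'a \<Rightarrow> 'a::real_normed_vector) \<Rightarrow> (real \<Rightarrow> real ^ 'l) \<Rightarrow> 'a \<Rightarrow> 'a" where
  "flow F u x0 = (THE y. \<exists>x. caratheodory_solution F u x0 x \<and> x 1 = y)"


section \<open>The regularised functional\<close>

definition cost ::
    "('l::finite \<Rightarrow> 'a \<Rightarrow> 'a::euclidean_space) \<Rightarrow> ('a \<Rightarrow> 'a) \<Rightarrow> ('a \<Rightarrow> real) \<Rightarrow> 'a measure \<Rightarrow>
     real \<Rightarrow> (real \<Rightarrow> real ^ 'l) \<Rightarrow> real" where
  "cost F \<Psi> a \<mu> \<beta> u = (\<integral>x. a (flow F u x - \<Psi> x) \<partial>\<mu>) + \<beta> / 2 * L2_norm_sq u"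

definition minimizers ::
    "('l::finite \<Rightarrow> 'a \<Rightarrow> 'a::euclidean_space) \<Rightarrow> ('a \<Rightarrow> 'a) \<Rightarrow> ('a \<Rightarrow> real) \<Rightarrow> 'a measure \<Rightarrow>
     real \<Rightarrow> (real \<Rightarrow> real ^ 'l) set" where
  "minimizers F \<Psi> a \<mu> \<beta> = {u. is_arg_min (cost F \<Psi> a \<mu> \<beta>) (\<lambda>u. u \<in> L2_controls) u}"

text \<open>The supremum is extended-real valued: it would be \<open>-\<infinity>\<close> if there were no minimizer.\<close>

definition kappa ::
    "('l::finite \<Rightarrow> 'a \<Rightarrow> 'a::euclidean_space) \<Rightarrow> ('a \<Rightarrow> 'a) \<Rightarrow> ('a \<Rightarrow> real) \<Rightarrow> 'a measure \<Rightarrow>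
     'a set \<Rightarrow> real \<Rightarrow> ereal" where
  "kappa F \<Psi> a \<mu> K \<beta> =
     (SUP u\<in>minimizers F \<Psi> a \<mu> \<beta>. ereal (LINT x:K|\<mu>. a (flow F u x - \<Psi> x)))"

end

theory Submission
  imports Defs "HOL-Complex_Analysis.Great_Picard"
begin

text \<open>
  For a fixed control \<open>u\<close> and a minimiser \<open>v\<close> of the functional with parameter \<open>\<beta>\<close>, the end cost
  of \<open>v\<close> is at most \<open>\<F>(v) \<le> \<F>(u) = \<close> end cost of \<open>u\<close> plus \<open>\<beta>/2 \<parallel>u\<parallel>\<^sup>2\<close>. Letting \<open>\<beta>\<close> tend to
  0, the claim follows from two facts: there are controls whose flow is as close to \<open>\<Psi>\<close> on \<open>K\<close> as
  desired (\<open>diffeotopy_attainable\<close>), and minimisers exist for every \<open>\<beta> > 0\<close> (\<open>minimizer_exists\<close>);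
  without the latter the supremum defining \<open>\<kappa>\<^sub>\<beta>\<close> would be \<open>-\<infinity>\<close>.

  Approximation of \<open>\<Psi>\<close>. The attainable flows are closed under composition. Call a vector field \<open>X\<close>
  tangent if for small \<open>\<tau>\<close> some attainable flow agrees with \<open>x + \<tau> X x\<close> up to \<open>o(\<tau>)\<close>, uniformly on
  compact sets. The fields \<open>\<plusminus>F i\<close> are tangent, and tangent fields are closed under sums,
  nonnegative multiples and locally uniform limits. They are also closed under brackets with
  \<open>F i\<close>, by the commutator of flows (\<open>tangent_bracket\<close>). Hence the whole Lie algebra is tangent and, by
  the approximating property, so is every smooth field. Now let \<open>H\<close> be a diffeotopy from the identity
  to \<open>\<Psi>\<close>. Its Eulerian velocity \<open>\<partial>\<^sub>s H \<circ> (H s)\<^sup>-\<^sup>1\<close> is smooth for each \<open>s\<close>, so every short piece of the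
  motion can be imitated with an error \<open>\<epsilon> \<tau>\<close>, where compactness of \<open>[0,1]\<close> makes \<open>\<tau>\<close> independent of
  \<open>s\<close> (\<open>euler_step\<close>). The errors of the pieces add up to a multiple of \<open>\<epsilon>\<close>, because the maps
  \<open>(H s)\<^sup>-\<^sup>1\<close> are uniformly Lipschitz (\<open>uniformly_expanding\<close>).

  Existence of minimisers is the direct method. A bounded sequence of controls has a subsequence
  whose primitives converge uniformly to the primitive of a control of no larger norm
  (\<open>L2_weak_compactness\<close>), and flows are continuous for this convergence
  (\<open>flow_weakly_continuous\<close>).

  Both parts rest on the theory of the control system itself: Caratheodory solutions are the
  solutions of an integral equation (\<open>caratheodory_solution_iff\<close>), for which existence, uniqueness
  and dependence on the data follow from a Picard iteration and a Gronwall inequality.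
\<close>

hide_const (open) Polynomial.content

section \<open>Absolutely continuous functions\<close>

lemma AE_lebesgue_on_iff_negligible:
  fixes S :: "'a::euclidean_space set"
  assumes "S \<in> sets lebesgue"
  shows "(AE x in lebesgue_on S. Q x) \<longleftrightarrow> (\<exists>N. negligible N \<and> (\<forall>x\<in>S - N. Q x))"
proof -
  have "(AE x in lebesgue_on S. Q x) \<longleftrightarrow> (AE x in lebesgue. x \<in> S \<longrightarrow> Q x)"
    using assms by (subst AE_restrict_space_iff) auto
  also have "\<dots> \<longleftrightarrow> (\<exists>N. negligible N \<and> (\<forall>x\<in>S - N. Q x))"
  proof
    assume "AE x in lebesgue. x \<in> S \<longrightarrow> Q x"
    then obtain N where "{x \<in> space lebesgue. \<not> (x \<in> S \<longrightarrow> Q x)} \<subseteq> N" "N \<in> null_sets lebesgue"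
      unfolding eventually_ae_filter by blast
    then show "\<exists>N. negligible N \<and> (\<forall>x\<in>S - N. Q x)"
      by (intro exI[of _ N]) (auto simp: negligible_iff_null_sets)
  next
    assume "\<exists>N. negligible N \<and> (\<forall>x\<in>S - N. Q x)"
    then obtain N where "negligible N" "\<forall>x\<in>S - N. Q x" by blast
    then show "AE x in lebesgue. x \<in> S \<longrightarrow> Q x"
      unfolding eventually_ae_filter
      by (intro bexI[of _ N]) (auto simp: negligible_iff_null_sets)
  qed
  finally show ?thesis .
qed

text \<open>The integrand is truncated at a level \<open>n\<close>: the tail has small integral over all of \<open>[a,b]\<close>, and the
  truncated part contributes at most \<open>n\<close> times the total length of the division.\<close>

lemma absolutely_continuous_integral:
  fixes G :: "real \<Rightarrow> real"
  assumes G: "G integrable_on {a..b}" and nonneg: "\<And>t. t \<in> {a..b} \<Longrightarrow> 0 \<le> G t" and "0 < \<epsilon>"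
  obtains \<delta> where "0 < \<delta>"
    "\<And>D S. D division_of S \<Longrightarrow> S \<subseteq> {a..b} \<Longrightarrow> (\<Sum>k\<in>D. Sup k - Inf k) < \<delta> \<Longrightarrow>
       (\<Sum>k\<in>D. integral k G) < \<epsilon>"
proof -
  have Gabs: "G absolutely_integrable_on {a..b}"
    using nonneg by (intro nonnegative_absolutely_integrable_1 G) auto
  define T where "T n t = min (G t) (real n)" for n :: nat and t
  have "(\<lambda>_. real n) absolutely_integrable_on {a..b}" for n
    by (simp add: absolutely_integrable_on_const)
  then have Tabs: "T n absolutely_integrable_on {a..b}" for n
    using absolutely_integrable_min_1[OF Gabs] unfolding T_def by blast
  have Tint: "T n integrable_on {a..b}" for n
    using Tabs set_lebesgue_integral_eq_integral(1) by blast
  have "(\<lambda>n. integral {a..b} (T n)) \<longlonglongrightarrow> integral {a..b} G"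
  proof (rule dominated_convergence(2)[OF Tint G])
    show "norm (T k x) \<le> G x" if "x \<in> {a..b}" for k x
      using nonneg[OF that] by (auto simp: T_def)
    show "(\<lambda>k. T k x) \<longlonglongrightarrow> G x" for x
    proof -
      obtain N where "G x \<le> real N" using real_arch_simple by blast
      then have "eventually (\<lambda>n. T n x = G x) sequentially"
        unfolding T_def by (intro eventually_sequentiallyI[of N]) (smt (verit) of_nat_mono)
      then show ?thesis by (rule tendsto_eventually)
    qed
  qed
  from LIMSEQ_D[OF this, of "\<epsilon>/2"] obtain n where "norm (integral {a..b} (T n) - integral {a..b} G) < \<epsilon>/2"
    using \<open>0 < \<epsilon>\<close> by auto
  then have n: "integral {a..b} (\<lambda>t. G t - T n t) < \<epsilon>/2"
    using Henstock_Kurzweil_Integration.integral_diff[OF G Tint[of n]] unfolding real_norm_def by linarith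
  show thesis
  proof
    show "0 < \<epsilon> / (2 * (real n + 1))" using \<open>0 < \<epsilon>\<close> by simp
  next
    fix D S assume D: "D division_of S" and S: "S \<subseteq> {a..b}"
      and small: "(\<Sum>k\<in>D. Sup k - Inf k) < \<epsilon> / (2 * (real n + 1))"
    have ivl: "\<exists>c d. k = {c..d} \<and> c \<le> d \<and> {c..d} \<subseteq> {a..b}" if k: "k \<in> D" for k
      using division_ofD(2,3,4)[OF D k] S by (metis atLeastatMost_empty_iff2 box_real(2) order_trans)
    have Dint: "f integrable_on k" if "f integrable_on {a..b}" "k \<in> D" for f :: "real \<Rightarrow> real" and k
      using ivl[OF that(2)] that(1) integrable_on_subinterval by blast
    have Gm: "(\<lambda>t. G t - T n t) integrable_on {a..b}"
      using G Tint by (rule integrable_diff)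
    have intS: "(\<lambda>t. G t - T n t) integrable_on S"
      by (rule integrable_on_subdivision[OF D Gm S])
    have "(\<Sum>k\<in>D. integral k G) \<le> (\<Sum>k\<in>D. integral k (\<lambda>t. G t - T n t) + real n * (Sup k - Inf k))"
    proof (rule sum_mono)
      fix k assume k: "k \<in> D"
      then obtain c d where cd: "k = {c..d}" "c \<le> d" using ivl by blast
      have "integral k G = integral k (\<lambda>t. G t - T n t) + integral k (T n)"
        using integral_add[OF Dint[OF Gm k] Dint[OF Tint[of n] k]] by simp
      moreover have "integral k (T n) \<le> integral k (\<lambda>t. real n)"
        using Dint[OF Tint k] cd by (intro integral_le) (auto simp: T_def)
      moreover have "integral k (\<lambda>t. real n) = real n * (Sup k - Inf k)"
        using cd by simp
      ultimately show "integral k G \<le> integral k (\<lambda>t. G t - T n t) + real n * (Sup k - Inf k)" by linarith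
    qed
    also have "\<dots> = integral S (\<lambda>t. G t - T n t) + real n * (\<Sum>k\<in>D. Sup k - Inf k)"
      by (simp add: sum.distrib sum_distrib_left integral_combine_division_topdown[OF intS D])
    also have "\<dots> \<le> integral {a..b} (\<lambda>t. G t - T n t) + real n * (\<epsilon> / (2 * (real n + 1)))"
      using small Gm intS S by (intro add_mono mult_left_mono integral_subset_le) (auto simp: T_def)
    also have "real n * (\<epsilon> / (2 * (real n + 1))) \<le> \<epsilon>/2"
      using \<open>0 < \<epsilon>\<close> by (simp add: field_simps)
    finally show "(\<Sum>k\<in>D. integral k G) < \<epsilon>" using n by linarith
  qed
qed

lemma abs_continuous_on_dominated:
  fixes f :: "real \<Rightarrow> 'a::real_normed_vector"
  assumes G: "G integrable_on {a..b}" and nonneg: "\<And>t. t \<in> {a..b} \<Longrightarrow> 0 \<le> G t"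
    and le: "\<And>s t. a \<le> s \<Longrightarrow> s \<le> t \<Longrightarrow> t \<le> b \<Longrightarrow> norm (f t - f s) \<le> integral {s..t} G"
  shows "abs_continuous_on {a..b} f"
  unfolding abs_continuous_on_def
proof (intro allI impI)
  fix \<epsilon> :: real assume "0 < \<epsilon>"
  from absolutely_continuous_integral[OF G nonneg this] obtain \<delta> where "0 < \<delta>" and
    \<delta>: "\<And>D S. D division_of S \<Longrightarrow> S \<subseteq> {a..b} \<Longrightarrow> (\<Sum>k\<in>D. Sup k - Inf k) < \<delta> \<Longrightarrow>
       (\<Sum>k\<in>D. integral k G) < \<epsilon>" by metis
  show "\<exists>\<delta>>0. \<forall>D S. D division_of S \<and> S \<subseteq> {a..b} \<and> (\<Sum>k\<in>D. Sup k - Inf k) < \<delta> \<longrightarrow>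
        (\<Sum>k\<in>D. norm (f (Sup k) - f (Inf k))) < \<epsilon>"
  proof (intro exI[of _ \<delta>] conjI allI impI \<open>0 < \<delta>\<close>, elim conjE)
    fix D S assume D: "D division_of S" and S: "S \<subseteq> {a..b}" and small: "(\<Sum>k\<in>D. Sup k - Inf k) < \<delta>"
    have "(\<Sum>k\<in>D. norm (f (Sup k) - f (Inf k))) \<le> (\<Sum>k\<in>D. integral k G)"
    proof (rule sum_mono)
      fix k assume k: "k \<in> D"
      obtain c d where "k = {c..d}" "c \<le> d" "{c..d} \<subseteq> {a..b}"
        using division_ofD(2,3,4)[OF D k] S by (metis atLeastatMost_empty_iff2 box_real(2) order_trans)
      then show "norm (f (Sup k) - f (Inf k)) \<le> integral k G" using le[of c d] by auto
    qed
    with \<delta>[OF D S small] show "(\<Sum>k\<in>D. norm (f (Sup k) - f (Inf k))) < \<epsilon>" by linarith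
  qed
qed

lemma abs_continuous_on_subset:
  assumes "abs_continuous_on I f" "J \<subseteq> I"
  shows "abs_continuous_on J f"
  unfolding abs_continuous_on_def
proof (intro allI impI)
  fix \<epsilon> :: real assume "0 < \<epsilon>"
  then obtain \<delta> where "\<delta> > 0" "\<forall>D S. D division_of S \<and> S \<subseteq> I \<and> (\<Sum>k\<in>D. Sup k - Inf k) < \<delta> \<longrightarrow>
        (\<Sum>k\<in>D. norm (f (Sup k) - f (Inf k))) < \<epsilon>"
    using assms(1) unfolding abs_continuous_on_def by blast
  then show "\<exists>\<delta>>0. \<forall>D S. D division_of S \<and> S \<subseteq> J \<and> (\<Sum>k\<in>D. Sup k - Inf k) < \<delta> \<longrightarrow>
        (\<Sum>k\<in>D. norm (f (Sup k) - f (Inf k))) < \<epsilon>"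
    using assms(2) by (meson subset_trans)
qed

text \<open>The fundamental theorem of calculus with an exceptional null set \<open>N\<close>. In the gauge argument, intervals
  whose tag lies in \<open>N\<close> are forced into an open set of small measure around \<open>N\<close>; by absolute
  continuity \<open>f\<close> changes only little along them.\<close>

lemma abs_continuous_ftc:
  fixes f :: "real \<Rightarrow> 'a::real_normed_vector"
  assumes ac: "abs_continuous_on {a..b} f" and N: "negligible N" and ab: "a \<le> b"
    and der: "\<And>t. t \<in> {a..b} - N \<Longrightarrow> (f has_vector_derivative g t) (at t within {a..b})"
  shows "(g has_integral (f b - f a)) {a..b}"
proof -
  define h where "h t = (if t \<in> N then 0 else g t)" for t
  have "(h has_integral (f b - f a)) {a..b}"
    unfolding has_integral_factor_content_real
  proof (intro allI impI)
    fix e :: real assume "0 < e"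
    show "\<exists>d. gauge d \<and> (\<forall>p. p tagged_division_of {a..b} \<and> d fine p \<longrightarrow>
      norm ((\<Sum>(x, k)\<in>p. content k *\<^sub>R h x) - (f b - f a)) \<le> e * content {a..b})"
    proof (cases "a = b")
      case True
      then have "norm ((\<Sum>(x, k)\<in>p. content k *\<^sub>R h x) - (f b - f a)) \<le> e * content {a..b}"
        if "p tagged_division_of {a..b}" for p
        using sum_content_null[of a b p h] that by simp
      then show ?thesis by (meson gauge_ball zero_less_one)
    next
      case False
      with ab have "a < b" by simp
      define e1 where "e1 = e * (b - a) / 2"
      have "0 < e1" using \<open>0 < e\<close> \<open>a < b\<close> by (simp add: e1_def)
      then obtain \<delta> where "0 < \<delta>" and \<delta>: "\<And>D S. D division_of S \<Longrightarrow> S \<subseteq> {a..b} \<Longrightarrow> 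
         (\<Sum>k\<in>D. Sup k - Inf k) < \<delta> \<Longrightarrow> (\<Sum>k\<in>D. norm (f (Sup k) - f (Inf k))) < e1"
        using ac unfolding abs_continuous_on_def by metis
      have Nl: "N \<in> sets lebesgue" using N by (simp add: negligible_imp_sets)
      obtain U where U: "open U" "N \<subseteq> U" "U - N \<in> lmeasurable" "emeasure lebesgue (U - N) < ennreal \<delta>"
        using sets_lebesgue_outer_open[OF Nl \<open>0 < \<delta>\<close>] by blast
      have "N \<in> null_sets lebesgue" using N negligible_iff_null_sets by blast
      have Ul: "U \<in> lmeasurable" 
        using U N by (metis Diff_partition fmeasurable.Un negligible_imp_measurable)
      have "emeasure lebesgue U = emeasure lebesgue (U - N)"
        using \<open>N \<in> null_sets lebesgue\<close> U(1) by (metis emeasure_Diff_null_set borel_open sets_completionI_sets sets_lborel)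
      then have Um: "measure lebesgue U < \<delta>"
        using U(4) \<open>0 < \<delta>\<close> emeasure_eq_measure2[OF Ul] by (metis ennreal_less_iff measure_nonneg)
      have "\<exists>r>0. \<forall>y\<in>{a..b}. \<bar>y - t\<bar> < r \<longrightarrow> norm (f y - f t - (y - t) *\<^sub>R g t) \<le> e/2 * \<bar>y - t\<bar>"
        if "t \<in> {a..b} - N" for t
      proof -
        have "(f has_derivative (\<lambda>x. x *\<^sub>R g t)) (at t within {a..b})"
          using der[OF that] by (simp add: has_vector_derivative_def)
        then have "\<forall>e>0. \<exists>d>0. \<forall>y\<in>{a..b}. \<bar>y - t\<bar> < d \<longrightarrow> norm (f y - f t - (y - t) *\<^sub>R g t) \<le> e * \<bar>y - t\<bar>"
          unfolding has_derivative_within_alt real_norm_def by (rule conjunct2)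
        then show ?thesis using \<open>0 < e\<close> by (meson half_gt_zero)
      qed
      then obtain r where r: "\<And>t. t \<in> {a..b} - N \<Longrightarrow> 0 < r t"
        and rr: "\<And>t y. t \<in> {a..b} - N \<Longrightarrow> y \<in> {a..b} \<Longrightarrow> \<bar>y - t\<bar> < r t \<Longrightarrow> norm (f y - f t - (y - t) *\<^sub>R g t) \<le> e/2 * \<bar>y - t\<bar>"
        by metis
      define d where "d t = (if t \<in> N then U else if t \<in> {a..b} then ball t (r t) else ball t 1)" for t
      have "gauge d"
        using r U unfolding gauge_def d_def by auto
      moreover have "norm ((\<Sum>(x, k)\<in>p. content k *\<^sub>R h x) - (f b - f a)) \<le> e * content {a..b}"
        if p: "p tagged_division_of {a..b}" and fine: "d fine p" for p
      proof -
        note pD = tagged_division_ofD[OF p]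
        have pk: "\<exists>u v. k = {u..v} \<and> u \<le> x \<and> x \<le> v \<and> a \<le> u \<and> v \<le> b" if xkp: "(x, k) \<in> p" for x k
        proof -
          obtain u v where uv: "k = cbox u v" using pD(4)[OF xkp] by blast
          then have "x \<in> {u..v}" "{u..v} \<subseteq> {a..b}" using pD(2,3)[OF xkp] by auto
          then show ?thesis using uv by auto
        qed
        define p1 where "p1 = {xk \<in> p. fst xk \<in> N}"
        define p2 where "p2 = {xk \<in> p. fst xk \<notin> N}"
        have fin: "finite p1" "finite p2" and pp: "p = p1 \<union> p2" "p1 \<inter> p2 = {}"
          using pD(1) by (auto simp: p1_def p2_def)
        have "p1 tagged_partial_division_of {a..b}"
          using tagged_partial_division_subset[of p "{a..b}" p1] p
          by (auto simp: p1_def tagged_division_of_def)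
        note p1t = tagged_partial_division_of_Union_self[OF this] partial_division_of_tagged_division[OF this]
        have sub1: "\<Union>(snd ` p1) \<subseteq> {a..b}" "\<Union>(snd ` p1) \<subseteq> U"
          using pD(3) fine unfolding p1_def fine_def d_def by fastforce+
        define w where "w k = (if k = {} then 0 else norm (f (Sup k) - f (Inf k)))" for k
        have "(\<Sum>(x, k)\<in>p1. norm (f (Sup k) - f (Inf k))) = (\<Sum>(x, k)\<in>p1. w k)"
          using pk unfolding p1_def w_def by (intro sum.cong) fastforce+
        also have "\<dots> = (\<Sum>k\<in>snd ` p1. w k)"
          by (rule sum.over_tagged_division_lemma[OF p1t(1)]) (auto simp: w_def)
        also have "\<dots> = (\<Sum>k\<in>snd ` p1. norm (f (Sup k) - f (Inf k)))"
          using pk unfolding p1_def w_def by (intro sum.cong) fastforce+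
        also have "\<dots> < e1"
        proof (rule \<delta>[OF p1t(2) sub1(1)])
          have "(\<Sum>k\<in>snd ` p1. Sup k - Inf k) = (\<Sum>k\<in>snd ` p1. measure lebesgue k)"
            using pk unfolding p1_def by (intro sum.cong refl) fastforce
          also have "\<dots> = measure lebesgue (\<Union>(snd ` p1))" by (rule content_division[OF p1t(2)])
          also have "\<dots> \<le> measure lebesgue U"
            using sub1 Ul lmeasurable_division[OF p1t(2)] 
            by (intro measure_mono_fmeasurable) (auto simp: fmeasurableD)
          finally show "(\<Sum>k\<in>snd ` p1. Sup k - Inf k) < \<delta>" using Um by linarith
        qed
        finally have s1: "(\<Sum>(x, k)\<in>p1. norm (f (Sup k) - f (Inf k))) < e1" .
        have est: "norm (content k *\<^sub>R h x - (f (Sup k) - f (Inf k))) \<le> e/2 * content k"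
          if xk: "(x, k) \<in> p2" for x k
        proof -
          from xk have "(x, k) \<in> p" "x \<notin> N" by (auto simp: p2_def)
          then obtain u v where uv: "k = {u..v}" "u \<le> x" "x \<le> v" "a \<le> u" "v \<le> b" using pk by blast
          then have x: "x \<in> {a..b} - N" using \<open>x \<notin> N\<close> by auto
          have "k \<subseteq> d x" using fine \<open>(x, k) \<in> p\<close> unfolding fine_def by blast
          moreover have "d x = ball x (r x)" using x by (simp add: d_def)
          moreover have "u \<in> k" "v \<in> k" using uv by auto
          ultimately have "u \<in> ball x (r x)" "v \<in> ball x (r x)" by auto
          then have "\<bar>u - x\<bar> < r x" "\<bar>v - x\<bar> < r x"
            by (simp_all add: dist_real_def abs_minus_commute)
          then have "norm (f u - f x - (u - x) *\<^sub>R g x) \<le> e/2 * \<bar>u - x\<bar>"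
            "norm (f v - f x - (v - x) *\<^sub>R g x) \<le> e/2 * \<bar>v - x\<bar>"
            using rr[OF x, of u] rr[OF x, of v] uv unfolding atLeastAtMost_iff by linarith+
          moreover have "content k *\<^sub>R h x - (f (Sup k) - f (Inf k)) = 
             (f u - f x - (u - x) *\<^sub>R g x) - (f v - f x - (v - x) *\<^sub>R g x)"
            using uv x by (simp add: h_def algebra_simps)
          ultimately have "norm (content k *\<^sub>R h x - (f (Sup k) - f (Inf k))) \<le> e/2 * \<bar>u - x\<bar> + e/2 * \<bar>v - x\<bar>"
            using norm_triangle_ineq4[of "f u - f x - (u - x) *\<^sub>R g x" "f v - f x - (v - x) *\<^sub>R g x"] by simp
          also have "\<dots> = e/2 * content k" using uv by (simp add: field_simps)
          finally show ?thesis .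
        qed
        have "(\<Sum>(x, k)\<in>p. content k *\<^sub>R h x) - (f b - f a)
           = (\<Sum>(x, k)\<in>p. content k *\<^sub>R h x - (f (Sup k) - f (Inf k)))"
          unfolding additive_tagged_division_1[OF ab p, of f, symmetric]
          by (simp add: sum_subtractf split_def)
        also have "\<dots> = (\<Sum>(x, k)\<in>p1. content k *\<^sub>R h x - (f (Sup k) - f (Inf k)))
            + (\<Sum>(x, k)\<in>p2. content k *\<^sub>R h x - (f (Sup k) - f (Inf k)))"
          using fin pp by (simp add: sum.union_disjoint)
        also have "norm \<dots> \<le> (\<Sum>(x, k)\<in>p1. norm (f (Sup k) - f (Inf k))) + (\<Sum>(x, k)\<in>p2. e/2 * content k)"
        proof (rule norm_triangle_mono)
          show "norm (\<Sum>(x, k)\<in>p1. content k *\<^sub>R h x - (f (Sup k) - f (Inf k))) \<le> (\<Sum>(x, k)\<in>p1. norm (f (Sup k) - f (Inf k)))"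
            by (rule sum_norm_le) (auto simp: p1_def h_def norm_minus_commute)
          show "norm (\<Sum>(x, k)\<in>p2. content k *\<^sub>R h x - (f (Sup k) - f (Inf k))) \<le> (\<Sum>(x, k)\<in>p2. e/2 * content k)"
            using est by (intro sum_norm_le) auto
        qed
        also have "(\<Sum>(x, k)\<in>p2. e/2 * content k) \<le> (\<Sum>(x, k)\<in>p. e/2 * content k)"
          using pD(1) \<open>0 < e\<close> by (intro sum_mono2) (auto simp: p2_def)
        also have "\<dots> = e/2 * (b - a)"
          using additive_content_tagged_division[of p a b] p \<open>a < b\<close>
          by (simp only: split_def sum_distrib_left[symmetric]) simp
        finally show ?thesis using s1 \<open>a < b\<close> by (simp add: e1_def)
      qed
      ultimately show ?thesis by (intro exI[of _ d]) simp
    qed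
  qed
  then show ?thesis
    by (rule has_integral_spike[OF N, where f = h, rotated]) (auto simp: h_def)
qed

lemma has_integral_primitive_right_derivative:
  fixes f :: "real \<Rightarrow> 'a::euclidean_space"
  assumes f: "\<And>a b. f integrable_on {a..b}"
  obtains N where "negligible N"
    "\<And>t e. t \<notin> N \<Longrightarrow> 0 < e \<Longrightarrow> \<exists>d>0. \<forall>h. 0 < h \<and> h < d \<longrightarrow> norm (integral {t..t+h} f - h *\<^sub>R f t) \<le> e * h"
proof -
  obtain N where N: "negligible N" "\<And>x e. \<lbrakk>x \<notin> N; 0 < e\<rbrakk> \<Longrightarrow>
               \<exists>d>0. \<forall>h. 0 < h \<and> h < d \<longrightarrow>
                         norm(integral (cbox x (x + h *\<^sub>R One)) f /\<^sub>R h ^ DIM(real) - f x) < e"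
    using integrable_ccontinuous_explicit[of f] f by (metis box_real(2))
  show thesis
  proof (rule that[OF N(1)])
    fix t e :: real assume "t \<notin> N" "0 < e"
    from N(2)[OF this] obtain d where "d > 0" and
      d: "\<And>h. 0 < h \<Longrightarrow> h < d \<Longrightarrow> norm (integral {t..t+h} f /\<^sub>R h - f t) < e" by auto
    have "norm (integral {t..t+h} f - h *\<^sub>R f t) \<le> e * h" if "0 < h" "h < d" for h
    proof -
      have "norm (integral {t..t+h} f - h *\<^sub>R f t) = norm (h *\<^sub>R (integral {t..t+h} f /\<^sub>R h - f t))"
        using that by (simp add: scaleR_diff_right)
      also have "\<dots> = h * norm (integral {t..t+h} f /\<^sub>R h - f t)" using that by simp
      also have "\<dots> \<le> h * e" using d[OF that] that by (intro mult_left_mono) auto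
      finally show ?thesis by (simp add: mult.commute)
    qed
    then show "\<exists>d>0. \<forall>h. 0 < h \<and> h < d \<longrightarrow> norm (integral {t..t+h} f - h *\<^sub>R f t) \<le> e * h"
      using \<open>d > 0\<close> by blast
  qed
qed

text \<open>Lebesgue differentiation from the left is obtained from the one-sided version by reflecting the
  integrand at 0.\<close>

lemma primitive_has_derivative_ae:
  fixes f :: "real \<Rightarrow> 'a::euclidean_space"
  assumes f: "f integrable_on {a..b}"
  obtains N where "negligible N"
    "\<And>t. t \<in> {a..b} - N \<Longrightarrow> ((\<lambda>t. integral {a..t} f) has_vector_derivative f t) (at t within {a..b})"
proof -
  define f0 where "f0 t = (if t \<in> {a..b} then f t else 0)" for t
  have "f0 integrable_on UNIV"
    using f unfolding f0_def by (simp only: integrable_restrict_UNIV)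
  then have f0: "f0 integrable_on {c..d}" for c d
    by (rule integrable_on_subinterval) simp
  have f0r: "(\<lambda>t. f0 (- t)) integrable_on {c..d}" for c d
    using f0[of "-d" "-c"] Henstock_Kurzweil_Integration.integrable_reflect_real[of f0 "-c" "-d"] by simp
  obtain N1 where N1: "negligible N1"
    "\<And>t e. t \<notin> N1 \<Longrightarrow> 0 < e \<Longrightarrow> \<exists>d>0. \<forall>h. 0 < h \<and> h < d \<longrightarrow> norm (integral {t..t+h} f0 - h *\<^sub>R f0 t) \<le> e * h"
    using has_integral_primitive_right_derivative[OF f0] by blast
  obtain N2 where N2: "negligible N2"
    "\<And>t e. t \<notin> N2 \<Longrightarrow> 0 < e \<Longrightarrow> \<exists>d>0. \<forall>h. 0 < h \<and> h < d \<longrightarrow> norm (integral {t..t+h} (\<lambda>t. f0 (-t)) - h *\<^sub>R f0 (-t)) \<le> e * h"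
    using has_integral_primitive_right_derivative[OF f0r] by blast
  have "negligible (uminus ` N2)"
    using N2(1) by (intro negligible_differentiable_image_negligible)
      (auto intro: derivative_intros)
  then have neg: "negligible (N1 \<union> uminus ` N2)" using N1(1) by simp
  show thesis
  proof (rule that[OF neg])
    fix t assume t: "t \<in> {a..b} - (N1 \<union> uminus ` N2)"
    then have tab: "t \<in> {a..b}" and "t \<notin> N1" "- t \<notin> N2" by force+
    have ft: "f0 t = f t" using tab by (simp add: f0_def)
    have eq: "integral {c..d} f0 = integral {c..d} f" if "a \<le> c" "d \<le> b" for c d
      using that by (intro integral_cong) (auto simp: f0_def)
    show "((\<lambda>t. integral {a..t} f) has_vector_derivative f t) (at t within {a..b})"
      unfolding has_vector_derivative_def has_derivative_within_alt
    proof (intro conjI allI impI)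
      show "bounded_linear (\<lambda>x. x *\<^sub>R f t)" by (rule bounded_linear_scaleR_left)
      fix e :: real assume "0 < e"
      obtain d1 where d1: "d1 > 0" "\<And>h. 0 < h \<Longrightarrow> h < d1 \<Longrightarrow> norm (integral {t..t+h} f0 - h *\<^sub>R f0 t) \<le> e * h"
        using N1(2)[OF \<open>t \<notin> N1\<close> \<open>0 < e\<close>] by blast
      obtain d2 where d2: "d2 > 0" "\<And>h. 0 < h \<Longrightarrow> h < d2 \<Longrightarrow> norm (integral {-t..-t+h} (\<lambda>t. f0 (-t)) - h *\<^sub>R f0 t) \<le> e * h"
        using N2(2)[OF \<open>- t \<notin> N2\<close> \<open>0 < e\<close>] by auto
      have "norm (integral {a..y} f - integral {a..t} f - (y - t) *\<^sub>R f t) \<le> e * norm (y - t)"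
        if y: "y \<in> {a..b}" "norm (y - t) < min d1 d2" for y
      proof (cases y t rule: linorder_cases)
        case equal then show ?thesis by simp
      next
        case greater
        have "integral {a..t} f + integral {t..y} f = integral {a..y} f"
          using y greater tab by (intro Henstock_Kurzweil_Integration.integral_combine integrable_on_subinterval[OF f]) auto
        moreover have "integral {t..t+(y-t)} f0 = integral {t..y} f" using eq[of t y] tab y by simp
        ultimately have "integral {a..y} f - integral {a..t} f - (y - t) *\<^sub>R f t = integral {t..t+(y-t)} f0 - (y - t) *\<^sub>R f0 t"
          using ft by (metis add_diff_cancel_left')
        also have "norm \<dots> \<le> e * (y - t)"
          by (rule d1(2)) (use y greater in auto)
        finally show ?thesis using greater by simp
      next
        case less
        have "integral {a..y} f + integral {y..t} f = integral {a..t} f"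
          using y less tab by (intro Henstock_Kurzweil_Integration.integral_combine integrable_on_subinterval[OF f]) auto
        moreover have "integral {-t..-t+(t-y)} (\<lambda>t. f0 (-t)) = integral {y..t} f"
          using eq[of y t] tab y Henstock_Kurzweil_Integration.integral_reflect_real[of t y f0] by simp
        ultimately have "integral {a..y} f - integral {a..t} f - (y - t) *\<^sub>R f t = - (integral {-t..-t+(t-y)} (\<lambda>t. f0 (-t)) - (t - y) *\<^sub>R f0 t)"
          using ft by (simp add: algebra_simps)
        then have "norm (integral {a..y} f - integral {a..t} f - (y - t) *\<^sub>R f t) = norm (integral {-t..-t+(t-y)} (\<lambda>t. f0 (-t)) - (t - y) *\<^sub>R f0 t)"
          by (simp only: norm_minus_cancel)
        also have "\<dots> \<le> e * (t - y)"
          by (rule d2(2)) (use y less in auto)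
        finally show ?thesis using less by simp
      qed
      then show "\<exists>d>0. \<forall>y\<in>{a..b}. norm (y - t) < d \<longrightarrow>
           norm (integral {a..y} f - integral {a..t} f - (y - t) *\<^sub>R f t) \<le> e * norm (y - t)"
        using d1(1) d2(1) by (intro exI[of _ "min d1 d2"]) auto
    qed
  qed
qed

section \<open>Caratheodory solutions as solutions of an integral equation\<close>

lemma abs_continuous_on_imp_continuous_on:
  fixes f :: "real \<Rightarrow> 'a::real_normed_vector"
  assumes "abs_continuous_on {a..b} f"
  shows "continuous_on {a..b} f"
  unfolding continuous_on_iff
proof (intro ballI allI impI)
  fix t e :: real assume t: "t \<in> {a..b}" and "0 < e"
  then obtain d where "d > 0" and d: "\<And>D S. D division_of S \<Longrightarrow> S \<subseteq> {a..b} \<Longrightarrow> (\<Sum>k\<in>D. Sup k - Inf k) < d \<Longrightarrow>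
        (\<Sum>k\<in>D. norm (f (Sup k) - f (Inf k))) < e"
    using assms unfolding abs_continuous_on_def by metis
  have *: "norm (f v - f u) < e" if "u \<le> v" "a \<le> u" "v \<le> b" "v - u < d" for u v
  proof -
    have "{{u..v}} division_of {u..v}" using division_of_self[of u v] that(1) by simp
    from d[OF this] show ?thesis using that by simp
  qed
  show "\<exists>d>0. \<forall>x'\<in>{a..b}. dist x' t < d \<longrightarrow> dist (f x') (f t) < e"
  proof (intro exI[of _ d] conjI ballI impI \<open>d > 0\<close>)
    fix y assume y: "y \<in> {a..b}" "dist y t < d"
    show "dist (f y) (f t) < e"
    proof (cases "t \<le> y")
      case True then show ?thesis using *[of t y] y t by (auto simp: dist_norm dist_real_def)
    next
      case False then show ?thesis using *[of y t] y t by (auto simp: dist_norm dist_real_def norm_minus_commute)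
    qed
  qed
qed

lemma le_one_add_square: "(x::real) \<le> 1 + x\<^sup>2"
proof -
  have "2 * x \<le> 1 + x\<^sup>2" using sum_squares_bound[of 1 x] by simp
  then show ?thesis using zero_le_power2[of x] by linarith
qed

text \<open>In terms of gauge integrals, membership is easily checked for controls that are reparametrised
  or glued together, without any argument about measurability.\<close>

lemma L2_controls_iff:
  "u \<in> L2_controls \<longleftrightarrow> u integrable_on {0..1} \<and> (\<lambda>s. norm (u s)) integrable_on {0..1}
     \<and> (\<lambda>s. (norm (u s))\<^sup>2) integrable_on {0..1}"
proof
  assume u: "u \<in> L2_controls"
  then have m: "u \<in> borel_measurable (lebesgue_on {0..1})"
    and sq: "integrable (lebesgue_on {0..1}) (\<lambda>s. (norm (u s))\<^sup>2)"
    by (auto simp: L2_controls_def)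
  have sq': "(\<lambda>s. (norm (u s))\<^sup>2) integrable_on {0..1}"
    using integrable_on_lebesgue_on[OF sq] by simp
  have "u absolutely_integrable_on {0..1}"
  proof (rule measurable_bounded_by_integrable_imp_absolutely_integrable[OF m])
    show "(\<lambda>s. 1 + (norm (u s))\<^sup>2) integrable_on {0..1}"
      using sq' by (intro integrable_add) auto
    show "norm (u x) \<le> 1 + (norm (u x))\<^sup>2" for x
      by (rule le_one_add_square)
  qed auto
  then show "u integrable_on {0..1} \<and> (\<lambda>s. norm (u s)) integrable_on {0..1}
     \<and> (\<lambda>s. (norm (u s))\<^sup>2) integrable_on {0..1}"
    using sq' by (simp add: absolutely_integrable_on_def)
next
  assume u: "u integrable_on {0..1} \<and> (\<lambda>s. norm (u s)) integrable_on {0..1}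
     \<and> (\<lambda>s. (norm (u s))\<^sup>2) integrable_on {0..1}"
  then have "u absolutely_integrable_on {0..1}" by (simp add: absolutely_integrable_on_def)
  then have "u \<in> borel_measurable (lebesgue_on {0..1})"
    by (rule absolutely_integrable_imp_borel_measurable) simp
  moreover have "(\<lambda>s. (norm (u s))\<^sup>2) absolutely_integrable_on {0..1}"
    using u by (intro nonnegative_absolutely_integrable_1) auto
  then have "integrable (lebesgue_on {0..1}) (\<lambda>s. (norm (u s))\<^sup>2)"
    by (rule absolutely_integrable_imp_integrable) auto
  ultimately show "u \<in> L2_controls" by (simp add: L2_controls_def)
qed

lemma L2_controlsD:
  assumes "u \<in> L2_controls"
  shows "u integrable_on {0..1}" "(\<lambda>s. norm (u s)) integrable_on {0..1}"
    "(\<lambda>s. (norm (u s))\<^sup>2) integrable_on {0..1}" "u absolutely_integrable_on {0..1}"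
  using assms by (simp_all add: L2_controls_iff absolutely_integrable_on_def)

lemma L2_norm_sq_eq: "u \<in> L2_controls \<Longrightarrow> L2_norm_sq u = integral {0..1} (\<lambda>s. (norm (u s))\<^sup>2)"
  unfolding L2_norm_sq_def L2_controls_def by (intro lebesgue_integral_eq_integral) auto

text \<open>Instead of the square root in the Cauchy--Schwarz inequality, \<open>2|u| \<le> 1 + |u|\<^sup>2\<close> suffices
  to bound the \<open>L\<^sup>1\<close> norm of a control by its \<open>L\<^sup>2\<close> norm.\<close>

lemma L1_norm_le:
  assumes "u \<in> L2_controls"
  shows "integral {0..1} (\<lambda>s. norm (u s)) \<le> 1 + L2_norm_sq u"
proof -
  have "integral {0..1} (\<lambda>s. norm (u s)) \<le> integral {0..1} (\<lambda>s. 1 + (norm (u s))\<^sup>2)"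
  proof (rule integral_le)
    show "norm (u x) \<le> 1 + (norm (u x))\<^sup>2" for x
      by (rule le_one_add_square)
  qed (use L2_controlsD[OF assms] in \<open>auto intro!: integrable_add\<close>)
  also have "\<dots> = 1 + L2_norm_sq u"
    using L2_controlsD(3)[OF assms]
      Henstock_Kurzweil_Integration.integral_add[OF integrable_const_ivl[of "1::real" 0 1] L2_controlsD(3)[OF assms]]
    by (simp add: L2_norm_sq_eq[OF assms])
  finally show ?thesis .
qed

lemma absolutely_integrable_scaleR_continuous:
  fixes y :: "real \<Rightarrow> 'a::euclidean_space" and g :: "real \<Rightarrow> real"
  assumes y: "continuous_on {a..b} y" and g: "g absolutely_integrable_on {a..b}"
  shows "(\<lambda>s. g s *\<^sub>R y s) absolutely_integrable_on {a..b}"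
proof (rule absolutely_integrable_bounded_measurable_product[where h = "\<lambda>x c. c *\<^sub>R x"])
  show "bilinear (\<lambda>x c::real. c *\<^sub>R (x::'a))"
    unfolding bilinear_def by (auto intro!: linearI simp: algebra_simps)
  show "y \<in> borel_measurable (lebesgue_on {a..b})"
    using y by (intro continuous_imp_measurable_on_sets_lebesgue) auto
  show "bounded (y ` {a..b})"
    using compact_continuous_image[OF y] compact_imp_bounded by blast
qed (use g in auto)

lemma integral_combine_real:
  fixes f :: "real \<Rightarrow> 'a::euclidean_space"
  assumes "f integrable_on {0..1}" "0 \<le> s" "s \<le> t" "t \<le> 1"
  shows "integral {0..t} f - integral {0..s} f = integral {s..t} f"
  using Henstock_Kurzweil_Integration.integral_combine[of 0 s t f] assms
    integrable_on_subinterval[OF assms(1), of 0 t] by (simp add: algebra_simps)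

lemma integral_nonneg_mono:
  fixes G :: "real \<Rightarrow> real"
  assumes "G integrable_on {0..1}" "\<And>s. s \<in> {0..1} \<Longrightarrow> 0 \<le> G s" "0 \<le> s" "s \<le> t" "t \<le> 1"
  shows "integral {0..s} G \<le> integral {0..t} G" "0 \<le> integral {s..t} G"
proof -
  show "0 \<le> integral {s..t} G"
    using assms by (intro Henstock_Kurzweil_Integration.integral_nonneg integrable_on_subinterval[OF assms(1)]) auto
  with integral_combine_real[OF assms(1,3-5)] show "integral {0..s} G \<le> integral {0..t} G" by linarith
qed

text \<open>The exponential weight \<open>exp (2 \<integral> G)\<close> turns integration against \<open>G\<close> into a contraction with
  factor \<open>1/2\<close>. Both the Gronwall inequality and the convergence of the Picard iteration rest
  on it.\<close>

lemma integral_exp_weight_le: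
  fixes G :: "real \<Rightarrow> real"
  assumes G: "G integrable_on {0..1}" and nonneg: "\<And>s. s \<in> {0..1} \<Longrightarrow> 0 \<le> G s" and t: "t \<in> {0..1}"
  shows "(\<lambda>s. G s * exp (2 * integral {0..s} G)) integrable_on {0..t}"
    and "integral {0..t} (\<lambda>s. G s * exp (2 * integral {0..s} G)) \<le> exp (2 * integral {0..t} G) / 2"
proof -
  define \<theta> where "\<theta> s = integral {0..s} G" for s
  define \<phi> where "\<phi> s = exp (2 * \<theta> s) / 2" for s
  have Gt: "G integrable_on {0..t}" using t by (intro integrable_on_subinterval[OF G]) auto
  obtain N where N: "negligible N"
    "\<And>s. s \<in> {0..t} - N \<Longrightarrow> (\<theta> has_vector_derivative G s) (at s within {0..t})"
    using primitive_has_derivative_ae[OF Gt] unfolding \<theta>_def by blast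
  define C where "C = exp (2 * \<theta> 1)"
  have "abs_continuous_on {0..t} \<phi>"
  proof (rule abs_continuous_on_dominated[where G = "\<lambda>s. C * G s"])
    show "(\<lambda>s. C * G s) integrable_on {0..t}" using Gt by (rule integrable_on_mult_right)
    show "0 \<le> C * G s" if "s \<in> {0..t}" for s using nonneg[of s] that t by (simp add: C_def)
    fix r s assume rs: "0 \<le> r" "r \<le> s" "s \<le> t"
    have mono: "\<theta> r \<le> \<theta> s" "\<theta> s \<le> \<theta> 1"
      unfolding \<theta>_def using rs t by (auto intro!: integral_nonneg_mono[OF G nonneg])
    have eq: "exp (2 * \<theta> s) - exp (2 * \<theta> r) = exp (2 * \<theta> s) * (1 - exp (2 * \<theta> r - 2 * \<theta> s))"
      by (simp add: right_diff_distrib exp_diff)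
    have "1 - exp (2 * \<theta> r - 2 * \<theta> s) \<le> 2 * \<theta> s - 2 * \<theta> r"
      using exp_ge_add_one_self[of "2 * \<theta> r - 2 * \<theta> s"] by linarith
    then have "exp (2 * \<theta> s) * (1 - exp (2 * \<theta> r - 2 * \<theta> s)) \<le> exp (2 * \<theta> s) * (2 * \<theta> s - 2 * \<theta> r)"
      by (rule mult_left_mono) simp
    also have "\<dots> \<le> C * (2 * \<theta> s - 2 * \<theta> r)"
      unfolding C_def using mono by (intro mult_right_mono) auto
    finally have "\<phi> s - \<phi> r \<le> C * (\<theta> s - \<theta> r)"
      unfolding \<phi>_def diff_divide_distrib[symmetric] eq by (simp add: right_diff_distrib)
    moreover have "\<phi> r \<le> \<phi> s" using mono by (simp add: \<phi>_def)
    ultimately have "norm (\<phi> s - \<phi> r) \<le> C * (\<theta> s - \<theta> r)" by simp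
    also have "\<theta> s - \<theta> r = integral {r..s} G"
      unfolding \<theta>_def using rs t by (intro integral_combine_real[OF G]) auto
    finally show "norm (\<phi> s - \<phi> r) \<le> integral {r..s} (\<lambda>s. C * G s)" by simp
  qed
  moreover have "(\<phi> has_vector_derivative (G s * exp (2 * \<theta> s))) (at s within {0..t})" if "s \<in> {0..t} - N" for s
  proof -
    have "(\<theta> has_real_derivative G s) (at s within {0..t})"
      using N(2)[OF that] by (simp add: has_real_derivative_iff_has_vector_derivative)
    then have "(\<phi> has_real_derivative (G s * exp (2 * \<theta> s))) (at s within {0..t})"
      unfolding \<phi>_def by (auto intro!: derivative_eq_intros)
    then show ?thesis by (simp add: has_real_derivative_iff_has_vector_derivative)
  qed
  ultimately have I: "((\<lambda>s. G s * exp (2 * \<theta> s)) has_integral (\<phi> t - \<phi> 0)) {0..t}"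
    using t by (intro abs_continuous_ftc[OF _ N(1)]) auto
  then show "(\<lambda>s. G s * exp (2 * integral {0..s} G)) integrable_on {0..t}"
    unfolding \<theta>_def by blast
  have "integral {0..t} (\<lambda>s. G s * exp (2 * \<theta> s)) = \<phi> t - \<phi> 0" using I by (rule integral_unique)
  then show "integral {0..t} (\<lambda>s. G s * exp (2 * integral {0..s} G)) \<le> exp (2 * integral {0..t} G) / 2"
    unfolding \<theta>_def \<phi>_def by simp
qed

lemma gronwall:
  fixes G d :: "real \<Rightarrow> real"
  assumes G: "G integrable_on {0..1}" and nonneg: "\<And>s. s \<in> {0..1} \<Longrightarrow> 0 \<le> G s"
    and d: "continuous_on {0..1} d" and "0 \<le> a"
    and le: "\<And>t. t \<in> {0..1} \<Longrightarrow> d t \<le> a + integral {0..t} (\<lambda>s. G s * d s)"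
    and t: "t \<in> {0..1}"
  shows "d t \<le> 2 * a * exp (2 * integral {0..1} G)"
proof -
  define \<theta> where "\<theta> s = integral {0..s} G" for s
  have \<theta>c: "continuous_on {0..1} \<theta>"
    unfolding \<theta>_def using indefinite_integral_continuous_1[OF G] .
  have dc: "continuous_on {0..1} (\<lambda>s. d s * exp (- (2 * \<theta> s)))"
    using d \<theta>c by (intro continuous_intros)
  then obtain t0 where t0: "t0 \<in> {0..1}" and
    max: "\<And>s. s \<in> {0..1} \<Longrightarrow> d s * exp (- (2 * \<theta> s)) \<le> d t0 * exp (- (2 * \<theta> t0))"
    using continuous_attains_sup[OF compact_Icc _ dc] by auto
  define m where "m = d t0 * exp (- (2 * \<theta> t0))"
  have ds: "d s \<le> m * exp (2 * \<theta> s)" if "s \<in> {0..1}" for s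
    using max[OF that] unfolding m_def[symmetric] by (simp add: exp_minus field_simps)
  have "m \<le> 2 * a"
  proof (cases "m \<le> 0")
    case True then show ?thesis using \<open>0 \<le> a\<close> by linarith
  next
    case False
    have "integral {0..t0} (\<lambda>s. G s * d s) \<le> integral {0..t0} (\<lambda>s. m * (G s * exp (2 * \<theta> s)))"
    proof (rule integral_le)
      have "G absolutely_integrable_on {0..1}" using nonneg by (intro nonnegative_absolutely_integrable_1 G) auto
      then have "(\<lambda>s. G s *\<^sub>R d s) absolutely_integrable_on {0..1}"
        by (rule absolutely_integrable_scaleR_continuous[OF d])
      then have "(\<lambda>s. G s * d s) integrable_on {0..1}"
        unfolding real_scaleR_def by (rule set_lebesgue_integral_eq_integral(1))
      then show "(\<lambda>s. G s * d s) integrable_on {0..t0}"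
        using t0 by (rule_tac integrable_on_subinterval) auto
      show "(\<lambda>s. m * (G s * exp (2 * \<theta> s))) integrable_on {0..t0}"
        unfolding \<theta>_def by (intro integrable_on_mult_right integral_exp_weight_le(1)[OF G nonneg t0])
      show "G s * d s \<le> m * (G s * exp (2 * \<theta> s))" if "s \<in> {0..t0}" for s
      proof -
        have "G s * d s \<le> G s * (m * exp (2 * \<theta> s))"
          using ds[of s] nonneg[of s] that t0 by (intro mult_left_mono) auto
        then show ?thesis by (simp add: mult.left_commute)
      qed
    qed
    also have "\<dots> = m * integral {0..t0} (\<lambda>s. G s * exp (2 * \<theta> s))" by simp
    also have "\<dots> \<le> m * (exp (2 * \<theta> t0) / 2)"
      unfolding \<theta>_def using False by (intro mult_left_mono integral_exp_weight_le(2)[OF G nonneg t0]) auto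
    finally have "d t0 \<le> a + m * exp (2 * \<theta> t0) / 2" using le[OF t0] by simp
    moreover have "d t0 = m * exp (2 * \<theta> t0)" by (simp add: m_def exp_minus)
    ultimately have "m * exp (2 * \<theta> t0) \<le> 2 * a" by linarith
    moreover have "0 \<le> \<theta> t0" using integral_nonneg_mono(2)[OF G nonneg, of 0 t0] t0 by (simp add: \<theta>_def)
    then have "m * 1 \<le> m * exp (2 * \<theta> t0)" using False by (intro mult_left_mono) auto
    ultimately show ?thesis by linarith
  qed
  then have "d t \<le> 2 * a * exp (2 * \<theta> t)"
    using ds[OF t] by (meson exp_ge_zero mult_right_mono order_trans)
  also have "\<dots> \<le> 2 * a * exp (2 * \<theta> 1)"
    using \<open>0 \<le> a\<close> integral_nonneg_mono(1)[OF G nonneg, of t 1] t by (intro mult_left_mono) (auto simp: \<theta>_def)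
  finally show ?thesis by (simp add: \<theta>_def)
qed

section \<open>Flows of bounded Lipschitz fields\<close>

text \<open>Global bounds and Lipschitz constants are all that the theory of the initial value problem needs from the
  fields; they are extracted from smoothness with bounded derivatives at the very end.\<close>

locale control_system =
  fixes F :: "'l::finite \<Rightarrow> 'a \<Rightarrow> 'a::euclidean_space" and M L :: real
  assumes F_bound: "norm (F i x) \<le> M"
    and F_lipschitz: "norm (F i x - F i y) \<le> L * norm (x - y)"
    and L_nonneg: "0 \<le> L"
begin

definition velocity :: "real ^ 'l \<Rightarrow> 'a \<Rightarrow> 'a" where
  "velocity w x = (\<Sum>i\<in>UNIV. (w $ i) *\<^sub>R F i x)"

definition B where "B = real CARD('l) * M"
definition \<Lambda> where "\<Lambda> = real CARD('l) * L"

lemma M_nonneg: "0 \<le> M" using F_bound norm_ge_zero order_trans by blast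
lemma B_nonneg: "0 \<le> B" using M_nonneg by (simp add: B_def)
lemma \<Lambda>_nonneg: "0 \<le> \<Lambda>" using L_nonneg by (simp add: \<Lambda>_def)

lemma velocity_bound: "norm (velocity w x) \<le> B * norm w"
proof -
  have "norm (velocity w x) \<le> (\<Sum>i\<in>(UNIV::'l set). norm w * M)"
    unfolding velocity_def
  proof (rule sum_norm_le)
    show "norm ((w $ i) *\<^sub>R F i x) \<le> norm w * M" for i
      using F_bound[of i x] component_le_norm_cart[of w i] by (simp add: mult_mono)
  qed
  then show ?thesis by (simp add: B_def algebra_simps)
qed

lemma velocity_lipschitz: "norm (velocity w x - velocity w y) \<le> \<Lambda> * norm w * norm (x - y)"
proof -
  have "velocity w x - velocity w y = (\<Sum>i\<in>UNIV. (w $ i) *\<^sub>R (F i x - F i y))"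
    by (simp add: velocity_def scaleR_diff_right sum_subtractf)
  also have "norm \<dots> \<le> (\<Sum>i\<in>(UNIV::'l set). norm w * (L * norm (x - y)))"
  proof (rule sum_norm_le)
    show "norm ((w $ i) *\<^sub>R (F i x - F i y)) \<le> norm w * (L * norm (x - y))" for i
      using F_lipschitz[of i x y] component_le_norm_cart[of w i] by (simp add: mult_mono)
  qed
  finally show ?thesis by (simp add: \<Lambda>_def algebra_simps)
qed

lemma F_continuous: "continuous_on S (F i)"
proof (rule lipschitz_on_continuous_on[of L])
  show "L-lipschitz_on S (F i)"
    using F_lipschitz L_nonneg by (auto simp: lipschitz_on_def dist_norm)
qed

lemma velocity_integrable:
  assumes u: "u \<in> L2_controls" and x: "continuous_on {0..1} x"
  shows "(\<lambda>s. velocity (u s) (x s)) absolutely_integrable_on {0..1}"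
    "0 \<le> a \<Longrightarrow> b \<le> 1 \<Longrightarrow> (\<lambda>s. velocity (u s) (x s)) integrable_on {a..b}"
proof -
  show *: "(\<lambda>s. velocity (u s) (x s)) absolutely_integrable_on {0..1}"
    unfolding velocity_def
  proof (intro absolutely_integrable_sum absolutely_integrable_scaleR_continuous)
    show "continuous_on {0..1} (\<lambda>s. F i (x s))" for i
      using continuous_on_compose2[OF F_continuous x] by blast
    show "(\<lambda>s. u s $ i) absolutely_integrable_on {0..1}" for i
      using absolutely_integrable_component[OF L2_controlsD(4)[OF u], of "axis i 1"]
      by (simp add: inner_axis)
  qed simp
  show "0 \<le> a \<Longrightarrow> b \<le> 1 \<Longrightarrow> (\<lambda>s. velocity (u s) (x s)) integrable_on {a..b}"
    using set_lebesgue_integral_eq_integral(1)[OF *] by (rule integrable_on_subinterval) auto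
qed

definition integral_solution :: "(real \<Rightarrow> real ^ 'l) \<Rightarrow> 'a \<Rightarrow> (real \<Rightarrow> 'a) \<Rightarrow> bool" where
  "integral_solution u x0 x \<longleftrightarrow> continuous_on {0..1} x \<and>
     (\<forall>t\<in>{0..1}. x t = x0 + integral {0..t} (\<lambda>s. velocity (u s) (x s)))"

lemma integral_solutionD:
  assumes "integral_solution u x0 x"
  shows "continuous_on {0..1} x" "x 0 = x0"
    "t \<in> {0..1} \<Longrightarrow> x t = x0 + integral {0..t} (\<lambda>s. velocity (u s) (x s))"
proof -
  show "continuous_on {0..1} x"
    using assms unfolding integral_solution_def by (rule conjunct1)
  have eq: "x t = x0 + integral {0..t} (\<lambda>s. velocity (u s) (x s))" if "t \<in> {0..1}" for t
    using assms that unfolding integral_solution_def by blast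
  show "x 0 = x0" using eq[of 0] by simp
  show "t \<in> {0..1} \<Longrightarrow> x t = x0 + integral {0..t} (\<lambda>s. velocity (u s) (x s))" by (rule eq)
qed

lemma velocity_integral_le:
  assumes u: "u \<in> L2_controls" and x: "continuous_on {0..1} x" and "0 \<le> s" "s \<le> t" "t \<le> 1"
  shows "norm (integral {s..t} (\<lambda>r. velocity (u r) (x r))) \<le> integral {s..t} (\<lambda>r. B * norm (u r))"
proof (rule integral_norm_bound_integral)
  show "(\<lambda>r. velocity (u r) (x r)) integrable_on {s..t}"
    by (rule velocity_integrable(2)[OF u x]) fact+
  have "(\<lambda>r. norm (u r)) integrable_on {s..t}"
    using assms(3-5) by (intro integrable_on_subinterval[OF L2_controlsD(2)[OF u]]) auto
  then show "(\<lambda>r. B * norm (u r)) integrable_on {s..t}" by (rule integrable_on_mult_right)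
qed (rule velocity_bound)

lemma caratheodory_solution_iff:
  assumes u: "u \<in> L2_controls"
  shows "caratheodory_solution F u x0 x \<longleftrightarrow> integral_solution u x0 x"
proof
  assume "caratheodory_solution F u x0 x"
  then have ac: "abs_continuous_on {0..1} x" and x0: "x 0 = x0" and
    "AE s in lebesgue_on {0..1}. (x has_vector_derivative velocity (u s) (x s)) (at s within {0..1})"
    unfolding caratheodory_solution_def velocity_def by auto
  then obtain N where N: "negligible N"
    "\<And>s. s \<in> {0..1} - N \<Longrightarrow> (x has_vector_derivative velocity (u s) (x s)) (at s within {0..1})"
    by (subst (asm) AE_lebesgue_on_iff_negligible) auto
  have "((\<lambda>s. velocity (u s) (x s)) has_integral (x t - x 0)) {0..t}" if t: "t \<in> {0..1}" for t
  proof (rule abs_continuous_ftc[OF abs_continuous_on_subset[OF ac] N(1)])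
    show "(x has_vector_derivative velocity (u s) (x s)) (at s within {0..t})" if "s \<in> {0..t} - N" for s
      using that t by (intro has_vector_derivative_within_subset[OF N(2)]) auto
  qed (use t in auto)
  then have "integral {0..t} (\<lambda>s. velocity (u s) (x s)) = x t - x0" if "t \<in> {0..1}" for t
    using that x0 by (metis integral_unique)
  then show "integral_solution u x0 x"
    unfolding integral_solution_def using abs_continuous_on_imp_continuous_on[OF ac] by simp
next
  assume sol: "integral_solution u x0 x"
  note solD = integral_solutionD[OF sol]
  let ?v = "\<lambda>s. velocity (u s) (x s)"
  have v: "?v integrable_on {0..1}" using velocity_integrable(2)[OF u solD(1)] by simp
  have "abs_continuous_on {0..1} x"
  proof (rule abs_continuous_on_dominated)
    show "(\<lambda>r. B * norm (u r)) integrable_on {0..1}"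
      using L2_controlsD(2)[OF u] by (rule integrable_on_mult_right)
    show "0 \<le> B * norm (u r)" for r using B_nonneg by simp
    fix s t :: real assume st: "0 \<le> s" "s \<le> t" "t \<le> 1"
    then have "x t - x s = integral {s..t} ?v"
      using solD(3)[of s] solD(3)[of t] integral_combine_real[OF v st] by simp
    then show "norm (x t - x s) \<le> integral {s..t} (\<lambda>r. B * norm (u r))"
      using velocity_integral_le[OF u solD(1) st] by simp
  qed
  moreover obtain N where N: "negligible N"
    "\<And>t. t \<in> {0..1} - N \<Longrightarrow> ((\<lambda>t. integral {0..t} ?v) has_vector_derivative ?v t) (at t within {0..1})"
    using primitive_has_derivative_ae[OF v] by blast
  have "(x has_vector_derivative ?v t) (at t within {0..1})" if t: "t \<in> {0..1} - N" for t
  proof (rule has_vector_derivative_transform)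
    show "((\<lambda>t. x0 + integral {0..t} ?v) has_vector_derivative ?v t) (at t within {0..1})"
      using N(2)[OF t] by (auto intro!: derivative_eq_intros)
    show "x s = x0 + integral {0..s} ?v" if "s \<in> {0..1}" for s using solD(3)[OF that] .
  qed (use t in auto)
  then have "AE s in lebesgue_on {0..1}. (x has_vector_derivative ?v s) (at s within {0..1})"
    using N(1) by (subst AE_lebesgue_on_iff_negligible) auto
  ultimately show "caratheodory_solution F u x0 x"
    unfolding caratheodory_solution_def using solD(2) unfolding velocity_def by blast
qed

lemma gronwall_velocity:
  assumes u: "u \<in> L2_controls" and d: "continuous_on {0..1} d" and "0 \<le> a"
    and le: "\<And>t. t \<in> {0..1} \<Longrightarrow> d t \<le> a + integral {0..t} (\<lambda>s. \<Lambda> * norm (u s) * d s)"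
    and t: "t \<in> {0..1}"
  shows "d t \<le> 2 * a * exp (2 * \<Lambda> * integral {0..1} (\<lambda>s. norm (u s)))"
proof -
  have "d t \<le> 2 * a * exp (2 * integral {0..1} (\<lambda>s. \<Lambda> * norm (u s)))"
    using \<Lambda>_nonneg by (intro gronwall[OF _ _ d \<open>0 \<le> a\<close> le t] integrable_on_mult_right L2_controlsD(2)[OF u]) auto
  then show ?thesis by (simp add: mult.assoc)
qed

text \<open>Gronwall's inequality for two curves driven by the same control. The error \<open>a\<close> is the
  difference of the starting points when both curves are trajectories, and the effect of changing the control
  when one of them is a trajectory of another control.\<close>

lemma trajectories_close:
  assumes u: "u \<in> L2_controls" and x: "continuous_on {0..1} x" and y: "continuous_on {0..1} y" and "0 \<le> a"
    and close: "\<And>t. t \<in> {0..1} \<Longrightarrow>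
      norm ((x t - y t) - integral {0..t} (\<lambda>s. velocity (u s) (x s) - velocity (u s) (y s))) \<le> a"
    and t: "t \<in> {0..1}"
  shows "norm (x t - y t) \<le> 2 * a * exp (2 * \<Lambda> * integral {0..1} (\<lambda>s. norm (u s)))"
proof (rule gronwall_velocity[OF u _ \<open>0 \<le> a\<close> _ t])
  show d: "continuous_on {0..1} (\<lambda>t. norm (x t - y t))" using x y by (intro continuous_intros)
  fix t :: real assume t: "t \<in> {0..1}"
  let ?I = "integral {0..t} (\<lambda>s. velocity (u s) (x s) - velocity (u s) (y s))"
  have "(\<lambda>s. norm (u s)) absolutely_integrable_on {0..1}"
    by (intro nonnegative_absolutely_integrable_1 L2_controlsD(2)[OF u]) auto
  then have "(\<lambda>s. norm (u s) *\<^sub>R norm (x s - y s)) integrable_on {0..1}"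
    using absolutely_integrable_scaleR_continuous[OF d] set_lebesgue_integral_eq_integral(1) by blast
  then have "(\<lambda>s. \<Lambda> * (norm (u s) *\<^sub>R norm (x s - y s))) integrable_on {0..1}"
    by (rule integrable_on_mult_right)
  then have int: "(\<lambda>s. \<Lambda> * norm (u s) * norm (x s - y s)) integrable_on {0..t}"
    unfolding real_scaleR_def mult.assoc by (rule integrable_on_subinterval) (use t in auto)
  have "norm ?I \<le> integral {0..t} (\<lambda>s. \<Lambda> * norm (u s) * norm (x s - y s))"
  proof (rule integral_norm_bound_integral[OF _ int])
    show "(\<lambda>s. velocity (u s) (x s) - velocity (u s) (y s)) integrable_on {0..t}"
      using t by (intro integrable_diff velocity_integrable(2)[OF u] x y) auto
  qed (rule velocity_lipschitz)
  then show "norm (x t - y t) \<le> a + integral {0..t} (\<lambda>s. \<Lambda> * norm (u s) * norm (x s - y s))"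
    using close[OF t] norm_triangle_sub[of "x t - y t" ?I] by linarith
qed

lemma integral_solution_dependence:
  assumes u: "u \<in> L2_controls" and x: "integral_solution u x0 x" and y: "integral_solution u y0 y"
    and t: "t \<in> {0..1}"
  shows "norm (x t - y t) \<le> 2 * norm (x0 - y0) * exp (2 * \<Lambda> * integral {0..1} (\<lambda>s. norm (u s)))"
proof (rule trajectories_close[OF u integral_solutionD(1)[OF x] integral_solutionD(1)[OF y] _ _ t])
  fix t :: real assume t: "t \<in> {0..1}"
  have "integral {0..t} (\<lambda>s. velocity (u s) (x s) - velocity (u s) (y s))
      = integral {0..t} (\<lambda>s. velocity (u s) (x s)) - integral {0..t} (\<lambda>s. velocity (u s) (y s))"
    using t integral_solutionD(1)[OF x] integral_solutionD(1)[OF y]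
    by (intro Henstock_Kurzweil_Integration.integral_diff velocity_integrable(2)[OF u]) auto
  then show "norm ((x t - y t) - integral {0..t} (\<lambda>s. velocity (u s) (x s) - velocity (u s) (y s))) \<le> norm (x0 - y0)"
    using integral_solutionD(3)[OF x t] integral_solutionD(3)[OF y t] by simp
qed auto

text \<open>Picard iteration. In the norm weighted by \<open>exp (2 \<integral> \<Lambda> |u|)\<close> each step halves the distance of
  consecutive iterates, so that the iteration converges on all of \<open>[0,1]\<close> at once.\<close>

lemma integral_solution_exists:
  assumes u: "u \<in> L2_controls"
  shows "\<exists>x. integral_solution u x0 x"
proof -
  define X where "X n = rec_nat (\<lambda>_. x0) (\<lambda>_ x t. x0 + integral {0..t} (\<lambda>s. velocity (u s) (x s))) n" for n :: nat
  have X0: "X 0 = (\<lambda>_. x0)" and XS: "X (Suc n) t = x0 + integral {0..t} (\<lambda>s. velocity (u s) (X n s))" for n t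
    by (auto simp: X_def)
  have Xc: "continuous_on {0..1} (X n)" for n
  proof (induction n)
    case (Suc n)
    have "continuous_on {0..1} (\<lambda>t. x0 + integral {0..t} (\<lambda>s. velocity (u s) (X n s)))"
      by (intro continuous_intros indefinite_integral_continuous_1 velocity_integrable(2)[OF u Suc]) auto
    then show ?case using XS by presburger
  qed (simp add: X0)
  define G where "G s = \<Lambda> * norm (u s)" for s
  have G: "G integrable_on {0..1}" unfolding G_def by (intro integrable_on_mult_right L2_controlsD(2)[OF u])
  have Gn: "0 \<le> G s" for s using \<Lambda>_nonneg by (simp add: G_def)
  define \<theta> where "\<theta> s = integral {0..s} G" for s
  define c where "c = B * integral {0..1} (\<lambda>s. norm (u s))"
  have un: "0 \<le> integral {0..1} (\<lambda>s. norm (u s))"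
    by (intro Henstock_Kurzweil_Integration.integral_nonneg L2_controlsD(2)[OF u]) auto
  have c0: "0 \<le> c" unfolding c_def using B_nonneg un by simp
  have step: "norm (X (Suc n) t - X n t) \<le> c * exp (2 * \<theta> t) / 2 ^ n" if "t \<in> {0..1}" for n t
    using that
  proof (induction n arbitrary: t)
    case 0
    have "norm (X (Suc 0) t - X 0 t) \<le> integral {0..t} (\<lambda>r. B * norm (u r))"
      using velocity_integral_le[OF u, of "\<lambda>_. x0" 0 t] 0 by (simp add: XS X0)
    also have "\<dots> \<le> integral {0..1} (\<lambda>r. B * norm (u r))"
      using 0 B_nonneg by (intro integral_nonneg_mono(1) integrable_on_mult_right L2_controlsD(2)[OF u]) auto
    also have "\<dots> = c * 1" by (simp add: c_def)
    also have "\<dots> \<le> c * exp (2 * \<theta> t)"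
      using 0 c0 integral_nonneg_mono(2)[OF G Gn, of 0 t] by (intro mult_left_mono) (auto simp: \<theta>_def)
    finally show ?case by simp
  next
    case (Suc n)
    have "X (Suc (Suc n)) t - X (Suc n) t = integral {0..t} (\<lambda>s. velocity (u s) (X (Suc n) s)) - integral {0..t} (\<lambda>s. velocity (u s) (X n s))"
      unfolding XS[of "Suc n"] XS[of n] by (simp only: add_diff_cancel_left)
    also have "\<dots> = integral {0..t} (\<lambda>s. velocity (u s) (X (Suc n) s) - velocity (u s) (X n s))"
      using Suc.prems by (intro Henstock_Kurzweil_Integration.integral_diff[symmetric] velocity_integrable(2)[OF u Xc]) auto
    also have "norm \<dots> \<le> integral {0..t} (\<lambda>s. (c / 2 ^ n) * (G s * exp (2 * \<theta> s)))"
    proof (rule integral_norm_bound_integral)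
      show "(\<lambda>s. velocity (u s) (X (Suc n) s) - velocity (u s) (X n s)) integrable_on {0..t}"
        using Suc.prems by (intro integrable_diff velocity_integrable(2)[OF u Xc]) auto
      show "(\<lambda>s. (c / 2 ^ n) * (G s * exp (2 * \<theta> s))) integrable_on {0..t}"
        unfolding \<theta>_def by (intro integrable_on_mult_right integral_exp_weight_le(1)[OF G Gn Suc.prems])
      show "norm (velocity (u s) (X (Suc n) s) - velocity (u s) (X n s)) \<le> (c / 2 ^ n) * (G s * exp (2 * \<theta> s))"
        if "s \<in> {0..t}" for s
      proof -
        have "norm (velocity (u s) (X (Suc n) s) - velocity (u s) (X n s)) \<le> G s * norm (X (Suc n) s - X n s)"
          using velocity_lipschitz[of "u s"] by (simp add: G_def)
        also have "\<dots> \<le> G s * (c * exp (2 * \<theta> s) / 2 ^ n)"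
          using Suc.IH[of s] Suc.prems that Gn by (intro mult_left_mono) auto
        finally show ?thesis by (simp add: mult_ac)
      qed
    qed
    also have "\<dots> = (c / 2 ^ n) * integral {0..t} (\<lambda>s. G s * exp (2 * \<theta> s))" by simp
    also have "\<dots> \<le> (c / 2 ^ n) * (exp (2 * \<theta> t) / 2)"
      unfolding \<theta>_def using c0 by (intro mult_left_mono integral_exp_weight_le(2)[OF G Gn Suc.prems]) auto
    finally show ?case by (simp add: mult_ac)
  qed
  define C where "C = c * exp (2 * \<theta> 1)"
  have stepC: "norm (X (Suc n) t - X n t) \<le> C * (1/2) ^ n" if "t \<in> {0..1}" for n t
  proof -
    have "\<theta> t \<le> \<theta> 1" unfolding \<theta>_def using that by (intro integral_nonneg_mono(1)[OF G Gn]) auto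
    then have "c * exp (2 * \<theta> t) / 2 ^ n \<le> C / 2 ^ n"
      unfolding C_def using c0 by (intro divide_right_mono mult_left_mono) auto
    moreover have "C / 2 ^ n = C * (1/2) ^ n" by (simp add: power_one_over)
    ultimately show ?thesis using step[OF that, of n] by linarith
  qed
  define x where "x t = x0 + (\<Sum>n. X (Suc n) t - X n t)" for t
  have tele: "(\<Sum>i<n. X (Suc i) t - X i t) = X n t - x0" for n t
    by (induction n) (simp_all add: X0)
  have "uniform_limit {0..1} (\<lambda>n t. \<Sum>i<n. X (Suc i) t - X i t) (\<lambda>t. \<Sum>n. X (Suc n) t - X n t) sequentially"
  proof (rule Weierstrass_m_test[where M = "\<lambda>n. C * (1/2) ^ n"])
    show "norm (X (Suc n) t - X n t) \<le> C * (1/2) ^ n" if "t \<in> {0..1}" for n t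
      using that by (rule stepC)
    show "summable (\<lambda>n. C * (1/2::real) ^ n)" by (intro summable_mult summable_geometric) simp
  qed
  then have ul: "uniform_limit {0..1} X x sequentially"
    unfolding tele x_def uniform_limit_iff dist_norm by (simp only: diff_diff_eq)
  have xc: "continuous_on {0..1} x"
    by (rule uniform_limit_theorem[OF _ ul]) (auto simp: Xc)
  have "x t = x0 + integral {0..t} (\<lambda>s. velocity (u s) (x s))" if t: "t \<in> {0..1}" for t
  proof (rule LIMSEQ_unique)
    show "(\<lambda>n. X (Suc n) t) \<longlonglongrightarrow> x t"
      using tendsto_uniform_limitI[OF ul t] by (rule LIMSEQ_Suc)
    have "(\<lambda>n. integral {0..t} (\<lambda>s. velocity (u s) (X n s))) \<longlonglongrightarrow> integral {0..t} (\<lambda>s. velocity (u s) (x s))"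
    proof (rule LIMSEQ_I)
      fix r :: real assume "0 < r"
      define D where "D = 1 + \<Lambda> * integral {0..1} (\<lambda>s. norm (u s))"
      have "D > 0" unfolding D_def using \<Lambda>_nonneg un by (simp add: add_pos_nonneg)
      then have "eventually (\<lambda>n. \<forall>s\<in>{0..1}. dist (X n s) (x s) < r / D) sequentially"
        using ul \<open>0 < r\<close> unfolding uniform_limit_iff by auto
      then obtain n0 where n0: "\<And>n s. n \<ge> n0 \<Longrightarrow> s \<in> {0..1} \<Longrightarrow> norm (X n s - x s) < r / D"
        unfolding eventually_sequentially dist_norm by blast
      have "norm (integral {0..t} (\<lambda>s. velocity (u s) (X n s)) - integral {0..t} (\<lambda>s. velocity (u s) (x s))) < r" if n: "n \<ge> n0" for n
      proof -
        have "integral {0..t} (\<lambda>s. velocity (u s) (X n s)) - integral {0..t} (\<lambda>s. velocity (u s) (x s))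
            = integral {0..t} (\<lambda>s. velocity (u s) (X n s) - velocity (u s) (x s))"
          using t by (intro Henstock_Kurzweil_Integration.integral_diff[symmetric] velocity_integrable(2)[OF u] Xc xc) auto
        also have "norm \<dots> \<le> integral {0..t} (\<lambda>s. (r / D) * (\<Lambda> * norm (u s)))"
        proof (rule integral_norm_bound_integral)
          show "(\<lambda>s. velocity (u s) (X n s) - velocity (u s) (x s)) integrable_on {0..t}"
            using t by (intro integrable_diff velocity_integrable(2)[OF u] Xc xc) auto
          show "(\<lambda>s. (r / D) * (\<Lambda> * norm (u s))) integrable_on {0..t}"
            using t by (intro integrable_on_mult_right integrable_on_subinterval[OF L2_controlsD(2)[OF u]]) auto
          show "norm (velocity (u s) (X n s) - velocity (u s) (x s)) \<le> (r / D) * (\<Lambda> * norm (u s))" if "s \<in> {0..t}" for s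
          proof -
            have "norm (velocity (u s) (X n s) - velocity (u s) (x s)) \<le> \<Lambda> * norm (u s) * norm (X n s - x s)"
              by (rule velocity_lipschitz)
            also have "\<dots> \<le> \<Lambda> * norm (u s) * (r / D)"
              using n0[OF n, of s] that t \<Lambda>_nonneg by (intro mult_left_mono) auto
            finally show ?thesis by (simp add: mult.commute)
          qed
        qed
        also have "\<dots> \<le> integral {0..1} (\<lambda>s. (r / D) * (\<Lambda> * norm (u s)))"
          using t \<open>0 < r\<close> \<open>0 < D\<close> \<Lambda>_nonneg by (intro integral_nonneg_mono(1) integrable_on_mult_right L2_controlsD(2)[OF u]) auto
        also have "\<dots> = (r / D) * (D - 1)" by (simp add: D_def)
        also have "\<dots> < (r / D) * D" using \<open>0 < r\<close> \<open>0 < D\<close> by (intro mult_strict_left_mono) auto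
        finally show ?thesis using \<open>0 < D\<close> by simp
      qed
      then show "\<exists>no. \<forall>n\<ge>no. norm (integral {0..t} (\<lambda>s. velocity (u s) (X n s)) - integral {0..t} (\<lambda>s. velocity (u s) (x s))) < r"
        by blast
    qed
    then show "(\<lambda>n. X (Suc n) t) \<longlonglongrightarrow> x0 + integral {0..t} (\<lambda>s. velocity (u s) (x s))"
      unfolding XS by (intro tendsto_add tendsto_const)
  qed
  then show ?thesis using xc unfolding integral_solution_def by blast
qed

lemma flow_eq:
  assumes u: "u \<in> L2_controls" and x: "integral_solution u x0 x"
  shows "flow F u x0 = x 1"
  unfolding flow_def
proof (rule the_equality)
  show "\<exists>x'. caratheodory_solution F u x0 x' \<and> x' 1 = x 1"
    using x caratheodory_solution_iff[OF u] by blast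
  fix y assume "\<exists>x. caratheodory_solution F u x0 x \<and> x 1 = y"
  then obtain x' where "integral_solution u x0 x'" "x' 1 = y" using caratheodory_solution_iff[OF u] by blast
  then show "y = x 1" using integral_solution_dependence[OF u x, of x0 x' 1] by simp
qed

definition traj :: "(real \<Rightarrow> real ^ 'l) \<Rightarrow> 'a \<Rightarrow> real \<Rightarrow> 'a" where
  "traj u x0 = (SOME x. integral_solution u x0 x)"

lemma traj: "u \<in> L2_controls \<Longrightarrow> integral_solution u x0 (traj u x0)"
  unfolding traj_def using integral_solution_exists[of u x0] by (rule someI_ex)

lemma flow_traj: "u \<in> L2_controls \<Longrightarrow> flow F u x0 = traj u x0 1"
  using flow_eq traj by blast

lemma traj_displacement:
  assumes u: "u \<in> L2_controls" and t: "t \<in> {0..1}"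
  shows "norm (traj u x0 t - x0) \<le> B * integral {0..1} (\<lambda>s. norm (u s))"
proof -
  have "traj u x0 t - x0 = integral {0..t} (\<lambda>s. velocity (u s) (traj u x0 s))"
    using integral_solutionD(3)[OF traj[OF u] t, of x0] by simp
  also have "norm \<dots> \<le> integral {0..t} (\<lambda>r. B * norm (u r))"
    using velocity_integral_le[OF u integral_solutionD(1)[OF traj[OF u, of x0]], of 0 t] t by simp
  also have "\<dots> \<le> integral {0..1} (\<lambda>r. B * norm (u r))"
    using t B_nonneg by (intro integral_nonneg_mono(1) integrable_on_mult_right L2_controlsD(2)[OF u]) auto
  finally show ?thesis by simp
qed

lemma flow_lipschitz:
  "u \<in> L2_controls \<Longrightarrow>
     norm (flow F u x - flow F u y) \<le> 2 * norm (x - y) * exp (2 * \<Lambda> * integral {0..1} (\<lambda>s. norm (u s)))"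
  using integral_solution_dependence[OF _ traj traj, of u 1 x y] by (simp add: flow_traj)

lemma flow_continuous:
  assumes "u \<in> L2_controls"
  shows "continuous_on S (flow F u)"
proof (rule lipschitz_on_continuous_on)
  show "(2 * exp (2 * \<Lambda> * integral {0..1} (\<lambda>s. norm (u s))))-lipschitz_on S (flow F u)"
    using flow_lipschitz[OF assms] by (auto simp: lipschitz_on_def dist_norm mult_ac)
qed

end

section \<open>Calculus of continuously differentiable maps\<close>

lemma Ck_on_Suc_imp: "Ck_on (Suc k) T f \<Longrightarrow> Ck_on k T f"
proof (induction k arbitrary: f)
  case 0
  then show ?case
    by (auto intro!: continuous_at_imp_continuous_on differentiable_imp_continuous_within)
next
  case (Suc k)
  have "Ck_on k T (dir_deriv e f)" if "e \<in> Basis" for e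
    using Suc.prems that by (intro Suc.IH) simp
  then show ?case using Suc.prems by simp
qed

lemma Ck_on_le: "k \<le> m \<Longrightarrow> Ck_on m T f \<Longrightarrow> Ck_on k T f"
  by (induction rule: inc_induct) (auto intro: Ck_on_Suc_imp simp del: Ck_on.simps)

lemma Ck_on_imp_continuous_on: "Ck_on k T f \<Longrightarrow> continuous_on T f"
  using Ck_on_le[of 0 k T f] by simp

lemma Ck_on_SucD:
  assumes "Ck_on (Suc k) T f"
  shows "x \<in> T \<Longrightarrow> (f has_derivative frechet_derivative f (at x)) (at x)"
    and "e \<in> Basis \<Longrightarrow> Ck_on k T (dir_deriv e f)"
  using assms by (simp_all add: frechet_derivative_works[symmetric])

text \<open>The derivative of \<open>f\<close> is usually known only on \<open>T\<close>. The last premise, invariance under a change of the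
  function outside \<open>T\<close> one order below, is kept as a premise since it is proved by induction with the
  help of this lemma.\<close>

lemma Ck_on_SucI:
  fixes f :: "'a::euclidean_space \<Rightarrow> 'b::real_normed_vector"
  assumes "open T" and f: "\<And>x. x \<in> T \<Longrightarrow> (f has_derivative f' x) (at x)"
    and f': "\<And>e. e \<in> Basis \<Longrightarrow> Ck_on k T (\<lambda>x. f' x e)"
    and cong: "\<And>e g. Ck_on k T (\<lambda>x. f' x e) \<Longrightarrow> (\<And>x. x \<in> T \<Longrightarrow> g x = f' x e) \<Longrightarrow> Ck_on k T g"
  shows "Ck_on (Suc k) T f"
proof -
  have eq: "dir_deriv e f x = f' x e" if "x \<in> T" for x e
    using frechet_derivative_at[OF f[OF that]] by simp
  have "Ck_on k T (dir_deriv e f)" if "e \<in> Basis" for e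
    using f'[OF that] eq by (rule cong)
  moreover have "f differentiable (at x)" if "x \<in> T" for x
    using f[OF that] by (rule differentiableI)
  ultimately show ?thesis by simp
qed

lemma Ck_on_cong:
  fixes f :: "'a::euclidean_space \<Rightarrow> 'b::real_normed_vector"
  assumes "open T"
  shows "Ck_on k T f \<Longrightarrow> (\<And>x. x \<in> T \<Longrightarrow> g x = f x) \<Longrightarrow> Ck_on k T g"
proof (induction k arbitrary: f g)
  case 0
  then show ?case using continuous_on_cong[of T T g f] by simp
next
  case (Suc k)
  have "(g has_derivative frechet_derivative f (at x)) (at x)" if "x \<in> T" for x
    using Ck_on_SucD(1)[OF Suc.prems(1) that] Suc.prems(2) that
    by (rule_tac has_derivative_transform_within_open[OF _ \<open>open T\<close>]) auto
  then show ?case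
    using Ck_on_SucD(2)[OF Suc.prems(1)] Suc.IH by (intro Ck_on_SucI[OF \<open>open T\<close>]) blast+
qed

lemma Ck_on_Suc:
  fixes f :: "'a::euclidean_space \<Rightarrow> 'b::real_normed_vector"
  assumes "open T" and f: "\<And>x. x \<in> T \<Longrightarrow> (f has_derivative f' x) (at x)"
    and f': "\<And>e. e \<in> Basis \<Longrightarrow> Ck_on k T (\<lambda>x. f' x e)"
  shows "Ck_on (Suc k) T f"
  using assms Ck_on_cong[OF \<open>open T\<close>] by (rule Ck_on_SucI) blast+

lemma Ck_on_const: "open T \<Longrightarrow> Ck_on k T (\<lambda>x::'a::euclidean_space. c)"
proof (induction k arbitrary: c)
  case (Suc k)
  then show ?case by (intro Ck_on_Suc[where f' = "\<lambda>_ _. 0"]) auto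
qed simp

lemma Ck_on_bounded_linear:
  fixes f :: "'a::euclidean_space \<Rightarrow> 'b::real_normed_vector"
  assumes h: "bounded_linear h" and "open T"
  shows "Ck_on k T f \<Longrightarrow> Ck_on k T (\<lambda>x. h (f x))"
proof (induction k arbitrary: f)
  case 0
  then show ?case using bounded_linear.continuous_on[OF h] by simp
next
  case (Suc k)
  show ?case
    using Suc.IH[OF Ck_on_SucD(2)[OF Suc.prems]]
    by (intro Ck_on_Suc[OF \<open>open T\<close> bounded_linear.has_derivative[OF h Ck_on_SucD(1)[OF Suc.prems]]])
qed

lemma Ck_on_affine:
  fixes h :: "'a::euclidean_space \<Rightarrow> 'b::real_normed_vector"
  assumes "bounded_linear h" "open T"
  shows "Ck_on k T (\<lambda>x. h x + c)"
proof (cases k)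
  case 0
  then show ?thesis using assms(1)
    by (simp add: continuous_on_add linear_continuous_on)
next
  case (Suc m)
  have "((\<lambda>x. h x + c) has_derivative h) (at x)" for x
    using bounded_linear_imp_has_derivative[OF assms(1), of "at x"] by (rule has_derivative_add_const)
  then show ?thesis
    unfolding Suc using Ck_on_const[OF \<open>open T\<close>] by (intro Ck_on_Suc[OF \<open>open T\<close>])
qed

lemma Ck_on_add:
  fixes f g :: "'a::euclidean_space \<Rightarrow> 'b::real_normed_vector"
  assumes "open T"
  shows "Ck_on k T f \<Longrightarrow> Ck_on k T g \<Longrightarrow> Ck_on k T (\<lambda>x. f x + g x)"
proof (induction k arbitrary: f g)
  case 0 then show ?case by (simp add: continuous_on_add)
next
  case (Suc k)
  show ?case
    using Suc.IH[OF Ck_on_SucD(2)[OF Suc.prems(1)] Ck_on_SucD(2)[OF Suc.prems(2)]]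
    by (intro Ck_on_Suc[OF \<open>open T\<close> has_derivative_add[OF Ck_on_SucD(1)[OF Suc.prems(1)] Ck_on_SucD(1)[OF Suc.prems(2)]]])
qed

lemma Ck_on_sum:
  fixes f :: "'i \<Rightarrow> 'a::euclidean_space \<Rightarrow> 'b::real_normed_vector"
  assumes "open T" "\<And>i. i \<in> I \<Longrightarrow> Ck_on k T (f i)"
  shows "Ck_on k T (\<lambda>x. \<Sum>i\<in>I. f i x)"
  using assms(2)
proof (induction I rule: infinite_finite_induct)
  case (insert i I)
  then show ?case using Ck_on_add[OF \<open>open T\<close>, of k "f i" "\<lambda>x. \<Sum>i\<in>I. f i x"] by simp
qed (auto intro: Ck_on_const[OF \<open>open T\<close>])

lemma Ck_on_scaleR:
  fixes f :: "'a::euclidean_space \<Rightarrow> real" and g :: "'a \<Rightarrow> 'b::real_normed_vector"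
  assumes "open T"
  shows "Ck_on k T f \<Longrightarrow> Ck_on k T g \<Longrightarrow> Ck_on k T (\<lambda>x. f x *\<^sub>R g x)"
proof (induction k arbitrary: f g)
  case 0 then show ?case by (simp add: continuous_on_scaleR)
next
  case (Suc k)
  note f = Ck_on_SucD[OF Suc.prems(1)] Ck_on_Suc_imp[OF Suc.prems(1)]
  note g = Ck_on_SucD[OF Suc.prems(2)] Ck_on_Suc_imp[OF Suc.prems(2)]
  show ?case
    by (intro Ck_on_Suc[OF \<open>open T\<close> has_derivative_scaleR[OF f(1) g(1)]] Ck_on_add[OF \<open>open T\<close>] Suc.IH f g)
qed

lemma linear_basis_expansion:
  fixes h :: "'a::euclidean_space \<Rightarrow> 'b::real_normed_vector"
  assumes "bounded_linear h"
  shows "h v = (\<Sum>b\<in>Basis. (v \<bullet> b) *\<^sub>R h b)"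
proof -
  interpret bounded_linear h by fact
  have "h v = h (\<Sum>b\<in>Basis. (v \<bullet> b) *\<^sub>R b)" by (simp add: euclidean_representation)
  then show ?thesis by (simp add: sum scaleR)
qed

lemma bounded_linear_basis_bound:
  fixes h :: "'a::euclidean_space \<Rightarrow> 'b::real_normed_vector"
  assumes h: "bounded_linear h" and k: "\<And>e. e \<in> Basis \<Longrightarrow> norm (h e) \<le> k e"
  shows "norm (h v) \<le> (\<Sum>e\<in>Basis. k e) * norm v"
proof -
  have "norm (h v) \<le> (\<Sum>e\<in>Basis. k e * norm v)"
    unfolding linear_basis_expansion[OF h, of v]
  proof (rule sum_norm_le)
    fix e :: 'a assume e: "e \<in> Basis"
    have "\<bar>v \<bullet> e\<bar> * norm (h e) \<le> norm v * k e"
      using k[OF e] Basis_le_norm[OF e, of v] by (intro mult_mono) auto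
    then show "norm ((v \<bullet> e) *\<^sub>R h e) \<le> k e * norm v" by (simp add: mult.commute)
  qed
  then show ?thesis by (simp add: sum_distrib_right)
qed

lemma Ck_on_compose:
  fixes f :: "'b::euclidean_space \<Rightarrow> 'c::real_normed_vector" and g :: "'a::euclidean_space \<Rightarrow> 'b"
  assumes "open T" and sub: "g ` T \<subseteq> U"
  shows "Ck_on k U f \<Longrightarrow> Ck_on k T g \<Longrightarrow> Ck_on k T (\<lambda>x. f (g x))"
proof (induction k arbitrary: f)
  case 0 then show ?case using continuous_on_compose2[of U f T g] sub by simp
next
  case (Suc k)
  note f = Ck_on_SucD[OF Suc.prems(1)]
  note g = Ck_on_SucD[OF Suc.prems(2)] Ck_on_Suc_imp[OF Suc.prems(2)]
  let ?D = "\<lambda>x v. \<Sum>b\<in>Basis. (frechet_derivative g (at x) v \<bullet> b) *\<^sub>R dir_deriv b f (g x)"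
  have der: "((\<lambda>x. f (g x)) has_derivative ?D x) (at x)" if "x \<in> T" for x
  proof -
    have fx: "(f has_derivative frechet_derivative f (at (g x))) (at (g x))"
      using f(1) sub that by blast
    have "?D x = (\<lambda>v. frechet_derivative f (at (g x)) (frechet_derivative g (at x) v))"
      by (rule ext) (rule linear_basis_expansion[OF has_derivative_bounded_linear[OF fx], symmetric])
    then show ?thesis using has_derivative_compose[OF g(1)[OF that] fx] by (simp only:)
  qed
  show ?case
  proof (rule Ck_on_Suc[OF \<open>open T\<close> der])
    fix e :: 'a assume e: "e \<in> Basis"
    show "Ck_on k T (\<lambda>x. ?D x e)"
      using Ck_on_bounded_linear[OF bounded_linear_inner_left \<open>open T\<close> g(2)[OF e]] Suc.IH[OF f(2) g(3)]
      by (intro Ck_on_sum[OF \<open>open T\<close>] Ck_on_scaleR[OF \<open>open T\<close>])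
  qed
qed

lemma Ck_on_frechet_derivative_apply:
  fixes X Y :: "'a::euclidean_space \<Rightarrow> 'a"
  assumes "open T" "Ck_on (Suc k) T Y" "Ck_on k T X"
  shows "Ck_on k T (\<lambda>x. frechet_derivative Y (at x) (X x))"
proof (rule Ck_on_cong[OF \<open>open T\<close>])
  show "Ck_on k T (\<lambda>x. \<Sum>b\<in>Basis. (X x \<bullet> b) *\<^sub>R dir_deriv b Y x)"
    by (intro Ck_on_sum Ck_on_scaleR Ck_on_bounded_linear[OF bounded_linear_inner_left] assms Ck_on_SucD(2)[OF assms(2)])
  show "frechet_derivative Y (at x) (X x) = (\<Sum>b\<in>Basis. (X x \<bullet> b) *\<^sub>R dir_deriv b Y x)" if "x \<in> T" for x
    by (rule linear_basis_expansion[OF has_derivative_bounded_linear[OF Ck_on_SucD(1)[OF assms(2) that]]])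
qed

lemma smooth_on_lie_bracket:
  assumes "smooth_on UNIV X" "smooth_on UNIV Y"
  shows "smooth_on UNIV (lie_bracket X Y)"
  unfolding smooth_on_def
proof
  fix k
  have "Ck_on k UNIV (\<lambda>x. frechet_derivative Y (at x) (X x) + (-1) *\<^sub>R frechet_derivative X (at x) (Y x))"
    using assms unfolding smooth_on_def
    by (intro Ck_on_add Ck_on_bounded_linear[OF bounded_linear_scaleR_right] Ck_on_frechet_derivative_apply open_UNIV) blast+
  then show "Ck_on k UNIV (lie_bracket X Y)" by (simp add: lie_bracket_def)
qed

lemma smooth_on_iter_brackets:
  assumes "\<And>i. smooth_on UNIV (F i)" "X \<in> iter_brackets F"
  shows "smooth_on UNIV X"
  using assms(2) by induction (auto intro: assms(1) smooth_on_lie_bracket)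

lemma C1_derivative_uniformly_continuous:
  fixes f :: "'a::euclidean_space \<Rightarrow> 'b::real_normed_vector"
  assumes f: "Ck_on (Suc 0) T f" and S: "compact S" "S \<subseteq> T" and "0 < \<eta>"
  obtains \<delta> where "0 < \<delta>"
    "\<And>x z v. x \<in> S \<Longrightarrow> z \<in> S \<Longrightarrow> dist z x < \<delta> \<Longrightarrow>
       norm (frechet_derivative f (at z) v - frechet_derivative f (at x) v) \<le> \<eta> * norm v"
proof -
  define \<eta>' where "\<eta>' = \<eta> / DIM('a)"
  have "\<eta>' > 0" using \<open>0 < \<eta>\<close> by (simp add: \<eta>'_def)
  have "\<exists>\<delta>>0. \<forall>x\<in>S. \<forall>z\<in>S. dist z x < \<delta> \<longrightarrow> dist (dir_deriv e f z) (dir_deriv e f x) < \<eta>'" if "e \<in> Basis" for e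
  proof -
    have "continuous_on S (dir_deriv e f)"
      using Ck_on_SucD(2)[OF f that] S(2) continuous_on_subset by auto
    then have "uniformly_continuous_on S (dir_deriv e f)"
      using S(1) compact_uniformly_continuous by blast
    then show ?thesis using \<open>\<eta>' > 0\<close> unfolding uniformly_continuous_on_def by blast
  qed
  then obtain \<delta> where \<delta>: "\<And>e. e \<in> Basis \<Longrightarrow> 0 < \<delta> e"
    "\<And>e x z. e \<in> Basis \<Longrightarrow> x \<in> S \<Longrightarrow> z \<in> S \<Longrightarrow> dist z x < \<delta> e \<Longrightarrow> dist (dir_deriv e f z) (dir_deriv e f x) < \<eta>'"
    by metis
  define d where "d = Min (\<delta> ` Basis)"
  have d: "0 < d" "\<And>e. e \<in> Basis \<Longrightarrow> d \<le> \<delta> e"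
    using \<delta>(1) by (auto simp: d_def)
  let ?f' = "\<lambda>z. frechet_derivative f (at z)"
  have bl: "bounded_linear (?f' z)" if "z \<in> S" for z
    using Ck_on_SucD(1)[OF f] that S(2) has_derivative_bounded_linear by blast
  show thesis
  proof (rule that[OF d(1)])
    fix x z v assume x: "x \<in> S" and z: "z \<in> S" "dist z x < d"
    have "norm (?f' z v - ?f' x v) \<le> (\<Sum>e\<in>(Basis::'a set). \<eta>') * norm v"
    proof (rule bounded_linear_basis_bound)
      show "bounded_linear (\<lambda>v. ?f' z v - ?f' x v)"
        using z bl x by (intro bounded_linear_sub) auto
      show "norm (?f' z e - ?f' x e) \<le> \<eta>'" if e: "e \<in> Basis" for e
        using \<delta>(2)[OF e x, of z] z d(2)[OF e] by (simp add: dist_norm norm_minus_commute)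
    qed
    then show "norm (?f' z v - ?f' x v) \<le> \<eta> * norm v" by (simp add: \<eta>'_def)
  qed
qed

text \<open>A linearization with the derivative frozen at a nearby point and an error proportional to
  \<open>|a - b|\<close>, not to the distance from \<open>x\<close>. This is what makes first derivatives suffice in the
  expansion of commutators of flows.\<close>

lemma C1_uniform_linearization:
  fixes f :: "'a::euclidean_space \<Rightarrow> 'b::real_normed_vector"
  assumes f: "Ck_on (Suc 0) T f" and S: "compact S" "convex S" "S \<subseteq> T" and "0 < \<eta>"
  obtains \<delta> where "0 < \<delta>"
    "\<And>x a b. x \<in> S \<Longrightarrow> a \<in> S \<Longrightarrow> b \<in> S \<Longrightarrow> dist a x < \<delta> \<Longrightarrow> dist b x < \<delta> \<Longrightarrow>
       norm (f a - f b - frechet_derivative f (at x) (a - b)) \<le> \<eta> * norm (a - b)"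
proof -
  let ?f' = "\<lambda>z. frechet_derivative f (at z)"
  obtain d where d: "0 < d" "\<And>x z v. x \<in> S \<Longrightarrow> z \<in> S \<Longrightarrow> dist z x < d \<Longrightarrow> norm (?f' z v - ?f' x v) \<le> \<eta> * norm v"
    using C1_derivative_uniformly_continuous[OF f S(1,3) \<open>0 < \<eta>\<close>] by metis
  have der: "(f has_derivative ?f' z) (at z)" if "z \<in> S" for z
    using Ck_on_SucD(1)[OF f] that S(3) by blast
  note bl = has_derivative_bounded_linear[OF der]
  show thesis
  proof (rule that[OF d(1)])
    fix x a b assume x: "x \<in> S" and ab: "a \<in> S" "b \<in> S" "dist a x < d" "dist b x < d"
    have "norm ((f a - ?f' x a) - (f b - ?f' x b)) \<le> \<eta> * norm (a - b)"
    proof (rule differentiable_bound[where S = "S \<inter> ball x d" and f' = "\<lambda>z v. ?f' z v - ?f' x v"])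
      show "convex (S \<inter> ball x d)" using S(2) by (intro convex_Int convex_ball)
      show "a \<in> S \<inter> ball x d" "b \<in> S \<inter> ball x d" using ab by (auto simp: dist_commute)
      fix z assume z: "z \<in> S \<inter> ball x d"
      show "((\<lambda>z. f z - ?f' x z) has_derivative (\<lambda>v. ?f' z v - ?f' x v)) (at z within S \<inter> ball x d)"
        using z by (intro has_derivative_at_withinI[OF has_derivative_diff] der bounded_linear_imp_has_derivative[OF bl[OF x]]) auto
      show "onorm (\<lambda>v. ?f' z v - ?f' x v) \<le> \<eta>"
        using d(2)[OF x, of z] z \<open>0 < \<eta>\<close> by (intro onorm_bound) (auto simp: dist_commute)
    qed
    moreover have "?f' x (a - b) = ?f' x a - ?f' x b"
      using bl[OF x] by (simp add: bounded_linear.linear linear_diff)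
    then have "(f a - ?f' x a) - (f b - ?f' x b) = f a - f b - ?f' x (a - b)" by simp
    ultimately show "norm (f a - f b - ?f' x (a - b)) \<le> \<eta> * norm (a - b)" by (simp only:)
  qed
qed

lemma C1_derivative_bound:
  fixes f :: "'a::euclidean_space \<Rightarrow> 'b::real_normed_vector"
  assumes f: "Ck_on (Suc 0) T f" and S: "compact S" "S \<subseteq> T"
  obtains K where "0 \<le> K" "\<And>x v. x \<in> S \<Longrightarrow> norm (frechet_derivative f (at x) v) \<le> K * norm v"
proof -
  have "\<exists>K. \<forall>x\<in>S. norm (dir_deriv e f x) \<le> K" if "e \<in> Basis" for e
  proof -
    have "continuous_on S (dir_deriv e f)"
      using Ck_on_SucD(2)[OF f that] S(2) continuous_on_subset by auto
    from compact_imp_bounded[OF compact_continuous_image[OF this S(1)]]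
    show ?thesis unfolding bounded_iff by auto
  qed
  then obtain K where K: "\<And>e x. e \<in> Basis \<Longrightarrow> x \<in> S \<Longrightarrow> norm (dir_deriv e f x) \<le> K e" by metis
  show thesis
  proof (rule that[of "\<Sum>e\<in>Basis. \<bar>K e\<bar>"])
    fix x v assume x: "x \<in> S"
    have "bounded_linear (frechet_derivative f (at x))"
      using Ck_on_SucD(1)[OF f] x S(2) has_derivative_bounded_linear by blast
    moreover have "norm (dir_deriv e f x) \<le> \<bar>K e\<bar>" if "e \<in> Basis" for e
      using K[OF that x] by linarith
    ultimately show "norm (frechet_derivative f (at x) v) \<le> (\<Sum>e\<in>Basis. \<bar>K e\<bar>) * norm v"
      by (rule bounded_linear_basis_bound)
  qed (simp add: sum_nonneg)
qed

lemma C1_lipschitz_on_convex_compact: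
  fixes f :: "'a::euclidean_space \<Rightarrow> 'b::real_normed_vector"
  assumes f: "Ck_on (Suc 0) T f" and S: "compact S" "convex S" "S \<subseteq> T"
  obtains K where "0 \<le> K" "\<And>x y. x \<in> S \<Longrightarrow> y \<in> S \<Longrightarrow> norm (f x - f y) \<le> K * norm (x - y)"
    "\<And>x v. x \<in> S \<Longrightarrow> norm (frechet_derivative f (at x) v) \<le> K * norm v"
proof -
  obtain K where K: "0 \<le> K" "\<And>x v. x \<in> S \<Longrightarrow> norm (frechet_derivative f (at x) v) \<le> K * norm v"
    using C1_derivative_bound[OF f S(1,3)] by blast
  have "norm (f x - f y) \<le> K * norm (x - y)" if "x \<in> S" "y \<in> S" for x y
  proof (rule differentiable_bound[OF S(2) _ _ that])
    show "(f has_derivative frechet_derivative f (at z)) (at z within S)" if "z \<in> S" for z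
      using Ck_on_SucD(1)[OF f] that S(3) has_derivative_at_withinI by blast
    show "onorm (frechet_derivative f (at z)) \<le> K" if "z \<in> S" for z
      using K that by (intro onorm_bound) auto
  qed
  then show thesis using that K by blast
qed

lemma compact_norm_bound:
  fixes X :: "'b::euclidean_space \<Rightarrow> 'c::real_normed_vector"
  assumes "compact C" "continuous_on C X"
  obtains K where "0 < K" "\<And>x. x \<in> C \<Longrightarrow> norm (X x) \<le> K"
  using compact_imp_bounded[OF compact_continuous_image[OF assms(2,1)]]
  unfolding bounded_pos by auto

section \<open>The semigroup of attainable flows\<close>

definition concat_controls :: "(real \<Rightarrow> 'b) \<Rightarrow> (real \<Rightarrow> 'b) \<Rightarrow> real \<Rightarrow> 'b" where
  "concat_controls f g s = (if s \<le> 1/2 then f (2 * s) else g (2 * s - 1))"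

lemma has_integral_concat:
  fixes f g :: "real \<Rightarrow> 'b::euclidean_space"
  assumes f: "f integrable_on {0..1}" and g: "g integrable_on {0..1}"
  shows "0 \<le> t \<Longrightarrow> t \<le> 1/2 \<Longrightarrow>
      (concat_controls f g has_integral (1/2) *\<^sub>R integral {0..2*t} f) {0..t}"
    and "1/2 \<le> t \<Longrightarrow> t \<le> 1 \<Longrightarrow>
      (concat_controls f g has_integral (1/2) *\<^sub>R (integral {0..1} f + integral {0..2*t-1} g)) {0..t}"
proof -
  show 1: "(concat_controls f g has_integral (1/2) *\<^sub>R integral {0..2*t} f) {0..t}"
    if "0 \<le> t" "t \<le> 1/2" for t
  proof -
    have "(f has_integral integral {0..2*t} f) (cbox 0 (2*t))"
      unfolding box_real using that
      by (intro integrable_integral integrable_on_subinterval[OF f]) auto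
    from has_integral_affinity'[OF this, of 2 0]
    have "((\<lambda>s. f (2 * s)) has_integral (1/2) *\<^sub>R integral {0..2*t} f) {0..t}"
      by (simp add: inverse_eq_divide)
    then show ?thesis
      by (rule has_integral_eq[rotated]) (use that in \<open>auto simp: concat_controls_def\<close>)
  qed
  assume t: "1/2 \<le> t" "t \<le> 1"
  have "(g has_integral integral {0..2*t-1} g) (cbox 0 (2*t-1))"
    unfolding box_real using t
    by (intro integrable_integral integrable_on_subinterval[OF g]) auto
  from has_integral_affinity'[OF this, of 2 "-1"]
  have "((\<lambda>s. g (2 * s - 1)) has_integral (1/2) *\<^sub>R integral {0..2*t-1} g) {1/2..t}"
    by (simp add: inverse_eq_divide)
  then have "(concat_controls f g has_integral (1/2) *\<^sub>R integral {0..2*t-1} g) {1/2..t}"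
    by (rule has_integral_spike[of "{1/2}", rotated 2]) (auto simp: concat_controls_def)
  from has_integral_combine[OF _ _ 1[of "1/2"] this]
  show "(concat_controls f g has_integral (1/2) *\<^sub>R (integral {0..1} f + integral {0..2*t-1} g)) {0..t}"
    using t by (simp add: scaleR_add_right)
qed

lemma concat_controls_integrable:
  fixes f g :: "real \<Rightarrow> 'b::euclidean_space"
  shows "f integrable_on {0..1} \<Longrightarrow> g integrable_on {0..1} \<Longrightarrow> concat_controls f g integrable_on {0..1}"
  using has_integral_concat(2)[of f g 1] by (auto simp: integrable_on_def)

lemma concat_controls_L2:
  assumes u: "u \<in> L2_controls" and v: "v \<in> L2_controls"
  shows "(\<lambda>s. 2 *\<^sub>R concat_controls u v s) \<in> L2_controls"
proof -
  have "(\<lambda>s. 2 *\<^sub>R concat_controls u v s) integrable_on {0..1}"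
    by (intro integrable_cmul concat_controls_integrable L2_controlsD(1) u v)
  moreover have "(\<lambda>s. 2 * concat_controls (\<lambda>s. norm (u s)) (\<lambda>s. norm (v s)) s) integrable_on {0..1}"
    by (intro integrable_on_mult_right concat_controls_integrable L2_controlsD(2) u v)
  moreover have "(\<lambda>s. 4 * concat_controls (\<lambda>s. (norm (u s))\<^sup>2) (\<lambda>s. (norm (v s))\<^sup>2) s) integrable_on {0..1}"
    by (intro integrable_on_mult_right concat_controls_integrable L2_controlsD(3) u v)
  moreover have "2 * concat_controls (\<lambda>s. norm (u s)) (\<lambda>s. norm (v s)) s = norm (2 *\<^sub>R concat_controls u v s)" for s
    by (simp add: concat_controls_def)
  moreover have "4 * concat_controls (\<lambda>s. (norm (u s))\<^sup>2) (\<lambda>s. (norm (v s))\<^sup>2) s = (norm (2 *\<^sub>R concat_controls u v s))\<^sup>2" for s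
    by (simp add: concat_controls_def power_mult_distrib)
  ultimately show ?thesis unfolding L2_controls_iff by (simp only:)
qed

lemma const_control_L2: "(\<lambda>_. w) \<in> L2_controls"
  by (simp add: L2_controls_iff integrable_const_ivl)

context control_system
begin

definition attainable :: "('a \<Rightarrow> 'a) set" where
  "attainable = flow F ` L2_controls"

lemma velocity_scaleR: "velocity (c *\<^sub>R w) x = c *\<^sub>R velocity w x"
  by (simp add: velocity_def scaleR_sum_right)

text \<open>The concatenated control is doubled to make up for the two halves of the time interval; the integral
  equation of the concatenated trajectory splits into those of the two pieces.\<close>

lemma attainable_compose:
  assumes "f \<in> attainable" "g \<in> attainable"
  shows "(\<lambda>x. g (f x)) \<in> attainable"
proof -
  obtain u v where u: "u \<in> L2_controls" "f = flow F u" and v: "v \<in> L2_controls" "g = flow F v"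
    using assms by (auto simp: attainable_def)
  define w where "w s = 2 *\<^sub>R concat_controls u v s" for s
  have w: "w \<in> L2_controls" unfolding w_def[abs_def] by (rule concat_controls_L2[OF u(1) v(1)])
  have "flow F w x0 = g (f x0)" for x0
  proof -
    define x where "x = traj u x0"
    define y where "y = traj v (x 1)"
    note x = integral_solutionD[OF traj[OF u(1), of x0], folded x_def]
    note y = integral_solutionD[OF traj[OF v(1), of "x 1"], folded y_def]
    define z where "z = concat_controls x y"
    let ?f = "\<lambda>s. velocity (u s) (x s)" and ?g = "\<lambda>s. velocity (v s) (y s)"
    have f: "?f integrable_on {0..1}" using velocity_integrable(2)[OF u(1) x(1)] by simp
    have g: "?g integrable_on {0..1}" using velocity_integrable(2)[OF v(1) y(1)] by simp
    have vel: "velocity (w s) (z s) = 2 *\<^sub>R concat_controls ?f ?g s" for s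
      by (simp add: w_def z_def concat_controls_def velocity_scaleR)
    have zt: "z t = x0 + integral {0..t} (\<lambda>s. velocity (w s) (z s))" if t: "t \<in> {0..1}" for t
    proof (cases "t \<le> 1/2")
      case True
      then have "integral {0..t} (\<lambda>s. velocity (w s) (z s)) = integral {0..2*t} ?f"
        using integral_unique[OF has_integral_cmul[OF has_integral_concat(1)[OF f g, of t], of 2]] t
        unfolding vel by simp
      then show ?thesis using True t x(3)[of "2*t"] by (simp add: z_def concat_controls_def)
    next
      case False
      then have "integral {0..t} (\<lambda>s. velocity (w s) (z s)) = integral {0..1} ?f + integral {0..2*t-1} ?g"
        using integral_unique[OF has_integral_cmul[OF has_integral_concat(2)[OF f g, of t], of 2]] t
        unfolding vel by simp
      moreover have "z t = y (2*t-1)" using False by (simp add: z_def concat_controls_def)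
      ultimately show ?thesis using False t x(3)[of 1] y(3)[of "2*t-1"] by simp
    qed
    have "continuous_on {0..1} (\<lambda>t. x0 + integral {0..t} (\<lambda>s. velocity (w s) (z s)))"
      unfolding vel by (intro continuous_intros indefinite_integral_continuous_1 integrable_cmul concat_controls_integrable f g)
    then have "continuous_on {0..1} z"
      using zt by (subst continuous_on_cong[OF refl zt]) auto
    then have "integral_solution w x0 z" unfolding integral_solution_def using zt by blast
    from flow_eq[OF w this] show ?thesis
      by (simp add: z_def concat_controls_def y_def x_def u(2) v(2) flow_traj[OF u(1)] flow_traj[OF v(1)])
  qed
  then have "(\<lambda>x. g (f x)) = flow F w" by (simp add: fun_eq_iff)
  then show ?thesis using w by (auto simp: attainable_def)
qed

subsection \<open>Flows of a single field\<close>

definition field_control :: "'l \<Rightarrow> real \<Rightarrow> real \<Rightarrow> real ^ 'l" where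
  "field_control i c = (\<lambda>_. c *\<^sub>R axis i 1)"

lemma field_control_L2 [simp]: "field_control i c \<in> L2_controls"
  unfolding field_control_def by (rule const_control_L2)

lemma field_flow_attainable [simp]: "flow F (field_control i c) \<in> attainable"
  by (simp add: attainable_def)

lemma velocity_field_control [simp]: "velocity (field_control i c s) x = c *\<^sub>R F i x"
proof -
  have "velocity (axis i 1) x = (\<Sum>j\<in>UNIV. if j = i then F j x else 0)"
    unfolding velocity_def by (intro sum.cong) (auto simp: axis_def)
  then show ?thesis by (simp add: field_control_def velocity_scaleR)
qed

lemma field_control_L1 [simp]: "integral {0..1} (\<lambda>s. norm (field_control i c s)) = \<bar>c\<bar>"
  by (simp add: field_control_def)

lemma flow_zero: "flow F (field_control i 0) x = x"
proof (rule flow_eq)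
  show "integral_solution (field_control i 0) x (\<lambda>_. x)"
    by (simp add: integral_solution_def)
qed simp

lemma id_attainable: "(\<lambda>x. x) \<in> attainable"
  using field_flow_attainable[of _ 0] unfolding flow_zero[abs_def] .

lemma field_traj_displacement:
  "t \<in> {0..1} \<Longrightarrow> norm (traj (field_control i c) x t - x) \<le> B * \<bar>c\<bar>"
  using traj_displacement[of "field_control i c" t x] by simp

lemma field_traj:
  "t \<in> {0..1} \<Longrightarrow> traj (field_control i c) x t = x + integral {0..t} (\<lambda>s. c *\<^sub>R F i (traj (field_control i c) x s))"
  using integral_solutionD(3)[OF traj[of "field_control i c" x]] by simp

lemma field_traj_continuous: "continuous_on {0..1} (traj (field_control i c) x)"
  by (rule integral_solutionD(1)[OF traj]) simp

text \<open>The trajectory backwards in time is a trajectory of the opposite constant control.\<close>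

lemma flow_inverse: "flow F (field_control i (- c)) (flow F (field_control i c) x) = x"
proof -
  define X where "X = traj (field_control i c) x"
  note Xc = field_traj_continuous[of i c x, folded X_def]
  let ?v = "\<lambda>s. c *\<^sub>R F i (X s)"
  have v: "?v integrable_on {0..1}"
    using velocity_integrable(2)[OF field_control_L2[of i c] Xc, of 0 1] by simp
  have "integral_solution (field_control i (- c)) (X 1) (\<lambda>t. X (1 - t))"
    unfolding integral_solution_def
  proof (intro conjI ballI)
    show "continuous_on {0..1} (\<lambda>t. X (1 - t))"
      by (rule continuous_on_compose2[OF Xc]) (auto intro!: continuous_intros)
    fix t :: real assume t: "t \<in> {0..1}"
    have "integral {0..t} (\<lambda>s. ?v (1 - s)) = integral {-t..0} (?v \<circ> (+) 1)"
      using Henstock_Kurzweil_Integration.integral_reflect_real[of 0 "-t" "?v \<circ> (+) 1"] by simp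
    also have "\<dots> = integral {1-t..1} ?v"
      using integral_shift_Icc_real[of "-t" 0 ?v 1] by (simp add: add.commute)
    also have "\<dots> = integral {0..1} ?v - integral {0..1-t} ?v"
      using integral_combine_real[OF v, of "1-t" 1] t by simp
    also have "\<dots> = X 1 - X (1 - t)"
      using field_traj[of 1 i c x] field_traj[of "1-t" i c x] t unfolding X_def by simp
    finally show "X (1 - t) = X 1 + integral {0..t} (\<lambda>s. velocity (field_control i (- c) s) (X (1 - s)))"
      by simp
  qed
  from flow_eq[OF field_control_L2 this] show ?thesis
    using integral_solutionD(2)[OF traj[of "field_control i c" x]] by (simp add: flow_traj X_def)
qed

lemma field_flow_first_order:
  "norm (flow F (field_control i c) x - x - c *\<^sub>R F i x) \<le> L * B * c\<^sup>2"
proof -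
  define X where "X = traj (field_control i c) x"
  note Xc = field_traj_continuous[of i c x, folded X_def]
  have v: "(\<lambda>s. c *\<^sub>R F i (X s)) integrable_on {0..1}"
    using velocity_integrable(2)[OF field_control_L2[of i c] Xc, of 0 1] by simp
  have "flow F (field_control i c) x - x - c *\<^sub>R F i x = integral {0..1} (\<lambda>s. c *\<^sub>R F i (X s)) - integral {0..1} (\<lambda>s::real. c *\<^sub>R F i x)"
    using field_traj[of 1 i c x] by (simp add: flow_traj X_def)
  also have "\<dots> = integral {0..1} (\<lambda>s. c *\<^sub>R F i (X s) - c *\<^sub>R F i x)"
    by (intro Henstock_Kurzweil_Integration.integral_diff[symmetric] v) auto
  also have "norm \<dots> \<le> integral {0..1} (\<lambda>s::real. L * B * c\<^sup>2)"
  proof (rule integral_norm_bound_integral)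
    show "(\<lambda>s. c *\<^sub>R F i (X s) - c *\<^sub>R F i x) integrable_on {0..1}" using v by (intro integrable_diff) auto
    fix s :: real assume s: "s \<in> {0..1}"
    have "norm (c *\<^sub>R F i (X s) - c *\<^sub>R F i x) = \<bar>c\<bar> * norm (F i (X s) - F i x)"
      by (simp add: scaleR_diff_right[symmetric])
    also have "\<dots> \<le> \<bar>c\<bar> * (L * norm (X s - x))"
      by (intro mult_left_mono F_lipschitz) simp
    also have "\<dots> \<le> \<bar>c\<bar> * (L * (B * \<bar>c\<bar>))"
      using field_traj_displacement[OF s, of i c x] L_nonneg unfolding X_def by (intro mult_left_mono) auto
    also have "\<dots> = L * B * (\<bar>c\<bar> * \<bar>c\<bar>)" by (simp only: mult_ac)
    also have "\<dots> = L * B * c\<^sup>2" by (simp add: power2_eq_square)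
    finally show "norm (c *\<^sub>R F i (X s) - c *\<^sub>R F i x) \<le> L * B * c\<^sup>2" .
  qed (rule integrable_const_ivl)
  finally show ?thesis by simp
qed

section \<open>Tangent fields\<close>

text \<open>A field is tangent if moving along it for a short time \<open>\<tau>\<close> can be imitated by an attainable
  flow up to an error of order \<open>o(\<tau>)\<close>, uniformly on compact sets. The tangent
  fields are the analogue of the tangent cone at the identity of a semigroup of matrices.\<close>

definition tangent :: "('a \<Rightarrow> 'a) \<Rightarrow> bool" where
  "tangent X \<longleftrightarrow> (\<forall>C \<epsilon>. compact C \<longrightarrow> 0 < \<epsilon> \<longrightarrow>
     (\<exists>\<tau>0>0. \<forall>\<tau>. 0 < \<tau> \<and> \<tau> \<le> \<tau>0 \<longrightarrow>
        (\<exists>g\<in>attainable. \<forall>x\<in>C. norm (g x - x - \<tau> *\<^sub>R X x) \<le> \<epsilon> * \<tau>)))"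

lemma tangentD:
  assumes "tangent X" "compact C" "0 < \<epsilon>"
  obtains \<tau>0 where "0 < \<tau>0" "\<And>\<tau>. 0 < \<tau> \<Longrightarrow> \<tau> \<le> \<tau>0 \<Longrightarrow> \<exists>g\<in>attainable. \<forall>x\<in>C. norm (g x - x - \<tau> *\<^sub>R X x) \<le> \<epsilon> * \<tau>"
  using assms unfolding tangent_def by meson

lemma tangentI:
  assumes "\<And>C \<epsilon>. compact C \<Longrightarrow> 0 < \<epsilon> \<Longrightarrow>
     \<exists>\<tau>0>0. \<forall>\<tau>. 0 < \<tau> \<and> \<tau> \<le> \<tau>0 \<longrightarrow> (\<exists>g\<in>attainable. \<forall>x\<in>C. norm (g x - x - \<tau> *\<^sub>R X x) \<le> \<epsilon> * \<tau>)"
  shows "tangent X"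
  using assms unfolding tangent_def by blast

lemma tangent_field: "tangent (\<lambda>x. c *\<^sub>R F i x)"
proof (rule tangentI)
  fix C :: "'a set" and \<epsilon> :: real assume "0 < \<epsilon>"
  define A where "A = L * B * c\<^sup>2 + 1"
  have "A > 0" using L_nonneg B_nonneg by (simp add: A_def add_nonneg_pos)
  show "\<exists>\<tau>0>0. \<forall>\<tau>. 0 < \<tau> \<and> \<tau> \<le> \<tau>0 \<longrightarrow> (\<exists>g\<in>attainable. \<forall>x\<in>C. norm (g x - x - \<tau> *\<^sub>R (c *\<^sub>R F i x)) \<le> \<epsilon> * \<tau>)"
  proof (intro exI[of _ "\<epsilon> / A"] conjI allI impI)
    fix \<tau> :: real assume \<tau>: "0 < \<tau> \<and> \<tau> \<le> \<epsilon> / A"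
    have "norm (flow F (field_control i (\<tau> * c)) x - x - \<tau> *\<^sub>R (c *\<^sub>R F i x)) \<le> \<epsilon> * \<tau>" for x
    proof -
      have "norm (flow F (field_control i (\<tau> * c)) x - x - \<tau> *\<^sub>R (c *\<^sub>R F i x)) \<le> L * B * (\<tau> * c)\<^sup>2"
        using field_flow_first_order[of i "\<tau> * c" x] by simp
      also have "\<dots> = (L * B * c\<^sup>2) * \<tau> * \<tau>" by (simp add: power2_eq_square)
      also have "\<dots> \<le> A * \<tau> * \<tau>" using \<tau> by (intro mult_right_mono) (auto simp: A_def)
      also have "\<dots> \<le> \<epsilon> * \<tau>" using \<tau> \<open>A > 0\<close> by (intro mult_right_mono) (auto simp: field_simps)
      finally show ?thesis .
    qed
    then show "\<exists>g\<in>attainable. \<forall>x\<in>C. norm (g x - x - \<tau> *\<^sub>R (c *\<^sub>R F i x)) \<le> \<epsilon> * \<tau>"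
      by (intro bexI[of _ "flow F (field_control i (\<tau> * c))"]) auto
  qed (use \<open>0 < \<epsilon>\<close> \<open>A > 0\<close> in simp)
qed

lemma tangent_zero: "tangent (\<lambda>x. 0)"
proof (rule tangentI)
  fix C :: "'a set" and \<epsilon> :: real assume "0 < \<epsilon>"
  then show "\<exists>\<tau>0>0. \<forall>\<tau>. 0 < \<tau> \<and> \<tau> \<le> \<tau>0 \<longrightarrow> (\<exists>g\<in>attainable. \<forall>x\<in>C. norm (g x - x - \<tau> *\<^sub>R 0) \<le> \<epsilon> * \<tau>)"
    by (intro exI[of _ 1] conjI allI impI bexI[OF _ id_attainable]) auto
qed

lemma tangent_scaleR:
  assumes X: "tangent X" and "0 \<le> c"
  shows "tangent (\<lambda>x. c *\<^sub>R X x)"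
proof (cases "c = 0")
  case True then show ?thesis using tangent_zero by simp
next
  case False
  with assms(2) have "0 < c" by simp
  show ?thesis
  proof (rule tangentI)
    fix C :: "'a set" and \<epsilon> :: real assume C: "compact C" "0 < \<epsilon>"
    obtain \<tau>0 where \<tau>0: "0 < \<tau>0" "\<And>\<tau>. 0 < \<tau> \<Longrightarrow> \<tau> \<le> \<tau>0 \<Longrightarrow> \<exists>g\<in>attainable. \<forall>x\<in>C. norm (g x - x - \<tau> *\<^sub>R X x) \<le> (\<epsilon> / c) * \<tau>"
      using tangentD[OF X C(1), of "\<epsilon> / c"] C(2) \<open>0 < c\<close> by auto
    show "\<exists>\<tau>0>0. \<forall>\<tau>. 0 < \<tau> \<and> \<tau> \<le> \<tau>0 \<longrightarrow> (\<exists>g\<in>attainable. \<forall>x\<in>C. norm (g x - x - \<tau> *\<^sub>R (c *\<^sub>R X x)) \<le> \<epsilon> * \<tau>)"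
    proof (intro exI[of _ "\<tau>0 / c"] conjI allI impI)
      fix \<tau> assume "0 < \<tau> \<and> \<tau> \<le> \<tau>0 / c"
      then have "0 < c * \<tau>" "c * \<tau> \<le> \<tau>0" using \<open>0 < c\<close> by (auto simp: field_simps)
      from \<tau>0(2)[OF this] show "\<exists>g\<in>attainable. \<forall>x\<in>C. norm (g x - x - \<tau> *\<^sub>R (c *\<^sub>R X x)) \<le> \<epsilon> * \<tau>"
        using \<open>0 < c\<close> by (simp add: mult.commute)
    qed (use \<tau>0(1) \<open>0 < c\<close> in simp)
  qed
qed

lemma tangent_limit:
  assumes "\<And>C \<epsilon>. compact C \<Longrightarrow> 0 < \<epsilon> \<Longrightarrow> \<exists>X. tangent X \<and> (\<forall>x\<in>C. norm (X x - Y x) \<le> \<epsilon>)"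
  shows "tangent Y"
proof (rule tangentI)
  fix C :: "'a set" and \<epsilon> :: real assume C: "compact C" "0 < \<epsilon>"
  obtain X where X: "tangent X" "\<And>x. x \<in> C \<Longrightarrow> norm (X x - Y x) \<le> \<epsilon>/2"
    using assms[OF C(1), of "\<epsilon>/2"] C(2) by auto
  obtain \<tau>0 where \<tau>0: "0 < \<tau>0" "\<And>\<tau>. 0 < \<tau> \<Longrightarrow> \<tau> \<le> \<tau>0 \<Longrightarrow> \<exists>g\<in>attainable. \<forall>x\<in>C. norm (g x - x - \<tau> *\<^sub>R X x) \<le> (\<epsilon>/2) * \<tau>"
    using tangentD[OF X(1) C(1), of "\<epsilon>/2"] C(2) by auto
  show "\<exists>\<tau>0>0. \<forall>\<tau>. 0 < \<tau> \<and> \<tau> \<le> \<tau>0 \<longrightarrow> (\<exists>g\<in>attainable. \<forall>x\<in>C. norm (g x - x - \<tau> *\<^sub>R Y x) \<le> \<epsilon> * \<tau>)"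
  proof (intro exI[of _ \<tau>0] conjI allI impI)
    fix \<tau> assume "0 < \<tau> \<and> \<tau> \<le> \<tau>0"
    then obtain g where g: "g \<in> attainable" "\<And>x. x \<in> C \<Longrightarrow> norm (g x - x - \<tau> *\<^sub>R X x) \<le> (\<epsilon>/2) * \<tau>" and "0 < \<tau>"
      using \<tau>0(2) by blast
    have "norm (g x - x - \<tau> *\<^sub>R Y x) \<le> \<epsilon> * \<tau>" if x: "x \<in> C" for x
    proof -
      have "g x - x - \<tau> *\<^sub>R Y x = (g x - x - \<tau> *\<^sub>R X x) + \<tau> *\<^sub>R (X x - Y x)" by (simp add: algebra_simps)
      also have "norm \<dots> \<le> (\<epsilon>/2) * \<tau> + \<tau> * (\<epsilon>/2)"
        using g(2)[OF x] X(2)[OF x] \<open>0 < \<tau>\<close> by (intro norm_triangle_mono) (auto intro: mult_left_mono)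
      finally show ?thesis by (simp add: algebra_simps)
    qed
    then show "\<exists>g\<in>attainable. \<forall>x\<in>C. norm (g x - x - \<tau> *\<^sub>R Y x) \<le> \<epsilon> * \<tau>" using g(1) by blast
  qed (rule \<tau>0(1))
qed

text \<open>Follow \<open>Y\<close> first, then \<open>X\<close>. The flow imitating \<open>X\<close> starts from a displaced point, hence it has to be
  accurate on a neighbourhood \<open>Q\<close> of \<open>C\<close>, and the displacement changes \<open>X\<close> only little.\<close>

lemma tangent_add:
  assumes X: "tangent X" "continuous_on UNIV X" and Y: "tangent Y" "continuous_on UNIV Y"
  shows "tangent (\<lambda>x. X x + Y x)"
proof (rule tangentI)
  fix C :: "'a set" and \<epsilon> :: real assume C: "compact C" "0 < \<epsilon>"
  obtain R where R: "\<And>x. x \<in> C \<Longrightarrow> norm x \<le> R"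
    using compact_imp_bounded[OF C(1)] by (auto simp: bounded_iff)
  define Q where "Q = cball (0::'a) (R + 1)"
  have Q: "compact Q" by (simp add: Q_def)
  obtain K where K: "0 < K" "\<And>x. x \<in> C \<Longrightarrow> norm (Y x) \<le> K"
    using compact_norm_bound[OF C(1) continuous_on_subset[OF Y(2)]] by blast
  obtain \<delta> where \<delta>: "0 < \<delta>" "\<And>x y. x \<in> Q \<Longrightarrow> y \<in> Q \<Longrightarrow> dist y x < \<delta> \<Longrightarrow> dist (X y) (X x) < \<epsilon>/3"
    using compact_uniformly_continuous[OF continuous_on_subset[OF X(2)] Q] C(2)
    unfolding uniformly_continuous_on_def by (metis divide_pos_pos subset_UNIV zero_less_numeral)
  obtain \<tau>1 where \<tau>1: "0 < \<tau>1" "\<And>\<tau>. 0 < \<tau> \<Longrightarrow> \<tau> \<le> \<tau>1 \<Longrightarrow> \<exists>g\<in>attainable. \<forall>x\<in>Q. norm (g x - x - \<tau> *\<^sub>R X x) \<le> (\<epsilon>/3) * \<tau>"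
    using tangentD[OF X(1) Q, of "\<epsilon>/3"] C(2) by auto
  obtain \<tau>2 where \<tau>2: "0 < \<tau>2" "\<And>\<tau>. 0 < \<tau> \<Longrightarrow> \<tau> \<le> \<tau>2 \<Longrightarrow> \<exists>g\<in>attainable. \<forall>x\<in>C. norm (g x - x - \<tau> *\<^sub>R Y x) \<le> (\<epsilon>/3) * \<tau>"
    using tangentD[OF Y(1) C(1), of "\<epsilon>/3"] C(2) by auto
  define \<tau>3 where "\<tau>3 = min 1 (\<delta>/2) / (K + \<epsilon>)"
  have "\<tau>3 > 0" using \<delta>(1) K(1) C(2) by (simp add: \<tau>3_def)
  show "\<exists>\<tau>0>0. \<forall>\<tau>. 0 < \<tau> \<and> \<tau> \<le> \<tau>0 \<longrightarrow> (\<exists>g\<in>attainable. \<forall>x\<in>C. norm (g x - x - \<tau> *\<^sub>R (X x + Y x)) \<le> \<epsilon> * \<tau>)"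
  proof (intro exI[of _ "min \<tau>1 (min \<tau>2 \<tau>3)"] conjI allI impI)
    fix \<tau> assume "0 < \<tau> \<and> \<tau> \<le> min \<tau>1 (min \<tau>2 \<tau>3)"
    then have \<tau>: "0 < \<tau>" "\<tau> \<le> \<tau>1" "\<tau> \<le> \<tau>2" "\<tau> \<le> \<tau>3" by auto
    obtain g where g: "g \<in> attainable" "\<And>x. x \<in> Q \<Longrightarrow> norm (g x - x - \<tau> *\<^sub>R X x) \<le> (\<epsilon>/3) * \<tau>"
      using \<tau>1(2)[OF \<tau>(1,2)] by blast
    obtain h where h: "h \<in> attainable" "\<And>x. x \<in> C \<Longrightarrow> norm (h x - x - \<tau> *\<^sub>R Y x) \<le> (\<epsilon>/3) * \<tau>"
      using \<tau>2(2)[OF \<tau>(1,3)] by blast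
    have "(K + \<epsilon>) * \<tau> \<le> min 1 (\<delta>/2)"
      using \<tau>(4) K(1) C(2) unfolding \<tau>3_def by (simp add: pos_le_divide_eq mult.commute)
    then have small: "(K + \<epsilon>) * \<tau> \<le> 1" "(K + \<epsilon>) * \<tau> < \<delta>" using \<delta>(1) by auto
    have "norm (g (h x) - x - \<tau> *\<^sub>R (X x + Y x)) \<le> \<epsilon> * \<tau>" if x: "x \<in> C" for x
    proof -
      have "norm (h x - x) \<le> norm (h x - x - \<tau> *\<^sub>R Y x) + norm (\<tau> *\<^sub>R Y x)"
        using norm_triangle_sub[of "h x - x" "\<tau> *\<^sub>R Y x"] by simp
      also have "\<dots> \<le> (\<epsilon>/3) * \<tau> + \<tau> * K"
        using h(2)[OF x] K(2)[OF x] \<tau>(1) by (auto intro!: add_mono mult_left_mono)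
      also have "\<dots> \<le> (K + \<epsilon>) * \<tau>" using C(2) \<tau>(1) by (simp add: algebra_simps)
      finally have hx: "norm (h x - x) \<le> 1" "norm (h x - x) < \<delta>" using small by auto
      have xQ: "x \<in> Q" and hQ: "h x \<in> Q"
        using R[OF x] hx(1) norm_triangle_sub[of "h x" x] by (auto simp: Q_def)
      have "g (h x) - x - \<tau> *\<^sub>R (X x + Y x) = ((g (h x) - h x - \<tau> *\<^sub>R X (h x)) + \<tau> *\<^sub>R (X (h x) - X x)) + (h x - x - \<tau> *\<^sub>R Y x)"
        by (simp add: algebra_simps)
      also have "norm \<dots> \<le> ((\<epsilon>/3) * \<tau> + \<tau> * (\<epsilon>/3)) + (\<epsilon>/3) * \<tau>"
      proof (intro norm_triangle_mono g(2)[OF hQ] h(2)[OF x])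
        have "norm (X (h x) - X x) \<le> \<epsilon>/3" using \<delta>(2)[OF xQ hQ] hx(2) by (simp add: dist_norm)
        then show "norm (\<tau> *\<^sub>R (X (h x) - X x)) \<le> \<tau> * (\<epsilon>/3)" using \<tau>(1) by (simp add: mult_left_mono)
      qed
      finally show ?thesis by (simp add: algebra_simps)
    qed
    then show "\<exists>g\<in>attainable. \<forall>x\<in>C. norm (g x - x - \<tau> *\<^sub>R (X x + Y x)) \<le> \<epsilon> * \<tau>"
      by (intro bexI[OF _ attainable_compose[OF h(1) g(1)]]) simp
  qed (use \<tau>1(1) \<tau>2(1) \<open>\<tau>3 > 0\<close> in simp)
qed

end

section \<open>Lie brackets are tangent\<close>

context control_system
begin

text \<open>With \<open>D\<close> the derivative of \<open>F i\<close> at \<open>x\<close>, the flow for time \<open>c\<close> has there the derivative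
  \<open>v \<mapsto> v + c D v + o(c)\<close>. In terms of differences of values, the expansion does not involve the
  differentiability of flows with respect to the starting point.\<close>

lemma flow_difference_first_order:
  assumes c: "\<bar>c\<bar> \<le> 1" and D: "bounded_linear D" "\<And>v. norm (D v) \<le> K * norm v" and "0 \<le> \<eta>" "0 \<le> K"
    and lin: "\<And>a b. norm (a - x) < \<delta> \<Longrightarrow> norm (b - x) < \<delta> \<Longrightarrow> norm (F i a - F i b - D (a - b)) \<le> \<eta> * norm (a - b)"
    and p: "norm (p - x) + B * \<bar>c\<bar> < \<delta>" and q: "norm (q - x) + B * \<bar>c\<bar> < \<delta>"
  shows "norm (flow F (field_control i c) q - flow F (field_control i c) p - (q - p) - c *\<^sub>R D (q - p))
     \<le> \<bar>c\<bar> * (\<eta> + K * L * \<bar>c\<bar>) * (2 * exp (2 * \<Lambda>)) * norm (q - p)"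
proof -
  define a where "a = traj (field_control i c) q"
  define b where "b = traj (field_control i c) p"
  define r where "r = 2 * exp (2 * \<Lambda>) * norm (q - p)"
  have "0 \<le> r" by (simp add: r_def)
  have ac: "continuous_on {0..1} a" and bc: "continuous_on {0..1} b"
    by (simp_all add: a_def b_def field_traj_continuous)
  have va: "(\<lambda>s. c *\<^sub>R F i (a s)) integrable_on {0..t}" and vb: "(\<lambda>s. c *\<^sub>R F i (b s)) integrable_on {0..t}"
    if "t \<in> {0..1}" for t
    using velocity_integrable(2)[OF field_control_L2[of i c] ac, of 0 t] velocity_integrable(2)[OF field_control_L2[of i c] bc, of 0 t] that by auto
  have ab: "norm (a t - b t) \<le> r" if "t \<in> {0..1}" for t
  proof -
    have "norm (a t - b t) \<le> 2 * norm (q - p) * exp (2 * \<Lambda> * \<bar>c\<bar>)"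
      using integral_solution_dependence[OF field_control_L2[of i c] traj traj that, of q p] by (simp add: a_def b_def)
    also have "\<dots> \<le> 2 * norm (q - p) * exp (2 * \<Lambda>)"
      using c \<Lambda>_nonneg by (intro mult_left_mono) (auto simp: mult_left_le)
    finally show ?thesis by (simp add: r_def mult_ac)
  qed
  have diff: "a t - b t - (q - p) = integral {0..t} (\<lambda>s. c *\<^sub>R F i (a s) - c *\<^sub>R F i (b s))" if t: "t \<in> {0..1}" for t
  proof -
    have "integral {0..t} (\<lambda>s. c *\<^sub>R F i (a s) - c *\<^sub>R F i (b s)) = integral {0..t} (\<lambda>s. c *\<^sub>R F i (a s)) - integral {0..t} (\<lambda>s. c *\<^sub>R F i (b s))"
      by (rule Henstock_Kurzweil_Integration.integral_diff[OF va[OF t] vb[OF t]])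
    then show ?thesis using field_traj[OF t, of i c q] field_traj[OF t, of i c p] unfolding a_def b_def by simp
  qed
  have d2: "norm (a t - b t - (q - p)) \<le> L * \<bar>c\<bar> * r" if t: "t \<in> {0..1}" for t
  proof -
    have "norm (a t - b t - (q - p)) \<le> integral {0..t} (\<lambda>s. \<bar>c\<bar> * (L * r))"
      unfolding diff[OF t]
    proof (rule integral_norm_bound_integral[OF integrable_diff[OF va[OF t] vb[OF t]] integrable_const_ivl])
      fix s assume s: "s \<in> {0..t}"
      have "norm (c *\<^sub>R F i (a s) - c *\<^sub>R F i (b s)) = \<bar>c\<bar> * norm (F i (a s) - F i (b s))"
        by (simp add: scaleR_diff_right[symmetric])
      also have "\<dots> \<le> \<bar>c\<bar> * (L * norm (a s - b s))" by (intro mult_left_mono F_lipschitz) simp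
      also have "\<dots> \<le> \<bar>c\<bar> * (L * r)" using ab[of s] s t L_nonneg by (intro mult_left_mono) auto
      finally show "norm (c *\<^sub>R F i (a s) - c *\<^sub>R F i (b s)) \<le> \<bar>c\<bar> * (L * r)" .
    qed
    also have "\<dots> = t * (\<bar>c\<bar> * (L * r))" using t by simp
    also have "\<dots> \<le> 1 * (\<bar>c\<bar> * (L * r))" using t L_nonneg \<open>0 \<le> r\<close> by (intro mult_right_mono) auto
    finally show ?thesis by (simp add: mult_ac)
  qed
  have "a 1 - b 1 - (q - p) - c *\<^sub>R D (q - p) = integral {0..1} (\<lambda>s. c *\<^sub>R F i (a s) - c *\<^sub>R F i (b s)) - integral {0..1} (\<lambda>s::real. c *\<^sub>R D (q - p))"
    using diff[of 1] by simp
  also have "\<dots> = integral {0..1} (\<lambda>s. (c *\<^sub>R F i (a s) - c *\<^sub>R F i (b s)) - c *\<^sub>R D (q - p))"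
    using va[of 1] vb[of 1] by (intro Henstock_Kurzweil_Integration.integral_diff[symmetric] integrable_diff integrable_const_ivl) auto
  also have "norm \<dots> \<le> integral {0..1} (\<lambda>s::real. \<bar>c\<bar> * (\<eta> * r + K * (L * \<bar>c\<bar> * r)))"
  proof (rule integral_norm_bound_integral)
    show "(\<lambda>s. (c *\<^sub>R F i (a s) - c *\<^sub>R F i (b s)) - c *\<^sub>R D (q - p)) integrable_on {0..1}"
      using va[of 1] vb[of 1] by (intro integrable_diff integrable_const_ivl) auto
    fix s :: real assume s: "s \<in> {0..1}"
    have near: "norm (a s - x) < \<delta>" "norm (b s - x) < \<delta>"
      using norm_triangle_ineq[of "a s - q" "q - x"] norm_triangle_ineq[of "b s - p" "p - x"] p q
        field_traj_displacement[OF s, of i c q] field_traj_displacement[OF s, of i c p]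
      unfolding a_def b_def by auto
    have Dd: "D (a s - b s) = D (q - p) + D (a s - b s - (q - p))"
      using bounded_linear.linear[OF D(1)] by (simp add: linear_diff)
    have "(c *\<^sub>R F i (a s) - c *\<^sub>R F i (b s)) - c *\<^sub>R D (q - p)
        = c *\<^sub>R ((F i (a s) - F i (b s) - D (a s - b s)) + D (a s - b s - (q - p)))"
      unfolding Dd by (simp add: algebra_simps)
    also have "norm \<dots> = \<bar>c\<bar> * norm ((F i (a s) - F i (b s) - D (a s - b s)) + D (a s - b s - (q - p)))" by simp
    also have "\<dots> \<le> \<bar>c\<bar> * (\<eta> * r + K * (L * \<bar>c\<bar> * r))"
    proof (intro mult_left_mono norm_triangle_mono)
      show "norm (F i (a s) - F i (b s) - D (a s - b s)) \<le> \<eta> * r"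
        using lin[OF near] mult_left_mono[OF ab[OF s] \<open>0 \<le> \<eta>\<close>] by linarith
      show "norm (D (a s - b s - (q - p))) \<le> K * (L * \<bar>c\<bar> * r)"
        using D(2)[of "a s - b s - (q - p)"] mult_left_mono[OF d2[OF s] \<open>0 \<le> K\<close>] by linarith
    qed simp
    finally show "norm ((c *\<^sub>R F i (a s) - c *\<^sub>R F i (b s)) - c *\<^sub>R D (q - p)) \<le> \<bar>c\<bar> * (\<eta> * r + K * (L * \<bar>c\<bar> * r))" .
  qed (rule integrable_const_ivl)
  also have "\<dots> = \<bar>c\<bar> * (\<eta> * r + K * (L * \<bar>c\<bar> * r))" by simp
  also have "\<dots> = \<bar>c\<bar> * (\<eta> + K * L * \<bar>c\<bar>) * r" by (simp add: algebra_simps)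
  finally show ?thesis by (simp add: flow_traj a_def b_def r_def mult_ac)
qed

text \<open>With \<open>h\<^sub>s\<close> the flow of \<open>F i\<close> and \<open>g\<^sub>\<sigma>\<close>, \<open>g'\<^sub>\<sigma>\<close> attainable imitations of the fields \<open>X\<close> and
  \<open>-X\<close>, the map \<open>h\<^sub>-\<^sub>s \<circ> g\<^sub>\<sigma> \<circ> h\<^sub>s \<circ> g'\<^sub>\<sigma>\<close> displaces a point by \<open>s \<sigma> [F i, X]\<close>
  (or \<open>- s \<sigma> [F i, X]\<close>, if \<open>h\<close> is run backwards)
  up to an error that is \<open>o(s \<sigma>)\<close> when \<open>s\<close> is chosen first and \<open>\<sigma>\<close> is small depending on \<open>s\<close>: the
  imitations are only first order accurate in \<open>\<sigma>\<close>, and the factor \<open>s\<close> in the error can be gained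
  since \<open>s\<close> is already fixed when \<open>\<sigma>\<close> tends to zero.\<close>

lemma tangent_bracket:
  assumes F1: "Ck_on (Suc 0) UNIV (F i)" and X1: "Ck_on (Suc 0) UNIV X"
    and X: "tangent X" and mX: "tangent (\<lambda>x. - X x)" and c: "\<bar>c\<bar> = 1"
  shows "tangent (\<lambda>x. c *\<^sub>R lie_bracket (F i) X x)"
proof (rule tangentI)
  fix C :: "'a set" and \<epsilon> :: real assume C: "compact C" "0 < \<epsilon>"
  obtain R where R: "\<And>x. x \<in> C \<Longrightarrow> norm x \<le> R"
    using compact_imp_bounded[OF C(1)] by (auto simp: bounded_iff)
  define Q where "Q = cball (0::'a) (R + 1)"
  have Q: "compact Q" "convex Q" "Q \<subseteq> UNIV" by (simp_all add: Q_def)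
  have inQ: "y \<in> Q" if "x \<in> C" "norm (y - x) < 1" for x y
    using R[OF that(1)] that(2) norm_triangle_sub[of y x] by (simp add: Q_def)
  let ?DF = "\<lambda>x. frechet_derivative (F i) (at x)" and ?DX = "\<lambda>x. frechet_derivative X (at x)"
  note blF = has_derivative_bounded_linear[OF Ck_on_SucD(1)[OF F1 UNIV_I]]
  note blX = has_derivative_bounded_linear[OF Ck_on_SucD(1)[OF X1 UNIV_I]]
  obtain N where N: "0 < N" "\<And>x. x \<in> Q \<Longrightarrow> norm (X x) \<le> N"
    using compact_norm_bound[OF Q(1) continuous_on_subset[OF Ck_on_imp_continuous_on[OF X1] Q(3)]] by blast
  obtain K1 where K1: "0 \<le> K1" "\<And>x y. x \<in> Q \<Longrightarrow> y \<in> Q \<Longrightarrow> norm (X x - X y) \<le> K1 * norm (x - y)"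
     "\<And>x v. x \<in> Q \<Longrightarrow> norm (?DX x v) \<le> K1 * norm v"
    using C1_lipschitz_on_convex_compact[OF X1 Q] by blast
  obtain K2 where K2: "0 \<le> K2" "\<And>x v. x \<in> Q \<Longrightarrow> norm (?DF x v) \<le> K2 * norm v"
    using C1_derivative_bound[OF F1 Q(1,3)] by blast
  \<comment> \<open>\<open>E\<close> is a Lipschitz constant of the flows, \<open>A3 * \<eta> * s\<close> will bound the second order
    error of \<open>X\<close> along the flow of \<open>F i\<close>, and \<open>A * \<eta> * s * \<sigma>\<close> the sum of all errors.\<close>
  define E where "E = 2 * exp (2 * \<Lambda>)"
  have "E > 0" by (simp add: E_def)
  define A3 where "A3 = 1 + B + K1 * L * B"
  define A where "A = 2 + (1 + K2 * L) * E * (N + 1) + A3 + K2 + K2 * (A3 + K1 * M)"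
  have A3: "0 \<le> A3" using B_nonneg K1(1) L_nonneg by (simp add: A3_def)
  have "A > 0"
    unfolding A_def using A3 K1(1) K2(1) L_nonneg \<open>E > 0\<close> N(1) M_nonneg
    by (intro add_pos_nonneg) auto
  define \<eta> where "\<eta> = min 1 (\<epsilon> / A)"
  have \<eta>: "0 < \<eta>" "\<eta> \<le> 1" "\<eta> * A \<le> \<epsilon>"
    using \<open>A > 0\<close> C(2) by (auto simp: \<eta>_def min_def field_simps)
  obtain \<delta>1 where \<delta>1: "0 < \<delta>1" "\<And>x a b. x \<in> Q \<Longrightarrow> a \<in> Q \<Longrightarrow> b \<in> Q \<Longrightarrow> dist a x < \<delta>1 \<Longrightarrow> dist b x < \<delta>1 \<Longrightarrow>
       norm (F i a - F i b - ?DF x (a - b)) \<le> \<eta> * norm (a - b)"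
    using C1_uniform_linearization[OF F1 Q \<eta>(1)] by metis
  obtain \<delta>2 where \<delta>2: "0 < \<delta>2" "\<And>x a b. x \<in> Q \<Longrightarrow> a \<in> Q \<Longrightarrow> b \<in> Q \<Longrightarrow> dist a x < \<delta>2 \<Longrightarrow> dist b x < \<delta>2 \<Longrightarrow>
       norm (X a - X b - ?DX x (a - b)) \<le> \<eta> * norm (a - b)"
    using C1_uniform_linearization[OF X1 Q \<eta>(1)] by metis
  define \<delta> where "\<delta> = min 1 (min \<delta>1 \<delta>2)"
  have \<delta>: "0 < \<delta>" "\<delta> \<le> 1" "\<delta> \<le> \<delta>1" "\<delta> \<le> \<delta>2" using \<delta>1(1) \<delta>2(1) by (auto simp: \<delta>_def)
  \<comment> \<open>All points of the construction will be \<open>\<delta>\<close>-close to \<open>x\<close>.\<close>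
  define s where "s = min \<eta> (\<delta> / (5 * (B + 1)))"
  have "0 < s" "s \<le> \<eta>" using \<eta>(1) \<delta>(1) B_nonneg by (auto simp: s_def)
  have sB: "s * B < \<delta>/4"
  proof -
    have "s * B \<le> \<delta> / (5 * (B + 1)) * B" using B_nonneg by (intro mult_right_mono) (auto simp: s_def)
    also have "\<dots> \<le> \<delta> / 5" using \<delta>(1) B_nonneg by (simp add: field_simps)
    also have "\<dots> < \<delta>/4" using \<delta>(1) by simp
    finally show ?thesis .
  qed
  have "s \<le> 1" using \<open>s \<le> \<eta>\<close> \<eta>(2) by simp
  have "0 < \<eta> * s" using \<eta>(1) \<open>0 < s\<close> by simp
  \<comment> \<open>From here on \<open>s\<close> is fixed, and \<open>X\<close> and \<open>-X\<close> are imitated with relative error \<open>\<eta> * s\<close>.\<close>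
  obtain \<sigma>1 where \<sigma>1: "0 < \<sigma>1" "\<And>\<sigma>. 0 < \<sigma> \<Longrightarrow> \<sigma> \<le> \<sigma>1 \<Longrightarrow> \<exists>g\<in>attainable. \<forall>x\<in>Q. norm (g x - x - \<sigma> *\<^sub>R X x) \<le> (\<eta> * s) * \<sigma>"
    using tangentD[OF X Q(1) \<open>0 < \<eta> * s\<close>] by metis
  obtain \<sigma>2 where \<sigma>2: "0 < \<sigma>2" "\<And>\<sigma>. 0 < \<sigma> \<Longrightarrow> \<sigma> \<le> \<sigma>2 \<Longrightarrow> \<exists>g\<in>attainable. \<forall>x\<in>C. norm (g x - x - \<sigma> *\<^sub>R - X x) \<le> (\<eta> * s) * \<sigma>"
    using tangentD[OF mX C(1) \<open>0 < \<eta> * s\<close>] by metis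
  have cancel: "k * (d / k) = d" if "k \<noteq> 0" for k d :: real using that by simp
  define \<sigma>3 where "\<sigma>3 = (\<delta> / 5) / (N + 1)"
  define \<sigma>4 where "\<sigma>4 = \<eta> * s / ((K1 + 1) * E * (N + 1))"
  define \<sigma>0 where "\<sigma>0 = min (min \<sigma>1 \<sigma>2) (min \<sigma>3 \<sigma>4)"
  have "0 < \<sigma>3" "0 < \<sigma>4" using \<delta>(1) N(1) \<open>0 < \<eta> * s\<close> K1(1) \<open>E > 0\<close> by (auto simp: \<sigma>3_def \<sigma>4_def)
  then have "0 < \<sigma>0" using \<sigma>1(1) \<sigma>2(1) by (simp add: \<sigma>0_def)
  show "\<exists>\<tau>0>0. \<forall>\<tau>. 0 < \<tau> \<and> \<tau> \<le> \<tau>0 \<longrightarrow> (\<exists>g\<in>attainable. \<forall>x\<in>C. norm (g x - x - \<tau> *\<^sub>R (c *\<^sub>R lie_bracket (F i) X x)) \<le> \<epsilon> * \<tau>)"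
  proof (intro exI[of _ "s * \<sigma>0"] conjI allI impI)
    show "0 < s * \<sigma>0" using \<open>0 < s\<close> \<open>0 < \<sigma>0\<close> by simp
    fix \<tau> assume "0 < \<tau> \<and> \<tau> \<le> s * \<sigma>0"
    then have \<tau>: "0 < \<tau>" "\<tau> \<le> s * \<sigma>0" by auto
    define \<sigma> where "\<sigma> = \<tau> / s"
    have \<sigma>: "0 < \<sigma>" "\<sigma> \<le> \<sigma>0" "\<tau> = s * \<sigma>" using \<tau> \<open>0 < s\<close> by (auto simp: \<sigma>_def field_simps)
    then have \<sigma>le: "\<sigma> \<le> \<sigma>1" "\<sigma> \<le> \<sigma>2" "\<sigma> \<le> \<sigma>3" "\<sigma> \<le> \<sigma>4" by (auto simp: \<sigma>0_def)
    have \<sigma>N: "(N + 1) * \<sigma> < \<delta>/4"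
    proof -
      have "(N + 1) * \<sigma> \<le> (N + 1) * \<sigma>3" using \<sigma>le N(1) by (intro mult_left_mono) auto
      also have "\<dots> = \<delta>/5" unfolding \<sigma>3_def using N(1) by (intro cancel) linarith
      also have "\<dots> < \<delta>/4" using \<delta>(1) by simp
      finally show ?thesis .
    qed
    have \<sigma>E: "K1 * (E * ((N + 1) * \<sigma>)) \<le> \<eta> * s"
    proof -
      have "K1 * (E * ((N + 1) * \<sigma>)) \<le> (K1 + 1) * (E * ((N + 1) * \<sigma>4))"
        using \<sigma>le N(1) K1(1) \<open>E > 0\<close> \<sigma>(1) by (intro mult_mono) auto
      also have "\<dots> = ((K1 + 1) * E * (N + 1)) * \<sigma>4" by (simp only: mult_ac)
      also have "\<dots> = \<eta> * s" using N(1) K1(1) \<open>E > 0\<close> unfolding \<sigma>4_def by (intro cancel) simp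
      finally show ?thesis .
    qed
    obtain g where g: "g \<in> attainable" "\<And>x. x \<in> Q \<Longrightarrow> norm (g x - x - \<sigma> *\<^sub>R X x) \<le> (\<eta> * s) * \<sigma>"
      using \<sigma>1(2)[OF \<sigma>(1) \<sigma>le(1)] by blast
    obtain g' where g': "g' \<in> attainable" "\<And>x. x \<in> C \<Longrightarrow> norm (g' x - x - \<sigma> *\<^sub>R - X x) \<le> (\<eta> * s) * \<sigma>"
      using \<sigma>2(2)[OF \<sigma>(1) \<sigma>le(2)] by blast
    define h where "h = flow F (field_control i (s * c))"
    define h' where "h' = flow F (field_control i (- (s * c)))"
    have sc: "\<bar>s * c\<bar> = s" "\<bar>- (s * c)\<bar> = s" "(s * c)\<^sup>2 = s * s"
      using c \<open>0 < s\<close> by (auto simp: abs_mult power2_eq_square abs_if split: if_splits)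
    have \<eta>s\<sigma>: "(\<eta> * s) * \<sigma> \<le> \<sigma>"
      using \<eta>(1,2) \<open>0 < s\<close> \<open>s \<le> 1\<close> \<sigma>(1) by (simp add: mult_le_one)
    have "norm (h' (g (h (g' x))) - x - \<tau> *\<^sub>R (c *\<^sub>R lie_bracket (F i) X x)) \<le> \<epsilon> * \<tau>" if x: "x \<in> C" for x
    proof -
      have xQ: "x \<in> Q" using inQ[OF x, of x] by simp
      define y where "y = g' x"
      define p where "p = h y"
      define q where "q = g p"
      define z where "z = h' q"
      have hp: "h' p = y" unfolding p_def h_def h'_def by (rule flow_inverse)
      define e5 where "e5 = y - x + \<sigma> *\<^sub>R X x"
      have e5: "norm e5 \<le> (\<eta> * s) * \<sigma>" using g'(2)[OF x] by (simp add: e5_def y_def)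
      have yx: "norm (y - x) \<le> (N + 1) * \<sigma>"
      proof -
        have "y - x = e5 - \<sigma> *\<^sub>R X x" by (simp add: e5_def)
        then have "norm (y - x) \<le> norm e5 + norm (\<sigma> *\<^sub>R X x)"
          using norm_triangle_ineq4[of e5 "\<sigma> *\<^sub>R X x"] by (simp only:)
        also have "norm (\<sigma> *\<^sub>R X x) \<le> \<sigma> * N" using N(2)[OF xQ] \<sigma>(1) by simp
        finally show ?thesis using e5 \<eta>s\<sigma> by (simp add: algebra_simps)
      qed
      have disp: "norm (h w - w) \<le> s * B" for w
        using field_traj_displacement[of 1 i "s * c" w] sc by (simp add: h_def flow_traj mult.commute)
      have px: "norm (p - x) < \<delta>/2"
        using norm_triangle_ineq[of "p - y" "y - x"] disp[of y] yx \<sigma>N sB unfolding p_def by simp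
      then have pQ: "p \<in> Q" using inQ[OF x, of p] \<delta>(1,2) by simp
      define e2 where "e2 = q - p - \<sigma> *\<^sub>R X p"
      have e2: "norm e2 \<le> (\<eta> * s) * \<sigma>" using g(2)[OF pQ] by (simp add: e2_def q_def)
      have qp: "norm (q - p) \<le> (N + 1) * \<sigma>"
      proof -
        have "q - p = e2 + \<sigma> *\<^sub>R X p" by (simp add: e2_def)
        then have "norm (q - p) \<le> norm e2 + norm (\<sigma> *\<^sub>R X p)"
          using norm_triangle_ineq[of e2 "\<sigma> *\<^sub>R X p"] by (simp only:)
        also have "norm (\<sigma> *\<^sub>R X p) \<le> \<sigma> * N" using N(2)[OF pQ] \<sigma>(1) by simp
        finally show ?thesis using e2 \<eta>s\<sigma> by (simp add: algebra_simps)
      qed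
      have qx: "norm (q - x) < 3 * \<delta>/4"
        using norm_triangle_ineq[of "q - p" "p - x"] qp px \<sigma>N by simp
      \<comment> \<open>\<open>e1\<close>: error of the linearised \<open>h'\<close>; \<open>e3\<close>: error of the linearised change of \<open>X\<close>
        from \<open>x\<close> to \<open>p\<close>, which includes the displacement of \<open>y\<close>.\<close>
      define e1 where "e1 = z - y - (q - p) + (s * c) *\<^sub>R ?DF x (q - p)"
      have e1: "norm e1 \<le> (\<eta> * s) * \<sigma> * ((1 + K2 * L) * E * (N + 1))"
      proof -
        have "norm (h' q - h' p - (q - p) - (- (s * c)) *\<^sub>R ?DF x (q - p))
            \<le> \<bar>- (s * c)\<bar> * (\<eta> + K2 * L * \<bar>- (s * c)\<bar>) * (2 * exp (2 * \<Lambda>)) * norm (q - p)"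
          unfolding h'_def
        proof (rule flow_difference_first_order[where x = x and \<delta> = \<delta>])
          show "norm (F i a - F i b - ?DF x (a - b)) \<le> \<eta> * norm (a - b)" if "norm (a - x) < \<delta>" "norm (b - x) < \<delta>" for a b
            using \<delta>1(2)[OF xQ inQ[OF x, of a] inQ[OF x, of b]] that \<delta> by (simp add: dist_norm)
          show "norm (p - x) + B * \<bar>- (s * c)\<bar> < \<delta>" "norm (q - x) + B * \<bar>- (s * c)\<bar> < \<delta>"
            using px qx sB \<delta>(1) unfolding sc mult.commute[of B s] by linarith+
        qed (use sc \<open>s \<le> 1\<close> blF K2 xQ \<eta>(1) in auto)
        then have "norm e1 \<le> s * (\<eta> + K2 * L * s) * E * norm (q - p)"
          unfolding e1_def z_def hp sc E_def by simp
        also have "\<dots> \<le> s * (\<eta> + K2 * L * \<eta>) * E * ((N + 1) * \<sigma>)"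
          using \<open>0 < s\<close> \<open>s \<le> \<eta>\<close> \<open>E > 0\<close> qp K2(1) L_nonneg \<eta>(1) by (intro mult_mono add_mono) auto
        also have "\<dots> = (\<eta> * s) * \<sigma> * ((1 + K2 * L) * E * (N + 1))" by (simp add: algebra_simps)
        finally show ?thesis .
      qed
      define e3 where "e3 = X p - X x - (s * c) *\<^sub>R ?DX x (F i x)"
      have e3: "norm e3 \<le> (\<eta> * s) * A3"
      proof -
        have hx: "norm (h x - x) < \<delta>" using disp[of x] sB \<delta>(1) by simp
        then have hQ: "h x \<in> Q" using inQ[OF x, of "h x"] \<delta>(2) by simp
        have "norm (p - h x) \<le> E * norm (y - x)"
        proof -
          have "norm (p - h x) \<le> 2 * norm (y - x) * exp (2 * \<Lambda> * s)"
            using flow_lipschitz[OF field_control_L2[of i "s * c"], of y x] sc unfolding p_def h_def by simp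
          also have "\<dots> \<le> 2 * norm (y - x) * exp (2 * \<Lambda>)"
            using \<open>s \<le> 1\<close> \<Lambda>_nonneg by (intro mult_left_mono) (auto simp: mult_left_le)
          finally show ?thesis by (simp add: E_def mult_ac)
        qed
        then have "norm (X p - X (h x)) \<le> K1 * (E * ((N + 1) * \<sigma>))"
          using K1(2)[OF pQ hQ] yx K1(1) \<open>E > 0\<close> by (meson mult_left_mono order_trans less_imp_le)
        then have 1: "norm (X p - X (h x)) \<le> \<eta> * s" using \<sigma>E by linarith
        have "norm (X (h x) - X x - ?DX x (h x - x)) \<le> \<eta> * norm (h x - x)"
          using \<delta>2(2)[OF xQ hQ xQ] hx \<delta> \<delta>2(1) by (simp add: dist_norm)
        also have "\<dots> \<le> \<eta> * (s * B)" using disp[of x] \<eta>(1) by (intro mult_left_mono) auto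
        finally have 2: "norm (X (h x) - X x - ?DX x (h x - x)) \<le> \<eta> * s * B" by simp
        have "norm (?DX x (h x - x - (s * c) *\<^sub>R F i x)) \<le> K1 * (L * B * (s * s))"
          using K1(3)[OF xQ, of "h x - x - (s * c) *\<^sub>R F i x"] field_flow_first_order[of i "s * c" x] K1(1)
          unfolding h_def sc by (meson mult_left_mono order_trans)
        also have "\<dots> \<le> K1 * (L * B * (\<eta> * s))"
          using K1(1) L_nonneg B_nonneg \<open>s \<le> \<eta>\<close> \<open>0 < s\<close> by (intro mult_left_mono mult_right_mono) auto
        finally have 3: "norm (?DX x (h x - x - (s * c) *\<^sub>R F i x)) \<le> \<eta> * s * (K1 * L * B)" by (simp add: mult_ac)
        have "?DX x (h x - x - (s * c) *\<^sub>R F i x) = ?DX x (h x - x) - (s * c) *\<^sub>R ?DX x (F i x)"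
          using bounded_linear.linear[OF blX] by (simp add: linear_diff linear_cmul)
        then have "e3 = ((X p - X (h x)) + (X (h x) - X x - ?DX x (h x - x))) + ?DX x (h x - x - (s * c) *\<^sub>R F i x)"
          by (simp add: e3_def)
        also have "norm \<dots> \<le> (\<eta> * s + \<eta> * s * B) + \<eta> * s * (K1 * L * B)"
          by (intro norm_triangle_mono 1 2 3)
        finally show ?thesis by (simp add: A3_def algebra_simps)
      qed
      have Xd: "norm (X p - X x) \<le> s * (A3 + K1 * M)"
      proof -
        have "X p - X x = e3 + (s * c) *\<^sub>R ?DX x (F i x)" by (simp add: e3_def)
        also have "norm \<dots> \<le> s * A3 + s * (K1 * M)"
        proof (rule norm_triangle_mono)
          have "(\<eta> * s) * A3 \<le> (1 * s) * A3" using \<eta>(2) \<open>0 < s\<close> A3 by (intro mult_right_mono) auto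
          then show "norm e3 \<le> s * A3" using e3 by simp
          have "norm (?DX x (F i x)) \<le> K1 * M"
            using K1(3)[OF xQ, of "F i x"] F_bound[of i x] K1(1) by (meson mult_left_mono order_trans)
          then show "norm ((s * c) *\<^sub>R ?DX x (F i x)) \<le> s * (K1 * M)" using sc \<open>0 < s\<close> by simp
        qed
        finally show ?thesis by (simp add: distrib_left)
      qed
      have lin: "?DF x (q - p) = \<sigma> *\<^sub>R ?DF x (X x) + \<sigma> *\<^sub>R ?DF x (X p - X x) + ?DF x e2"
      proof -
        have "q - p = \<sigma> *\<^sub>R X x + \<sigma> *\<^sub>R (X p - X x) + e2" by (simp add: e2_def algebra_simps)
        then show ?thesis using bounded_linear.linear[OF blF] by (simp add: linear_add linear_cmul)
      qed
      \<comment> \<open>The terms \<open>\<sigma> X x\<close> cancel; what remains at order \<open>s \<sigma>\<close> is the bracket.\<close>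
      have "z - x - \<tau> *\<^sub>R (c *\<^sub>R lie_bracket (F i) X x)
          = (((e5 + e2) + e1) + \<sigma> *\<^sub>R e3) + ((- (s * c)) *\<^sub>R ?DF x e2 + (- (s * c)) *\<^sub>R (\<sigma> *\<^sub>R ?DF x (X p - X x)))"
        unfolding lie_bracket_def \<sigma>(3) e5_def e2_def[symmetric]
        using lin unfolding e1_def e3_def by (simp add: e2_def algebra_simps)
      also have "norm \<dots> \<le> ((((\<eta> * s) * \<sigma> + (\<eta> * s) * \<sigma>) + (\<eta> * s) * \<sigma> * ((1 + K2 * L) * E * (N + 1))) + \<sigma> * ((\<eta> * s) * A3))
          + ((\<eta> * s) * \<sigma> * K2 + (\<eta> * s) * \<sigma> * (K2 * (A3 + K1 * M)))"
      proof (intro norm_triangle_mono e5 e2 e1)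
        show "norm (\<sigma> *\<^sub>R e3) \<le> \<sigma> * ((\<eta> * s) * A3)" using e3 \<sigma>(1) by simp
        have "norm ((- (s * c)) *\<^sub>R ?DF x e2) = s * norm (?DF x e2)" using sc by simp
        also have "\<dots> \<le> 1 * norm (?DF x e2)" using \<open>s \<le> 1\<close> by (intro mult_right_mono) auto
        also have "\<dots> \<le> K2 * ((\<eta> * s) * \<sigma>)"
          using K2(2)[OF xQ, of e2] mult_left_mono[OF e2 K2(1)] by simp
        finally show "norm ((- (s * c)) *\<^sub>R ?DF x e2) \<le> (\<eta> * s) * \<sigma> * K2" by (simp add: mult_ac)
        have "norm ((- (s * c)) *\<^sub>R (\<sigma> *\<^sub>R ?DF x (X p - X x))) = s * (\<sigma> * norm (?DF x (X p - X x)))"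
          unfolding norm_scaleR sc using \<sigma>(1) by simp
        also have "\<dots> \<le> s * (\<sigma> * (K2 * (s * (A3 + K1 * M))))"
          using K2(2)[OF xQ, of "X p - X x"] mult_left_mono[OF Xd K2(1)] \<open>0 < s\<close> \<sigma>(1) by (intro mult_left_mono) auto
        also have "\<dots> \<le> s * (\<sigma> * (K2 * (\<eta> * (A3 + K1 * M))))"
          using \<open>s \<le> \<eta>\<close> \<open>0 < s\<close> \<sigma>(1) K2(1) A3 K1(1) M_nonneg by (intro mult_left_mono mult_right_mono) auto
        finally show "norm ((- (s * c)) *\<^sub>R (\<sigma> *\<^sub>R ?DF x (X p - X x))) \<le> (\<eta> * s) * \<sigma> * (K2 * (A3 + K1 * M))"
          by (simp add: mult_ac)
      qed
      also have "\<dots> = (\<eta> * A) * (s * \<sigma>)" by (simp add: A_def algebra_simps)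
      also have "\<dots> \<le> \<epsilon> * (s * \<sigma>)" using \<eta>(3) \<open>0 < s\<close> \<sigma>(1) by (intro mult_right_mono) auto
      finally show ?thesis by (simp add: z_def q_def p_def y_def \<sigma>(3))
    qed
    moreover have "(\<lambda>x. h' (g (h (g' x)))) \<in> attainable"
      using attainable_compose[OF attainable_compose[OF attainable_compose[OF g'(1), of h] g(1)], of h']
      unfolding h_def h'_def by simp
    ultimately show "\<exists>g\<in>attainable. \<forall>x\<in>C. norm (g x - x - \<tau> *\<^sub>R (c *\<^sub>R lie_bracket (F i) X x)) \<le> \<epsilon> * \<tau>"
      by (intro bexI[of _ "\<lambda>x. h' (g (h (g' x)))"]) auto
  qed
qed

text \<open>Tangent fields are closed under nonnegative multiples only, therefore both signs are carried through the
  induction.\<close>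

lemma tangent_iter_brackets:
  assumes smooth: "\<And>i. smooth_on UNIV (F i)" and "X \<in> iter_brackets F"
  shows "tangent X \<and> tangent (\<lambda>x. - X x)"
  using assms(2)
proof induction
  case (1 i)
  show ?case using tangent_field[of 1 i] tangent_field[of "-1" i] by simp
next
  case (2 X i)
  have "Ck_on (Suc 0) UNIV (F i)" "Ck_on (Suc 0) UNIV X"
    using smooth smooth_on_iter_brackets[OF smooth 2(1)] unfolding smooth_on_def by blast+
  then have "tangent (\<lambda>x. c *\<^sub>R lie_bracket (F i) X x)" if "\<bar>c\<bar> = 1" for c
    using 2 that by (intro tangent_bracket) auto
  from this[of 1] this[of "-1"] show ?case by simp
qed

lemma tangent_Lie:
  assumes smooth: "\<And>i. smooth_on UNIV (F i)" and "X \<in> Lie F"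
  shows "tangent X"
proof -
  obtain S c where S: "finite S" "S \<subseteq> iter_brackets F" and X: "X = (\<lambda>x. \<Sum>Z\<in>S. c Z *\<^sub>R Z x)"
    using assms(2) by (auto simp: Lie_def)
  have cont: "continuous_on UNIV Z" if "Z \<in> iter_brackets F" for Z
    using smooth_on_iter_brackets[OF smooth that] Ck_on_imp_continuous_on unfolding smooth_on_def by blast
  have one: "tangent (\<lambda>x. c Z *\<^sub>R Z x)" if "Z \<in> iter_brackets F" for Z
  proof (cases "0 \<le> c Z")
    case True
    then show ?thesis using tangent_iter_brackets[OF smooth that] tangent_scaleR by blast
  next
    case False
    then have "tangent (\<lambda>x. (- c Z) *\<^sub>R (- Z x))"
      using tangent_iter_brackets[OF smooth that] by (intro tangent_scaleR) auto
    then show ?thesis by simp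
  qed
  have "tangent (\<lambda>x. \<Sum>Z\<in>S. c Z *\<^sub>R Z x)"
    using S
  proof (induction S rule: finite_induct)
    case empty
    show ?case using tangent_zero by simp
  next
    case (insert Z S)
    have "continuous_on UNIV (\<lambda>x. c Y *\<^sub>R Y x)" if "Y \<in> insert Z S" for Y
      using that insert.prems by (intro continuous_on_scaleR continuous_on_const cont) blast
    then have "tangent (\<lambda>x. c Z *\<^sub>R Z x + (\<Sum>Z\<in>S. c Z *\<^sub>R Z x))"
      using insert one by (intro tangent_add continuous_on_sum) auto
    then show ?case using insert by simp
  qed
  then show ?thesis by (simp add: X)
qed

lemma lie_approximating_imp_tangent:
  assumes smooth: "\<And>i. smooth_on UNIV (F i)" and "lie_strong_approximating F" and Y: "smooth_on UNIV Y"
  shows "tangent Y"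
proof (rule tangent_limit)
  fix C :: "'a set" and \<epsilon> :: real assume C: "compact C" "0 < \<epsilon>"
  obtain \<delta> where "(INF X\<in>Lie_C1 \<delta> C F. SUP x\<in>C. ennreal (norm (X x - Y x))) = 0"
    using assms(2) Y C(1) unfolding lie_strong_approximating_def smooth_on_def by blast
  also have "(0::ennreal) < ennreal \<epsilon>" using C(2) by simp
  finally obtain X where X: "X \<in> Lie_C1 \<delta> C F" "(SUP x\<in>C. ennreal (norm (X x - Y x))) < ennreal \<epsilon>"
    unfolding INF_less_iff by blast
  have "norm (X x - Y x) \<le> \<epsilon>" if "x \<in> C" for x
  proof -
    have "ennreal (norm (X x - Y x)) \<le> (SUP x\<in>C. ennreal (norm (X x - Y x)))"
      using that by (rule SUP_upper)
    also have "\<dots> < ennreal \<epsilon>" by (rule X(2))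
    finally show ?thesis using C(2) by (simp add: ennreal_less_iff)
  qed
  moreover have "tangent X" using X(1) tangent_Lie[OF smooth] by (simp add: Lie_C1_def)
  ultimately show "\<exists>X. tangent X \<and> (\<forall>x\<in>C. norm (X x - Y x) \<le> \<epsilon>)" by blast
qed

end

section \<open>Following a diffeotopy\<close>

text \<open>The lower bound is assumed only for points \<open>w\<close> in the unit ball around \<open>z\<close>. It forces \<open>z'\<close> to lie in that
  ball, since the connected preimage of the ball of radius \<open>c\<close> around \<open>f z\<close> cannot cross the unit sphere.\<close>

lemma expanding_homeomorphism_near:
  fixes f f' :: "'a::euclidean_space \<Rightarrow> 'a"
  assumes inv: "\<And>y. f (f' y) = y" "\<And>x. f' (f x) = x" and cont: "continuous_on UNIV f'"
    and exp: "\<And>w. dist z w \<le> 1 \<Longrightarrow> c * dist z w \<le> dist (f z) (f w)"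
    and near: "dist (f z) (f z') < c"
  shows "c * dist z z' \<le> dist (f z) (f z')"
proof (rule exp, rule ccontr)
  assume far: "\<not> dist z z' \<le> 1"
  define U where "U = f' ` ball (f z) c"
  have "0 < c" using near zero_le_dist[of "f z" "f z'"] by linarith
  then have "z \<in> U" unfolding U_def by (intro image_eqI[of _ _ "f z"]) (simp_all add: inv(2))
  have "z' \<in> U" using near unfolding U_def by (intro image_eqI[of _ _ "f z'"]) (simp_all add: inv(2))
  have "connected U"
    unfolding U_def by (intro connected_continuous_image continuous_on_subset[OF cont]) auto
  then have "connected (dist z ` U)"
    by (intro connected_continuous_image continuous_intros)
  then have "1 \<in> dist z ` U"
    using \<open>z \<in> U\<close> \<open>z' \<in> U\<close> far connectedD_interval[of "dist z ` U" "dist z z" "dist z z'" 1] by force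
  then obtain y where "y \<in> ball (f z) c" "dist z (f' y) = 1" unfolding U_def by auto
  then show False using exp[of "f' y"] inv(1) by simp
qed

lemma Icc_uniform_choice:
  fixes P :: "real \<Rightarrow> real \<Rightarrow> bool"
  assumes loc: "\<And>s0. s0 \<in> {0..1} \<Longrightarrow> \<exists>\<delta>>0. \<exists>c>0. \<forall>s\<in>{0..1}. \<bar>s - s0\<bar> < \<delta> \<longrightarrow> P s c"
    and mono: "\<And>s c c'. P s c \<Longrightarrow> 0 < c' \<Longrightarrow> c' \<le> c \<Longrightarrow> P s c'"
  shows "\<exists>c>0. \<forall>s\<in>{0..1}. P s c"
proof -
  obtain \<delta> c where \<delta>: "\<And>s0. s0 \<in> {0..1} \<Longrightarrow> 0 < \<delta> s0" "\<And>s0. s0 \<in> {0..1} \<Longrightarrow> 0 < c s0"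
    and P: "\<And>s0 s. s0 \<in> {0..1} \<Longrightarrow> s \<in> {0..1} \<Longrightarrow> \<bar>s - s0\<bar> < \<delta> s0 \<Longrightarrow> P s (c s0)"
    using loc by metis
  obtain D where D: "D \<subseteq> {0..1}" "finite D" "{0..1} \<subseteq> (\<Union>s0\<in>D. ball s0 (\<delta> s0))"
  proof (rule compactE_image[of "{0..1::real}" "{0..1}" "\<lambda>s0. ball s0 (\<delta> s0)"])
    show "{0..1} \<subseteq> (\<Union>s0\<in>{0..1}. ball s0 (\<delta> s0))" using \<delta>(1) by force
  qed auto
  have "D \<noteq> {}" using D(3) by (metis UN_empty atLeastAtMost_iff empty_iff le_numeral_extra(3) subset_empty zero_le_one)
  define m where "m = Min (c ` D)"
  have m: "0 < m" "\<And>s0. s0 \<in> D \<Longrightarrow> m \<le> c s0"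
    using D(1,2) \<open>D \<noteq> {}\<close> \<delta>(2) by (auto simp: m_def)
  have "P s m" if s: "s \<in> {0..1}" for s
  proof -
    obtain s0 where s0: "s0 \<in> D" "s \<in> ball s0 (\<delta> s0)" using D(3) s by blast
    then have "P s (c s0)" using P[of s0 s] D(1) s by (auto simp: dist_real_def abs_minus_commute)
    then show ?thesis using m(1) m(2)[OF s0(1)] by (rule mono)
  qed
  then show ?thesis using m(1) by blast
qed

locale diffeotopy =
  fixes H :: "real \<Rightarrow> 'a::euclidean_space \<Rightarrow> 'a" and T
  assumes T: "open T" "{0..1} \<times> UNIV \<subseteq> T"
    and smooth: "smooth_on T (\<lambda>(s, x). H s x)"
    and diffeo: "\<And>s. s \<in> {0..1} \<Longrightarrow> diffeomorphism (H s)"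
begin

abbreviation G where "G \<equiv> (\<lambda>(s, x). H s x)"

definition time_derivative :: "real \<Rightarrow> 'a \<Rightarrow> 'a" where
  "time_derivative s z = dir_deriv (1, 0) G (s, z)"

lemma G_C1: "Ck_on (Suc 0) T G" and G_continuous: "continuous_on T G"
  using smooth Ck_on_imp_continuous_on unfolding smooth_on_def by blast+

lemma in_T: "s \<in> {0..1} \<Longrightarrow> (s, z) \<in> T"
  using T(2) by auto

lemma H_inverse:
  assumes "s \<in> {0..1}"
  shows "H s (inv (H s) y) = y" "inv (H s) (H s x) = x"
    "smooth_on UNIV (H s)" "smooth_on UNIV (inv (H s))"
  using diffeo[OF assms] unfolding diffeomorphism_def
  by (auto simp: bij_is_surj bij_is_inj surj_f_inv_f)

lemma time_derivative_smooth:
  assumes "s \<in> {0..1}"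
  shows "Ck_on k UNIV (time_derivative s)"
proof -
  have e: "((1::real), (0::'a)) \<in> Basis" by (simp add: Basis_prod_def)
  have "Ck_on (Suc k) T G" using smooth unfolding smooth_on_def by blast
  from Ck_on_SucD(2)[OF this e] have "Ck_on k T (dir_deriv (1, 0) G)" .
  moreover have "Ck_on k UNIV (\<lambda>z::'a. (0, z) + (s, 0))"
    by (intro Ck_on_affine) (auto intro: bounded_linear_Pair bounded_linear_zero bounded_linear_ident)
  moreover have "(\<lambda>z::'a. (0, z) + (s, 0)) ` UNIV \<subseteq> T"
    using in_T[OF assms] by auto
  ultimately have "Ck_on k UNIV (\<lambda>z. dir_deriv (1, 0) G ((0, z) + (s, 0)))"
    using Ck_on_compose[OF open_UNIV] by blast
  then show ?thesis by (simp add: time_derivative_def[abs_def])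
qed

lemma time_derivative_continuous: "continuous_on T (\<lambda>(s, z). time_derivative s z)"
proof -
  have e: "((1::real), (0::'a)) \<in> Basis" by (simp add: Basis_prod_def)
  show ?thesis
    using Ck_on_SucD(2)[OF G_C1 e] by (simp add: time_derivative_def split_def)
qed

definition eulerian_velocity :: "real \<Rightarrow> 'a \<Rightarrow> 'a" where
  "eulerian_velocity s y = time_derivative s (inv (H s) y)"

lemma eulerian_velocity_smooth:
  assumes "s \<in> {0..1}"
  shows "smooth_on UNIV (eulerian_velocity s)"
  unfolding eulerian_velocity_def[abs_def] smooth_on_def
proof
  fix k
  have "Ck_on k UNIV (inv (H s))" using H_inverse(4)[OF assms] unfolding smooth_on_def by (rule spec)
  with time_derivative_smooth[OF assms] show "Ck_on k UNIV (\<lambda>y. time_derivative s (inv (H s) y))"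
    by (rule Ck_on_compose[OF open_UNIV subset_UNIV])
qed

lemma first_order_in_time:
  assumes "0 < \<epsilon>"
  obtains \<tau>0 where "0 < \<tau>0"
    "\<And>s \<tau> z. 0 \<le> s \<Longrightarrow> 0 < \<tau> \<Longrightarrow> \<tau> \<le> \<tau>0 \<Longrightarrow> s + \<tau> \<le> 1 \<Longrightarrow> norm z \<le> R \<Longrightarrow>
       norm (H (s + \<tau>) z - H s z - \<tau> *\<^sub>R time_derivative s z) \<le> \<epsilon> * \<tau>"
proof -
  define S where "S = {0..1::real} \<times> cball (0::'a) R"
  have S: "compact S" "convex S" "S \<subseteq> T"
    using T(2) by (auto simp: S_def intro!: compact_Times convex_Times)
  obtain \<delta> where \<delta>: "0 < \<delta>" "\<And>x a b. x \<in> S \<Longrightarrow> a \<in> S \<Longrightarrow> b \<in> S \<Longrightarrow> dist a x < \<delta> \<Longrightarrow> dist b x < \<delta> \<Longrightarrow>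
       norm (G a - G b - frechet_derivative G (at x) (a - b)) \<le> \<epsilon> * norm (a - b)"
    using C1_uniform_linearization[OF G_C1 S assms] by metis
  show thesis
  proof (rule that[of "\<delta>/2"])
    fix s \<tau> :: real and z :: 'a assume *: "0 \<le> s" "0 < \<tau>" "\<tau> \<le> \<delta>/2" "s + \<tau> \<le> 1" "norm z \<le> R"
    then have "(s, z) \<in> S" "(s + \<tau>, z) \<in> S" by (auto simp: S_def)
    moreover have "dist (s + \<tau>, z) (s, z) < \<delta>" using * \<delta>(1) by (simp add: dist_Pair_Pair dist_real_def)
    ultimately have "norm (G (s + \<tau>, z) - G (s, z) - frechet_derivative G (at (s, z)) ((s + \<tau>, z) - (s, z))) \<le> \<epsilon> * norm ((s + \<tau>, z) - (s, z))"
      using \<delta> by (intro \<delta>(2)) auto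
    moreover have "(s + \<tau>, z) - (s, z) = \<tau> *\<^sub>R (1, 0)" by simp
    moreover have "frechet_derivative G (at (s, z)) (\<tau> *\<^sub>R (1, 0)) = \<tau> *\<^sub>R time_derivative s z"
      using has_derivative_bounded_linear[OF Ck_on_SucD(1)[OF G_C1 in_T[of s z]]] *
      unfolding time_derivative_def by (intro linear_cmul bounded_linear.linear) auto
    moreover have "norm (\<tau> *\<^sub>R (1::real, 0::'a)) = \<tau>" using *(2) by (simp add: norm_Pair)
    ultimately show "norm (H (s + \<tau>) z - H s z - \<tau> *\<^sub>R time_derivative s z) \<le> \<epsilon> * \<tau>"
      by (simp only: split)
  qed (use \<delta>(1) in simp)
qed

text \<open>For fixed \<open>s0\<close> the inverse of \<open>H s0\<close> is Lipschitz on compact sets, and for \<open>s\<close> near \<open>s0\<close> the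
  difference \<open>H s - H s0\<close> has a small Lipschitz constant. So the inverses are uniformly Lipschitz, without
  any discussion of the joint regularity of \<open>(s, y) \<mapsto> inv (H s) y\<close>.\<close>

lemma uniformly_expanding:
  "\<exists>c>0. \<forall>s\<in>{0..1}. \<forall>u v. norm u \<le> R \<longrightarrow> norm v \<le> R \<longrightarrow> c * norm (u - v) \<le> norm (H s u - H s v)"
proof (rule Icc_uniform_choice)
  fix s0 :: real assume s0: "s0 \<in> {0..1}"
  have Hc: "continuous_on UNIV (H s0)"
    using H_inverse(3)[OF s0] Ck_on_imp_continuous_on unfolding smooth_on_def by blast
  obtain R' where R': "\<And>u. norm u \<le> R \<Longrightarrow> norm (H s0 u) \<le> R'"
    using compact_norm_bound[OF compact_cball[of "0::'a" R] continuous_on_subset[OF Hc]] by (metis mem_cball_0 subset_UNIV)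
  have "Ck_on (Suc 0) UNIV (inv (H s0))"
    using H_inverse(4)[OF s0] unfolding smooth_on_def by blast
  from C1_lipschitz_on_convex_compact[OF this compact_cball convex_cball subset_UNIV, of 0 R']
  obtain K where K: "0 \<le> K" "\<And>x y. x \<in> cball 0 R' \<Longrightarrow> y \<in> cball 0 R' \<Longrightarrow> norm (inv (H s0) x - inv (H s0) y) \<le> K * norm (x - y)"
    by metis
  define K' where "K' = K + 1"
  have K': "0 < K'" using K(1) by (simp add: K'_def)
  have low: "norm (u - v) \<le> K' * norm (H s0 u - H s0 v)" if "norm u \<le> R" "norm v \<le> R" for u v
  proof -
    have "norm (u - v) \<le> K * norm (H s0 u - H s0 v)"
      using K(2)[of "H s0 u" "H s0 v"] R' that H_inverse(2)[OF s0] by simp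
    also have "\<dots> \<le> K' * norm (H s0 u - H s0 v)" by (intro mult_right_mono) (auto simp: K'_def)
    finally show ?thesis .
  qed
  define S where "S = {0..1::real} \<times> cball (0::'a) R"
  have S: "compact S" "S \<subseteq> T"
    using T(2) by (auto simp: S_def intro!: compact_Times)
  obtain \<delta> where \<delta>: "0 < \<delta>" "\<And>x z v. x \<in> S \<Longrightarrow> z \<in> S \<Longrightarrow> dist z x < \<delta> \<Longrightarrow>
       norm (frechet_derivative G (at z) v - frechet_derivative G (at x) v) \<le> 1 / (2 * K') * norm v"
    using C1_derivative_uniformly_continuous[OF G_C1 S, of "1 / (2 * K')"] K' by (metis divide_pos_pos mult_pos_pos zero_less_numeral zero_less_one)
  have up: "norm ((H s u - H s0 u) - (H s v - H s0 v)) \<le> 1 / (2 * K') * norm (u - v)"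
    if s: "s \<in> {0..1}" "\<bar>s - s0\<bar> < \<delta>" and uv: "norm u \<le> R" "norm v \<le> R" for s u v
  proof (rule differentiable_bound[where S = "cball 0 R" and
        f' = "\<lambda>z w. frechet_derivative G (at (s, z)) (0, w) - frechet_derivative G (at (s0, z)) (0, w)"])
    fix z :: 'a assume z: "z \<in> cball 0 R"
    have slice: "(H r has_derivative (\<lambda>w. frechet_derivative G (at (r, z)) (0, w))) (at z within cball 0 R)" if "r \<in> {0..1}" for r
    proof -
      have "((\<lambda>z. (r, z)) has_derivative (\<lambda>w. (0, w))) (at z within cball 0 R)"
        by (auto intro!: derivative_eq_intros)
      from has_derivative_compose[OF this Ck_on_SucD(1)[OF G_C1 in_T[OF that]]]
      show ?thesis by simp
    qed
    show "((\<lambda>u. H s u - H s0 u) has_derivative (\<lambda>w. frechet_derivative G (at (s, z)) (0, w) - frechet_derivative G (at (s0, z)) (0, w))) (at z within cball 0 R)"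
      by (intro has_derivative_diff slice s s0)
    show "onorm (\<lambda>w. frechet_derivative G (at (s, z)) (0, w) - frechet_derivative G (at (s0, z)) (0, w)) \<le> 1 / (2 * K')"
    proof (rule onorm_bound)
      fix w
      have "dist (s, z) (s0, z) < \<delta>" using s(2) by (simp add: dist_Pair_Pair dist_real_def)
      then show "norm (frechet_derivative G (at (s, z)) (0, w) - frechet_derivative G (at (s0, z)) (0, w)) \<le> 1 / (2 * K') * norm w"
        using \<delta>(2)[of "(s0, z)" "(s, z)" "(0, w)"] s s0 z by (simp add: S_def norm_Pair)
    qed (use K' in simp)
  qed (use uv in auto)
  have "1 / (2 * K') * norm (u - v) \<le> norm (H s u - H s v)"
    if s: "s \<in> {0..1}" "\<bar>s - s0\<bar> < \<delta>" and uv: "norm u \<le> R" "norm v \<le> R" for s u v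
  proof -
    have "1 / K' * norm (u - v) \<le> norm (H s0 u - H s0 v)"
      using low[OF uv] K' by (simp add: field_simps)
    moreover have "H s0 u - H s0 v = (H s u - H s v) - ((H s u - H s0 u) - (H s v - H s0 v))" by simp
    then have "norm (H s0 u - H s0 v) \<le> norm (H s u - H s v) + norm ((H s u - H s0 u) - (H s v - H s0 v))"
      by (metis norm_triangle_ineq4)
    moreover have "1 / K' * norm (u - v) = 1 / (2 * K') * norm (u - v) + 1 / (2 * K') * norm (u - v)"
      using K' by (simp add: field_simps)
    ultimately show ?thesis using up[OF s uv] by linarith
  qed
  then show "\<exists>\<delta>>0. \<exists>c>0. \<forall>s\<in>{0..1}. \<bar>s - s0\<bar> < \<delta> \<longrightarrow>
      (\<forall>u v. norm u \<le> R \<longrightarrow> norm v \<le> R \<longrightarrow> c * norm (u - v) \<le> norm (H s u - H s v))"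
    using \<delta>(1) K' by (intro exI[of _ \<delta>] conjI exI[of _ "1 / (2 * K')"]) auto
next
  fix s c c' :: real
  assume *: "\<forall>u v. norm u \<le> R \<longrightarrow> norm v \<le> R \<longrightarrow> c * norm (u - v) \<le> norm (H s u - H s v)" "c' \<le> c"
  show "\<forall>u v. norm u \<le> R \<longrightarrow> norm v \<le> R \<longrightarrow> c' * norm (u - v) \<le> norm (H s u - H s v)"
    using *(1) mult_right_mono[OF *(2) norm_ge_zero] by (meson order_trans)
qed

end

locale steered_diffeotopy = control_system F M L + diffeotopy H T
  for F :: "'l::finite \<Rightarrow> 'a \<Rightarrow> 'a::euclidean_space" and M L and H :: "real \<Rightarrow> 'a \<Rightarrow> 'a" and T +
  assumes smooth_tangent: "\<And>Y. smooth_on UNIV Y \<Longrightarrow> tangent Y"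
begin

text \<open>For \<open>s\<close> near \<open>s0\<close> the field at time \<open>s0\<close> is followed, which differs only little from the velocity at
  time \<open>s\<close>. It is evaluated at points \<open>H s z\<close> with \<open>z\<close> in a fixed ball, where its difference from
  \<open>time_derivative s z\<close> is continuous in \<open>(s, z)\<close> and vanishes for \<open>s = s0\<close>.\<close>

lemma euler_step_local:
  assumes s0: "s0 \<in> {0..1}" and "0 < \<epsilon>"
  shows "\<exists>\<delta>>0. \<exists>\<tau>0>0. \<forall>s\<in>{0..1}. \<bar>s - s0\<bar> < \<delta> \<longrightarrow> (\<forall>\<tau>. 0 < \<tau> \<and> \<tau> \<le> \<tau>0 \<longrightarrow>
     (\<exists>g\<in>attainable. \<forall>z. norm z \<le> R \<longrightarrow> norm (g (H s z) - H s z - \<tau> *\<^sub>R time_derivative s z) \<le> \<epsilon> * \<tau>))"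
proof -
  define Y where "Y = eulerian_velocity s0"
  have Y: "tangent Y" "continuous_on UNIV Y"
    using smooth_tangent[OF eulerian_velocity_smooth[OF s0]] eulerian_velocity_smooth[OF s0] Ck_on_imp_continuous_on
    unfolding Y_def smooth_on_def by blast+
  define S where "S = {0..1::real} \<times> cball (0::'a) R"
  have S: "compact S" "S \<subseteq> T"
    using T(2) by (auto simp: S_def intro!: compact_Times)
  have C: "compact (G ` S)"
    by (intro compact_continuous_image continuous_on_subset[OF G_continuous S(2)] S(1))
  obtain \<tau>0 where \<tau>0: "0 < \<tau>0" "\<And>\<tau>. 0 < \<tau> \<Longrightarrow> \<tau> \<le> \<tau>0 \<Longrightarrow> \<exists>g\<in>attainable. \<forall>x\<in>G ` S. norm (g x - x - \<tau> *\<^sub>R Y x) \<le> (\<epsilon>/2) * \<tau>"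
    using tangentD[OF Y(1) C, of "\<epsilon>/2"] \<open>0 < \<epsilon>\<close> by auto
  define \<psi> where "\<psi> p = Y (G p) - (\<lambda>(s, z). time_derivative s z) p" for p
  have "continuous_on S \<psi>"
    unfolding \<psi>_def using S(2)
    by (intro continuous_on_diff continuous_on_subset[OF time_derivative_continuous] continuous_on_compose2[OF Y(2)]
        continuous_on_subset[OF G_continuous]) auto
  then have "uniformly_continuous_on S \<psi>" using S(1) by (rule compact_uniformly_continuous)
  then obtain \<delta> where \<delta>: "0 < \<delta>" "\<And>p q. p \<in> S \<Longrightarrow> q \<in> S \<Longrightarrow> dist q p < \<delta> \<Longrightarrow> dist (\<psi> q) (\<psi> p) < \<epsilon>/2"
    using \<open>0 < \<epsilon>\<close> unfolding uniformly_continuous_on_def by (metis half_gt_zero)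
  have small: "norm (Y (H s z) - time_derivative s z) \<le> \<epsilon>/2" if "s \<in> {0..1}" "\<bar>s - s0\<bar> < \<delta>" "norm z \<le> R" for s z
  proof -
    have "\<psi> (s0, z) = 0" by (simp add: \<psi>_def Y_def eulerian_velocity_def H_inverse(2)[OF s0])
    moreover have "dist (s, z) (s0, z) < \<delta>" using that(2) by (simp add: dist_Pair_Pair dist_real_def)
    ultimately have "norm (\<psi> (s, z)) < \<epsilon>/2"
      using \<delta>(2)[of "(s0, z)" "(s, z)"] that s0 by (simp add: S_def)
    then show ?thesis by (simp add: \<psi>_def)
  qed
  have "\<exists>g\<in>attainable. \<forall>z. norm z \<le> R \<longrightarrow> norm (g (H s z) - H s z - \<tau> *\<^sub>R time_derivative s z) \<le> \<epsilon> * \<tau>"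
    if s: "s \<in> {0..1}" "\<bar>s - s0\<bar> < \<delta>" and \<tau>: "0 < \<tau>" "\<tau> \<le> \<tau>0" for s \<tau>
  proof -
    obtain g where g: "g \<in> attainable" "\<And>x. x \<in> G ` S \<Longrightarrow> norm (g x - x - \<tau> *\<^sub>R Y x) \<le> (\<epsilon>/2) * \<tau>"
      using \<tau>0(2)[OF \<tau>] by blast
    have "norm (g (H s z) - H s z - \<tau> *\<^sub>R time_derivative s z) \<le> \<epsilon> * \<tau>" if z: "norm z \<le> R" for z
    proof -
      have "H s z \<in> G ` S" using s(1) z by (intro image_eqI[of _ _ "(s, z)"]) (auto simp: S_def)
      note g2 = g(2)[OF this]
      have "g (H s z) - H s z - \<tau> *\<^sub>R time_derivative s z
          = (g (H s z) - H s z - \<tau> *\<^sub>R Y (H s z)) + \<tau> *\<^sub>R (Y (H s z) - time_derivative s z)"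
        by (simp add: algebra_simps)
      also have "norm \<dots> \<le> (\<epsilon>/2) * \<tau> + \<tau> * (\<epsilon>/2)"
        using g2 small[OF s z] \<tau>(1) by (intro norm_triangle_mono) (auto intro: mult_left_mono)
      finally show ?thesis by (simp add: algebra_simps)
    qed
    then show ?thesis using g(1) by blast
  qed
  then show ?thesis using \<delta>(1) \<tau>0(1) by (intro exI[of _ \<delta>] conjI exI[of _ \<tau>0]) auto
qed

lemma euler_step:
  assumes "0 < \<epsilon>"
  shows "\<exists>\<tau>0>0. \<forall>s \<tau>. 0 \<le> s \<longrightarrow> 0 < \<tau> \<longrightarrow> \<tau> \<le> \<tau>0 \<longrightarrow> s + \<tau> \<le> 1 \<longrightarrow>
     (\<exists>g\<in>attainable. \<forall>z. norm z \<le> R \<longrightarrow> norm (g (H s z) - H (s + \<tau>) z) \<le> \<epsilon> * \<tau>)"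
proof -
  have "\<exists>c>0. \<forall>s\<in>{0..1}. \<forall>\<tau>. 0 < \<tau> \<and> \<tau> \<le> c \<longrightarrow>
     (\<exists>g\<in>attainable. \<forall>z. norm z \<le> R \<longrightarrow> norm (g (H s z) - H s z - \<tau> *\<^sub>R time_derivative s z) \<le> (\<epsilon>/2) * \<tau>)"
    using \<open>0 < \<epsilon>\<close> by (intro Icc_uniform_choice euler_step_local) auto
  then obtain \<tau>1 where \<tau>1: "0 < \<tau>1" "\<And>s \<tau>. s \<in> {0..1} \<Longrightarrow> 0 < \<tau> \<Longrightarrow> \<tau> \<le> \<tau>1 \<Longrightarrow>
     \<exists>g\<in>attainable. \<forall>z. norm z \<le> R \<longrightarrow> norm (g (H s z) - H s z - \<tau> *\<^sub>R time_derivative s z) \<le> (\<epsilon>/2) * \<tau>"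
    by blast
  obtain \<tau>2 where \<tau>2: "0 < \<tau>2"
    "\<And>s \<tau> z. 0 \<le> s \<Longrightarrow> 0 < \<tau> \<Longrightarrow> \<tau> \<le> \<tau>2 \<Longrightarrow> s + \<tau> \<le> 1 \<Longrightarrow> norm z \<le> R \<Longrightarrow>
       norm (H (s + \<tau>) z - H s z - \<tau> *\<^sub>R time_derivative s z) \<le> (\<epsilon>/2) * \<tau>"
    using first_order_in_time[of "\<epsilon>/2" R] \<open>0 < \<epsilon>\<close> by auto
  show ?thesis
  proof (intro exI[of _ "min \<tau>1 \<tau>2"] conjI allI impI)
    fix s \<tau> :: real assume *: "0 \<le> s" "0 < \<tau>" "\<tau> \<le> min \<tau>1 \<tau>2" "s + \<tau> \<le> 1"
    then obtain g where g: "g \<in> attainable"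
      "\<And>z. norm z \<le> R \<Longrightarrow> norm (g (H s z) - H s z - \<tau> *\<^sub>R time_derivative s z) \<le> (\<epsilon>/2) * \<tau>"
      using \<tau>1(2)[of s \<tau>] by auto
    have "norm (g (H s z) - H (s + \<tau>) z) \<le> \<epsilon> * \<tau>" if z: "norm z \<le> R" for z
    proof -
      have "g (H s z) - H (s + \<tau>) z = (g (H s z) - H s z - \<tau> *\<^sub>R time_derivative s z) - (H (s + \<tau>) z - H s z - \<tau> *\<^sub>R time_derivative s z)"
        by simp
      also have "norm \<dots> \<le> (\<epsilon>/2) * \<tau> + (\<epsilon>/2) * \<tau>"
        using norm_triangle_ineq4[of "g (H s z) - H s z - \<tau> *\<^sub>R time_derivative s z" "H (s + \<tau>) z - H s z - \<tau> *\<^sub>R time_derivative s z"]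
          g(2)[OF z] \<tau>2(2)[of s \<tau> z] * z by linarith
      finally show ?thesis by (simp add: algebra_simps)
    qed
    then show "\<exists>g\<in>attainable. \<forall>z. norm z \<le> R \<longrightarrow> norm (g (H s z) - H (s + \<tau>) z) \<le> \<epsilon> * \<tau>"
      using g(1) by blast
  qed (use \<tau>1(1) \<tau>2(1) in simp)
qed

text \<open>The error of the Euler scheme is measured after pulling it back by \<open>H s\<close>: the point
  \<open>z = (H s)\<^sup>-\<^sup>1 (g x)\<close> would stay at \<open>x\<close> for the exact motion, and in each step it moves by
  at most a constant times the local error.\<close>

lemma diffeotopy_attainable:
  assumes H0: "H 0 = id" and C: "compact C" and "0 < \<epsilon>"
  shows "\<exists>g\<in>attainable. \<forall>x\<in>C. norm (g x - H 1 x) \<le> \<epsilon>"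
proof -
  obtain R where R: "\<And>x. x \<in> C \<Longrightarrow> norm x \<le> R"
    using compact_imp_bounded[OF C] by (auto simp: bounded_iff)
  define R' where "R' = R + 2"
  obtain c where c: "0 < c" "\<And>s u v. s \<in> {0..1} \<Longrightarrow> norm u \<le> R' \<Longrightarrow> norm v \<le> R' \<Longrightarrow> c * norm (u - v) \<le> norm (H s u - H s v)"
    using uniformly_expanding[of R'] by blast
  have "Ck_on (Suc 0) UNIV (H 1)" using H_inverse(3)[of 1] unfolding smooth_on_def by auto
  from C1_lipschitz_on_convex_compact[OF this compact_cball convex_cball subset_UNIV, of 0 R']
  obtain K where K: "0 \<le> K" "\<And>x y. x \<in> cball 0 R' \<Longrightarrow> y \<in> cball 0 R' \<Longrightarrow> norm (H 1 x - H 1 y) \<le> K * norm (x - y)"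
    by metis
  \<comment> \<open>\<open>e\<close> is the admissible total drift of \<open>z\<close>; at most \<open>1/2\<close>, so that \<open>z\<close> stays in the ball.\<close>
  define e where "e = min (1/2) (\<epsilon> / (K + 1))"
  have e: "0 < e" "e \<le> 1/2" "K * e \<le> \<epsilon>"
  proof -
    show "0 < e" using \<open>0 < \<epsilon>\<close> K(1) by (simp add: e_def)
    show "e \<le> 1/2" unfolding e_def by (rule min.cobounded1)
    have "K * e \<le> (K + 1) * (\<epsilon> / (K + 1))" using K(1) \<open>0 < \<epsilon>\<close> by (intro mult_mono) (auto simp: e_def)
    then show "K * e \<le> \<epsilon>" using K(1) by simp
  qed
  obtain \<tau>0 where \<tau>0: "0 < \<tau>0" "\<And>s \<tau>. 0 \<le> s \<Longrightarrow> 0 < \<tau> \<Longrightarrow> \<tau> \<le> \<tau>0 \<Longrightarrow> s + \<tau> \<le> 1 \<Longrightarrow>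
     \<exists>g\<in>attainable. \<forall>z. norm z \<le> R' \<longrightarrow> norm (g (H s z) - H (s + \<tau>) z) \<le> (c * e) * \<tau>"
    using euler_step[of "c * e" R'] c(1) e(1) by (metis mult_pos_pos)
  obtain n where n: "inverse (real (Suc n)) < \<tau>0" using reals_Archimedean[OF \<tau>0(1)] by blast
  define \<tau> where "\<tau> = inverse (real (Suc n))"
  have \<tau>: "0 < \<tau>" "\<tau> \<le> \<tau>0" "real (Suc n) * \<tau> = 1" "\<tau> \<le> 1"
    using n by (auto simp: \<tau>_def field_simps)
  have "\<exists>g\<in>attainable. \<forall>x\<in>C. \<exists>z. g x = H (real k * \<tau>) z \<and> norm (z - x) \<le> e * (real k * \<tau>)" if "k \<le> Suc n" for k
    using that
  proof (induction k)
    case 0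
    then show ?case using id_attainable by (intro bexI[of _ "\<lambda>x. x"]) (auto simp: H0)
  next
    case (Suc k)
    then obtain g where g: "g \<in> attainable" "\<And>x. x \<in> C \<Longrightarrow> \<exists>z. g x = H (real k * \<tau>) z \<and> norm (z - x) \<le> e * (real k * \<tau>)"
      by auto
    define s where "s = real k * \<tau>"
    have s: "0 \<le> s" "s + \<tau> = real (Suc k) * \<tau>" using \<tau>(1) by (auto simp: s_def algebra_simps)
    have "real (Suc k) * \<tau> \<le> real (Suc n) * \<tau>" using Suc.prems \<tau>(1) by (intro mult_right_mono) auto
    then have s1: "s + \<tau> \<le> 1" using s(2) \<tau>(3) by linarith
    obtain h where h: "h \<in> attainable" "\<And>z. norm z \<le> R' \<Longrightarrow> norm (h (H s z) - H (s + \<tau>) z) \<le> (c * e) * \<tau>"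
      using \<tau>0(2)[OF s(1) \<tau>(1,2) s1] by blast
    have "\<exists>z'. h (g x) = H (s + \<tau>) z' \<and> norm (z' - x) \<le> e * (s + \<tau>)" if x: "x \<in> C" for x
    proof -
      obtain z where z: "g x = H s z" "norm (z - x) \<le> e * s" using g(2)[OF x] by (auto simp: s_def)
      have "e * s \<le> 1 * 1" using e(1,2) s(1) s1 \<tau>(1) by (intro mult_mono) auto
      then have zR: "norm z \<le> R + 1" using z(2) R[OF x] norm_triangle_sub[of z x] by linarith
      have st: "s + \<tau> \<in> {0..1}" using s(1) s1 \<tau>(1) by simp
      define z' where "z' = inv (H (s + \<tau>)) (h (g x))"
      have Hz': "H (s + \<tau>) z' = h (g x)" unfolding z'_def by (rule H_inverse(1)[OF st])
      have d: "dist (H (s + \<tau>) z) (H (s + \<tau>) z') \<le> c * (e * \<tau>)"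
        using h(2)[of z] zR unfolding Hz' z(1) by (simp add: R'_def dist_norm norm_minus_commute mult.assoc)
      have "e * \<tau> < 1" using e(1,2) \<tau>(1,4) mult_mono[of e "1/2" \<tau> 1] by simp
      then have "c * (e * \<tau>) < c * 1" using c(1) by (intro mult_strict_left_mono)
      then have dc: "dist (H (s + \<tau>) z) (H (s + \<tau>) z') < c" using d by linarith
      have "c * dist z z' \<le> dist (H (s + \<tau>) z) (H (s + \<tau>) z')"
      proof (rule expanding_homeomorphism_near[OF H_inverse(1)[OF st] H_inverse(2)[OF st] _ _ dc])
        show "continuous_on UNIV (inv (H (s + \<tau>)))"
          using H_inverse(4)[OF st] Ck_on_imp_continuous_on unfolding smooth_on_def by blast
        fix w assume "dist z w \<le> 1"
        then have "norm w \<le> R'" using zR norm_triangle_sub[of w z] by (simp add: R'_def dist_norm norm_minus_commute)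
        then show "c * dist z w \<le> dist (H (s + \<tau>) z) (H (s + \<tau>) w)"
          using c(2)[OF st, of z w] zR by (simp add: R'_def dist_norm)
      qed
      then have "c * dist z z' \<le> c * (e * \<tau>)" using d by linarith
      then have "norm (z' - z) \<le> e * \<tau>" using c(1) by (simp add: dist_norm norm_minus_commute)
      then have "norm (z' - x) \<le> e * (s + \<tau>)"
        using z(2) norm_triangle_ineq[of "z' - z" "z - x"] by (simp add: distrib_left)
      then show ?thesis using Hz' by metis
    qed
    then show ?case
      using attainable_compose[OF g(1) h(1)] unfolding s(2) by (intro bexI[of _ "\<lambda>x. h (g x)"]) auto
  qed
  from this[of "Suc n"] obtain g where g: "g \<in> attainable" "\<And>x. x \<in> C \<Longrightarrow> \<exists>z. g x = H 1 z \<and> norm (z - x) \<le> e * 1"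
    unfolding \<tau>(3) by blast
  have "norm (g x - H 1 x) \<le> \<epsilon>" if x: "x \<in> C" for x
  proof -
    obtain z where z: "g x = H 1 z" "norm (z - x) \<le> e" using g(2)[OF x] by auto
    have "z \<in> cball 0 R'" "x \<in> cball 0 R'"
      using z(2) e(2) R[OF x] norm_triangle_sub[of z x] by (auto simp: R'_def)
    from K(2)[OF this] have "norm (g x - H 1 x) \<le> K * norm (z - x)" by (simp add: z(1))
    also have "\<dots> \<le> K * e" using z(2) K(1) by (rule mult_left_mono)
    also have "\<dots> \<le> \<epsilon>" by (rule e(3))
    finally show ?thesis .
  qed
  then show ?thesis using g(1) by blast
qed

end

section \<open>Weak compactness of bounded sets of controls\<close>

lemma le_add_square_div:
  fixes x p :: real
  assumes "0 < p"
  shows "x \<le> p + x\<^sup>2 / p"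
proof -
  have "p * (x / p) \<le> p * (1 + (x / p)\<^sup>2)" using le_one_add_square[of "x / p"] assms by (intro mult_left_mono) auto
  also have "\<dots> = p + x\<^sup>2 / p" using assms by (simp add: power2_eq_square field_simps)
  finally show ?thesis using assms by simp
qed

lemma L2_controlsD':
  assumes "u \<in> L2_controls"
  shows "u \<in> borel_measurable (lebesgue_on {0..1})" "integrable (lebesgue_on {0..1}) (\<lambda>s. (norm (u s))\<^sup>2)"
    "integrable (lebesgue_on {0..1}) u"
  using assms absolutely_integrable_imp_integrable[OF L2_controlsD(4)[OF assms]]
  by (auto simp: L2_controls_def)

lemma L2_controls_linear:
  assumes u: "u \<in> L2_controls" and v: "v \<in> L2_controls"
  shows "(\<lambda>s. a *\<^sub>R u s + b *\<^sub>R v s) \<in> L2_controls"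
proof -
  note [measurable] = L2_controlsD'(1)[OF u] L2_controlsD'(1)[OF v]
  have "integrable (lebesgue_on {0..1}) (\<lambda>s. (norm (a *\<^sub>R u s + b *\<^sub>R v s))\<^sup>2)"
  proof (rule Bochner_Integration.integrable_bound)
    show "integrable (lebesgue_on {0..1}) (\<lambda>s. 2 * a\<^sup>2 * (norm (u s))\<^sup>2 + 2 * b\<^sup>2 * (norm (v s))\<^sup>2)"
      using L2_controlsD'(2)[OF u] L2_controlsD'(2)[OF v]
      by (intro Bochner_Integration.integrable_add integrable_mult_right)
    have "(norm (a *\<^sub>R u s + b *\<^sub>R v s))\<^sup>2 \<le> 2 * a\<^sup>2 * (norm (u s))\<^sup>2 + 2 * b\<^sup>2 * (norm (v s))\<^sup>2" for s
    proof -
      have "(norm (a *\<^sub>R u s + b *\<^sub>R v s))\<^sup>2 \<le> (norm (a *\<^sub>R u s) + norm (b *\<^sub>R v s))\<^sup>2"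
        by (intro power_mono norm_triangle_ineq) simp
      also have "\<dots> \<le> 2 * (norm (a *\<^sub>R u s))\<^sup>2 + 2 * (norm (b *\<^sub>R v s))\<^sup>2"
        using sum_squares_bound[of "norm (a *\<^sub>R u s)" "norm (b *\<^sub>R v s)"] by (simp add: power2_sum)
      also have "\<dots> = 2 * a\<^sup>2 * (norm (u s))\<^sup>2 + 2 * b\<^sup>2 * (norm (v s))\<^sup>2"
        by (simp add: power_mult_distrib)
      finally show ?thesis .
    qed
    then show "AE s in lebesgue_on {0..1}. norm ((norm (a *\<^sub>R u s + b *\<^sub>R v s))\<^sup>2) \<le> norm (2 * a\<^sup>2 * (norm (u s))\<^sup>2 + 2 * b\<^sup>2 * (norm (v s))\<^sup>2)"
      by (intro AE_I2) (simp add: order_trans[OF _ abs_ge_self])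
  qed measurable
  then show ?thesis unfolding L2_controls_def by (auto intro!: borel_measurable_add borel_measurable_scaleR L2_controlsD'(1) u v)
qed

lemma L2_norm_sq_nonneg: "0 \<le> L2_norm_sq u"
  by (simp add: L2_norm_sq_def)

lemma L2_parallelogram:
  assumes u: "u \<in> L2_controls" and v: "v \<in> L2_controls"
  shows "L2_norm_sq (\<lambda>s. v s - u s)
    = 2 * L2_norm_sq u + 2 * L2_norm_sq v - 4 * L2_norm_sq (\<lambda>s. (1/2) *\<^sub>R u s + (1/2) *\<^sub>R v s)"
proof -
  have w: "(\<lambda>s. (1/2) *\<^sub>R u s + (1/2) *\<^sub>R v s) \<in> L2_controls" by (rule L2_controls_linear[OF u v])
  have pt: "(norm (v s - u s))\<^sup>2 = (2 * (norm (u s))\<^sup>2 + 2 * (norm (v s))\<^sup>2) - 4 * (norm ((1/2) *\<^sub>R u s + (1/2) *\<^sub>R v s))\<^sup>2" for s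
    unfolding power2_norm_eq_inner by (simp add: inner_add_left inner_add_right inner_diff_left inner_diff_right inner_commute)
  show ?thesis
    unfolding L2_norm_sq_def pt
    using L2_controlsD'(2)[OF u] L2_controlsD'(2)[OF v] L2_controlsD'(2)[OF w] by simp
qed

lemma lebesgue_on_unit_interval: "measure (lebesgue_on {0..1::real}) (space (lebesgue_on {0..1})) = 1"
  by (simp add: measure_restrict_space)

text \<open>Completeness of \<open>L\<^sup>2\<close> together with Fatou's lemma for the norm. By \<open>le_add_square_div\<close> with
  \<open>p = 2\<^sup>-\<^sup>j\<close>, the \<open>L\<^sup>1\<close> norms of the increments are summable; thus the sequence converges almost
  everywhere and is dominated by the norm of its first term plus those of its increments.\<close>

lemma L2_rapid_limit:
  fixes w :: "nat \<Rightarrow> real \<Rightarrow> real ^ 'l"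
  assumes w: "\<And>j. w j \<in> L2_controls"
    and rapid: "\<And>j. L2_norm_sq (\<lambda>s. w (Suc j) s - w j s) \<le> (1/4) ^ j"
    and bound: "\<And>j. L2_norm_sq (w j) \<le> c j" and c: "c \<longlonglongrightarrow> \<gamma>"
  obtains u where "u \<in> L2_controls" "L2_norm_sq u \<le> \<gamma>"
    "\<And>t. t \<in> {0..1} \<Longrightarrow> (\<lambda>j. integral {0..t} (w j)) \<longlonglongrightarrow> integral {0..t} u"
proof -
  define \<mu> where "\<mu> = lebesgue_on {0..1::real}"
  note D = L2_controlsD'[folded \<mu>_def]
  note [measurable] = D(1)[OF w]
  have diff: "(\<lambda>s. w (Suc j) s - w j s) \<in> L2_controls" for j
    using L2_controls_linear[OF w[of "Suc j"] w[of j], of 1 "-1"] by simp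
  define d where "d j s = norm (w (Suc j) s - w j s)" for j s
  have [measurable]: "d j \<in> borel_measurable \<mu>" for j unfolding d_def by measurable
  have dint: "integrable \<mu> (d j)" for j
    unfolding d_def using D(3)[OF diff] by (rule integrable_norm)
  have d2int: "integrable \<mu> (\<lambda>s. (d j s)\<^sup>2)" for j
    unfolding d_def by (rule D(2)[OF diff])
  interpret \<mu>: finite_measure \<mu>
    unfolding \<mu>_def by (rule finite_measureI) (simp add: emeasure_restrict_space)
  have dI: "integral\<^sup>L \<mu> (d j) \<le> 2 * (1/2) ^ j" for j
  proof -
    let ?p = "(1/2::real) ^ j"
    have "integral\<^sup>L \<mu> (d j) \<le> integral\<^sup>L \<mu> (\<lambda>s. ?p + (d j s)\<^sup>2 / ?p)"
      using d2int by (intro integral_mono dint le_add_square_div Bochner_Integration.integrable_add integrable_divide) auto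
    also have "\<dots> = ?p + integral\<^sup>L \<mu> (\<lambda>s. (d j s)\<^sup>2) / ?p"
      using d2int lebesgue_on_unit_interval by (simp add: \<mu>_def[symmetric] Bochner_Integration.integral_add)
    also have "integral\<^sup>L \<mu> (\<lambda>s. (d j s)\<^sup>2) = L2_norm_sq (\<lambda>s. w (Suc j) s - w j s)"
      by (simp add: L2_norm_sq_def d_def \<mu>_def)
    also have "?p + \<dots> / ?p \<le> ?p + (1/4) ^ j / ?p"
      using rapid by (intro add_left_mono divide_right_mono) auto
    also have "(1/4::real) ^ j / ?p = ?p" by (simp add: power_divide field_simps flip: power_mult_distrib)
    finally show ?thesis by simp
  qed
  define S where "S s = (\<Sum>j. ennreal (d j s))" for s
  have [measurable]: "S \<in> borel_measurable \<mu>" unfolding S_def by measurable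
  have "(\<integral>\<^sup>+s. S s \<partial>\<mu>) = (\<Sum>j. \<integral>\<^sup>+s. ennreal (d j s) \<partial>\<mu>)"
    unfolding S_def by (rule nn_integral_suminf) measurable
  also have "\<dots> = (\<Sum>j. ennreal (integral\<^sup>L \<mu> (d j)))"
    by (intro suminf_cong nn_integral_eq_integral dint) (simp add: d_def)
  also have "\<dots> \<le> (\<Sum>j. ennreal (2 * (1/2) ^ j))"
    by (intro suminf_le ennreal_leI dI) auto
  also have "\<dots> = ennreal (\<Sum>j. 2 * (1/2) ^ j)"
    by (rule suminf_ennreal2) (auto intro!: summable_mult summable_geometric)
  finally have Sfin: "(\<integral>\<^sup>+s. S s \<partial>\<mu>) < \<infinity>" by (rule le_less_trans) simp
  then have "AE s in \<mu>. S s \<noteq> \<infinity>" by (intro nn_integral_PInf_AE) auto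
  then have AE_summable: "AE s in \<mu>. summable (\<lambda>j. d j s)"
    unfolding S_def by eventually_elim (intro summable_suminf_not_top, auto simp: d_def)
  define u where "u s = lim (\<lambda>j. w j s)" for s
  have um [measurable]: "u \<in> borel_measurable \<mu>" unfolding u_def by (rule borel_measurable_lim_metric) measurable
  have AE_lim: "AE s in \<mu>. (\<lambda>j. w j s) \<longlonglongrightarrow> u s"
    using AE_summable
  proof eventually_elim
    case (elim s)
    then have "summable (\<lambda>j. w (Suc j) s - w j s)" unfolding d_def by (rule summable_norm_cancel)
    then have "convergent (\<lambda>n. \<Sum>j<n. w (Suc j) s - w j s)" by (simp add: summable_iff_convergent)
    then have "convergent (\<lambda>n. w n s - w 0 s)" by (simp only: sum_lessThan_telescope[of "\<lambda>n. w n s"])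
    then have "convergent (\<lambda>n. w n s)" by (simp only: convergent_diff_const_right_iff)
    then show ?case by (simp add: u_def convergent_LIMSEQ_iff)
  qed
  define dom where "dom s = norm (w 0 s) + enn2real (S s)" for s
  have "(\<integral>\<^sup>+s. ennreal (enn2real (S s)) \<partial>\<mu>) \<le> (\<integral>\<^sup>+s. S s \<partial>\<mu>)"
    by (intro nn_integral_mono) (simp add: ennreal_enn2real_if)
  then have "integrable \<mu> (\<lambda>s. enn2real (S s))"
    using Sfin by (intro integrableI_bounded) (auto intro: le_less_trans)
  then have domint: "integrable \<mu> dom"
    unfolding dom_def using D(3)[OF w[of 0]] by (intro Bochner_Integration.integrable_add integrable_norm)
  have AE_dom: "AE s in \<mu>. norm (w j s) \<le> dom s" for j
    using AE_summable
  proof eventually_elim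
    case (elim s)
    have "w j s = w 0 s + (\<Sum>i<j. w (Suc i) s - w i s)"
      unfolding sum_lessThan_telescope[of "\<lambda>i. w i s" j] by simp
    then have "norm (w j s) \<le> norm (w 0 s) + norm (\<Sum>i<j. w (Suc i) s - w i s)" by (metis norm_triangle_ineq)
    also have "norm (\<Sum>i<j. w (Suc i) s - w i s) \<le> (\<Sum>i<j. d i s)" unfolding d_def by (rule norm_sum)
    also have "\<dots> \<le> (\<Sum>i. d i s)" using elim by (intro sum_le_suminf) (auto simp: d_def)
    also have "\<dots> = enn2real (S s)"
      unfolding S_def using elim by (subst suminf_ennreal2) (auto simp: d_def suminf_nonneg)
    finally show ?case by (simp add: dom_def)
  qed
  have uint: "integrable \<mu> u"
    using integrable_dominated_convergence[OF um D(1)[OF w] domint AE_lim AE_dom] .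
  have "(\<integral>\<^sup>+s. ennreal ((norm (u s))\<^sup>2) \<partial>\<mu>) = (\<integral>\<^sup>+s. liminf (\<lambda>j. ennreal ((norm (w j s))\<^sup>2)) \<partial>\<mu>)"
  proof (intro nn_integral_cong_AE, use AE_lim in eventually_elim)
    case (elim s)
    then have "(\<lambda>j. ennreal ((norm (w j s))\<^sup>2)) \<longlonglongrightarrow> ennreal ((norm (u s))\<^sup>2)"
      by (intro tendsto_ennrealI tendsto_power tendsto_norm)
    from lim_imp_Liminf[OF trivial_limit_sequentially this] show ?case by (rule sym)
  qed
  also have "\<dots> \<le> liminf (\<lambda>j. \<integral>\<^sup>+s. ennreal ((norm (w j s))\<^sup>2) \<partial>\<mu>)"
    by (rule nn_integral_liminf) measurable
  also have "\<dots> = liminf (\<lambda>j. ennreal (L2_norm_sq (w j)))"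
    using D(2)[OF w] by (simp add: nn_integral_eq_integral L2_norm_sq_def \<mu>_def)
  also have "\<dots> \<le> liminf (\<lambda>j. ennreal (c j))"
    by (intro Liminf_mono always_eventually allI ennreal_leI bound)
  also have "\<dots> = ennreal \<gamma>"
    by (intro lim_imp_Liminf tendsto_ennrealI c) simp
  finally have nn: "(\<integral>\<^sup>+s. ennreal ((norm (u s))\<^sup>2) \<partial>\<mu>) \<le> ennreal \<gamma>" .
  have "0 \<le> c j" for j
    using bound[of j] L2_norm_sq_nonneg[of "w j"] by linarith
  then have "0 \<le> \<gamma>" by (intro LIMSEQ_le_const[OF c]) blast
  have "integrable \<mu> (\<lambda>s. (norm (u s))\<^sup>2)"
    using nn by (intro integrableI_bounded) (auto intro: le_less_trans)
  then have u: "u \<in> L2_controls" using um by (simp add: L2_controls_def \<mu>_def)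
  have "L2_norm_sq u \<le> \<gamma>"
    unfolding L2_norm_sq_def \<mu>_def[symmetric] by (rule integral_real_bounded[OF \<open>0 \<le> \<gamma>\<close> nn])
  moreover have "(\<lambda>j. integral {0..t} (w j)) \<longlonglongrightarrow> integral {0..t} u" if t: "t \<in> {0..1}" for t
  proof -
    have prim: "integral\<^sup>L \<mu> (\<lambda>s. if s \<in> {0..t} then f s else 0) = integral {0..t} f" if "integrable \<mu> f" for f :: "real \<Rightarrow> real ^ 'l"
    proof -
      have "integral\<^sup>L \<mu> (\<lambda>s. if s \<in> {0..t} then f s else 0) = integral\<^sup>L (lebesgue_on ({0..t} \<inter> {0..1})) f"
        unfolding \<mu>_def by (rule Lebesgue_Measure.integral_restrict_Int) auto
      also have "{0..t} \<inter> {0..1} = {0..t}" using t by auto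
      also have "integral\<^sup>L (lebesgue_on {0..t}) f = integral {0..t} f"
      proof (rule lebesgue_integral_eq_integral)
        show "integrable (lebesgue_on {0..t}) f"
          by (rule integrable_subinterval[OF that[unfolded \<mu>_def]]) (use t in auto)
      qed simp
      finally show ?thesis .
    qed
    have st: "{0..t} \<inter> space \<mu> \<in> sets \<mu>" unfolding \<mu>_def by (auto simp: sets_restrict_space)
    have "(\<lambda>j. integral\<^sup>L \<mu> (\<lambda>s. if s \<in> {0..t} then w j s else 0)) \<longlonglongrightarrow> integral\<^sup>L \<mu> (\<lambda>s. if s \<in> {0..t} then u s else 0)"
    proof (rule integral_dominated_convergence[OF _ _ domint])
      show "(\<lambda>s. if s \<in> {0..t} then u s else 0) \<in> borel_measurable \<mu>"
        by (intro measurable_If_set um measurable_const st) simp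
      show "(\<lambda>s. if s \<in> {0..t} then w j s else 0) \<in> borel_measurable \<mu>" for j
        by (intro measurable_If_set D(1)[OF w] measurable_const st) simp
      show "AE s in \<mu>. (\<lambda>j. if s \<in> {0..t} then w j s else 0) \<longlonglongrightarrow> (if s \<in> {0..t} then u s else 0)"
        using AE_lim by eventually_elim auto
      show "AE s in \<mu>. norm (if s \<in> {0..t} then w j s else 0) \<le> dom s" for j
        using AE_dom[of j] by eventually_elim (auto simp: dom_def)
    qed
    then show ?thesis unfolding prim[OF D(3)[OF w]] prim[OF uint] .
  qed
  ultimately show thesis by (rule that[OF u])
qed

text \<open>Arzela--Ascoli yields a uniform limit \<open>g\<close> of primitives along a subsequence. To see that \<open>g\<close> is
  again the primitive of a control, consider controls of almost minimal norm among those whose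
  primitive is close to \<open>g\<close>: by the parallelogram law they form a Cauchy sequence.\<close>

lemma L2_weak_compactness:
  fixes u :: "nat \<Rightarrow> real \<Rightarrow> real ^ 'l"
  assumes u: "\<And>n. u n \<in> L2_controls" and lim: "(\<lambda>n. L2_norm_sq (u n)) \<longlonglongrightarrow> \<gamma>"
  obtains v r where "v \<in> L2_controls" "strict_mono (r :: nat \<Rightarrow> nat)" "L2_norm_sq v \<le> \<gamma>"
    "\<And>e. 0 < e \<Longrightarrow> \<exists>N. \<forall>n\<ge>N. \<forall>t\<in>{0..1}. norm (integral {0..t} (u (r n)) - integral {0..t} v) < e"
proof -
  obtain C where "\<And>n. norm (L2_norm_sq (u n)) \<le> C"
    using convergent_imp_Bseq[of "\<lambda>n. L2_norm_sq (u n)"] lim unfolding Bseq_def convergent_def by blast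
  then have C: "\<And>n. L2_norm_sq (u n) \<le> C" by (metis abs_le_D1 real_norm_def)
  have "0 \<le> C" using C[of 0] L2_norm_sq_nonneg[of "u 0"] by linarith
  define V where "V n t = integral {0..t} (u n)" for n t
  have est: "norm (V n t - V n s) \<le> p * (t - s) + C / p" if "0 < p" "0 \<le> s" "s \<le> t" "t \<le> 1" for n s t p
  proof -
    have sq: "(\<lambda>r. (norm (u n r))\<^sup>2 / p) integrable_on {s..t}"
      using that by (intro integrable_on_divide integrable_on_subinterval[OF L2_controlsD(3)[OF u]]) auto
    have "V n t - V n s = integral {s..t} (u n)"
      unfolding V_def by (rule integral_combine_real[OF L2_controlsD(1)[OF u] that(2-4)])
    also have "norm \<dots> \<le> integral {s..t} (\<lambda>r. p + (norm (u n r))\<^sup>2 / p)"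
      using that by (intro integral_norm_bound_integral integrable_on_subinterval[OF L2_controlsD(1)[OF u]]
          integrable_add integrable_const_ivl sq le_add_square_div) auto
    also have "\<dots> = p * (t - s) + integral {s..t} (\<lambda>r. (norm (u n r))\<^sup>2 / p)"
      using Henstock_Kurzweil_Integration.integral_add[OF integrable_const_ivl[of p s t] sq] that by simp
    also have "integral {s..t} (\<lambda>r. (norm (u n r))\<^sup>2 / p) \<le> integral {0..1} (\<lambda>r. (norm (u n r))\<^sup>2 / p)"
      using that sq by (intro integral_subset_le integrable_on_divide L2_controlsD(3)[OF u]) auto
    also have "\<dots> = L2_norm_sq (u n) / p" by (simp add: L2_norm_sq_eq[OF u])
    also have "\<dots> \<le> C / p" using C that by (intro divide_right_mono) auto
    finally show ?thesis by simp
  qed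
  obtain g r where g: "continuous_on {0..1} g" and r: "strict_mono (r :: nat \<Rightarrow> nat)"
    and gl: "\<And>e. 0 < e \<Longrightarrow> \<exists>N. \<forall>n t. N \<le> n \<and> t \<in> {0..1} \<longrightarrow> norm (V (r n) t - g t) < e"
  proof (rule Arzela_Ascoli[of "{0..1::real}" V "1 + C"])
    show "norm (V n t) \<le> 1 + C" if "t \<in> {0..1}" for n t
      using est[of 1 0 t n] that by (simp add: V_def)
    show "\<exists>d>0. \<forall>n y. y \<in> {0..1} \<and> norm (x - y) < d \<longrightarrow> norm (V n x - V n y) < e"
      if x: "x \<in> {0..1}" and "0 < e" for x e :: real
    proof -
      define p where "p = 2 * (C + 1) / e"
      have "0 < p" using \<open>0 \<le> C\<close> \<open>0 < e\<close> by (simp add: p_def)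
      have Cp: "C / p < e / 2"
        using \<open>0 \<le> C\<close> \<open>0 < e\<close> by (simp add: p_def field_simps)
      have main: "norm (V n t - V n s) < e" if "0 \<le> s" "s \<le> t" "t \<le> 1" "t - s < e / (2 * p)" for n s t
      proof -
        have "p * (t - s) < p * (e / (2 * p))" using that(4) \<open>0 < p\<close> by (rule mult_strict_left_mono)
        also have "\<dots> = e / 2" using \<open>0 < p\<close> by simp
        finally show ?thesis using est[OF \<open>0 < p\<close> that(1-3), of n] Cp by linarith
      qed
      show ?thesis
      proof (intro exI[of _ "e / (2 * p)"] conjI allI impI)
        fix n y assume y: "y \<in> {0..1} \<and> norm (x - y) < e / (2 * p)"
        show "norm (V n x - V n y) < e"
        proof (cases "y \<le> x")
          case True then show ?thesis using main[of y x n] x y by simp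
        next
          case False then show ?thesis using main[of x y n] x y by (simp add: norm_minus_commute)
        qed
      qed (use \<open>0 < e\<close> \<open>0 < p\<close> in simp)
    qed
  qed auto
  define near where "near m = {w \<in> L2_controls. \<forall>t\<in>{0..1}. norm (integral {0..t} w - g t) \<le> 1 / real (Suc m)}" for m
  have near_antimono: "near m' \<subseteq> near m" if "m \<le> m'" for m m'
  proof -
    have "1 / real (Suc m') \<le> 1 / real (Suc m)" using that by (simp add: frac_le)
    then show ?thesis unfolding near_def by (auto intro: order_trans)
  qed
  have near_ev: "\<exists>N. \<forall>n\<ge>N. u (r n) \<in> near m" for m
  proof -
    obtain N where "\<forall>n t. N \<le> n \<and> t \<in> {0..1} \<longrightarrow> norm (V (r n) t - g t) < 1 / real (Suc m)"
      using gl[of "1 / real (Suc m)"] by auto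
    then show ?thesis using u unfolding near_def V_def by (intro exI[of _ N]) (auto intro: less_imp_le)
  qed
  define I where "I m = Inf (L2_norm_sq ` near m)" for m
  have bdd: "bdd_below (L2_norm_sq ` A)" for A :: "(real \<Rightarrow> real ^ 'l) set"
    by (intro bdd_belowI[of _ 0]) (auto simp: L2_norm_sq_nonneg)
  have I_le: "I m \<le> L2_norm_sq w" if "w \<in> near m" for m w
    unfolding I_def using that by (intro cInf_lower bdd) auto
  have I_l: "I m \<le> \<gamma>" for m
  proof (rule LIMSEQ_le_const)
    show "(\<lambda>n. L2_norm_sq (u (r n))) \<longlonglongrightarrow> \<gamma>"
      using LIMSEQ_subseq_LIMSEQ[OF lim r] by (simp add: o_def)
    show "\<exists>N. \<forall>n\<ge>N. I m \<le> L2_norm_sq (u (r n))" using near_ev[of m] I_le by blast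
  qed
  have ne: "near m \<noteq> {}" for m using near_ev[of m] by blast
  have I_mono: "I m \<le> I m'" if "m \<le> m'" for m m'
    unfolding I_def using near_antimono[OF that] ne by (intro cInf_superset_mono bdd) auto
  obtain J where J: "I \<longlonglongrightarrow> J" "\<And>m. I m \<le> J"
    using incseq_convergent[of I \<gamma>] I_mono I_l by (auto simp: incseq_def)
  have "\<exists>N. \<forall>m\<ge>N. J - I m \<le> (1/4) ^ j / 8 \<and> 1 / real (Suc m) \<le> (1/4) ^ j / 8" for j :: nat
  proof -
    have pos: "0 < (1/4::real) ^ j / 8" by simp
    obtain N1 where N1: "\<And>m. m \<ge> N1 \<Longrightarrow> norm (I m - J) < (1/4) ^ j / 8" using LIMSEQ_D[OF J(1) pos] by blast
    obtain N2 where N2: "inverse (real (Suc N2)) < (1/4) ^ j / 8" using reals_Archimedean[OF pos] by blast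
    show ?thesis
    proof (intro exI[of _ "max N1 N2"] allI impI conjI)
      fix m assume m: "max N1 N2 \<le> m"
      show "J - I m \<le> (1/4) ^ j / 8" using N1[of m] m unfolding real_norm_def by linarith
      have "1 / real (Suc m) \<le> inverse (real (Suc N2))" using m by (simp add: inverse_eq_divide frac_le)
      then show "1 / real (Suc m) \<le> (1/4) ^ j / 8" using N2 by linarith
    qed
  qed
  then obtain N where N: "\<And>j m. N j \<le> m \<Longrightarrow> J - I m \<le> (1/4) ^ j / 8" "\<And>j m. N j \<le> m \<Longrightarrow> 1 / real (Suc m) \<le> (1/4) ^ j / 8"
    by metis
  define q where "q j = j + (\<Sum>i\<le>j. N i)" for j
  have q: "N j \<le> q j" "j \<le> q j" "q j \<le> q (Suc j)" for j
    using member_le_sum[of j "{..j}" N] by (auto simp: q_def)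
  have "\<exists>w\<in>near (q j). L2_norm_sq w < I (q j) + 1 / real (Suc (q j))" for j
    using cInf_lessD[of "L2_norm_sq ` near (q j)" "I (q j) + 1 / real (Suc (q j))"] ne by (auto simp: I_def)
  then obtain w where w: "\<And>j. w j \<in> near (q j)" "\<And>j. L2_norm_sq (w j) < I (q j) + 1 / real (Suc (q j))"
    by metis
  have wL: "w j \<in> L2_controls" for j using w(1) by (simp add: near_def)
  have rapid: "L2_norm_sq (\<lambda>s. w (Suc j) s - w j s) \<le> (1/4) ^ j" for j
  proof -
    have two: "(1/2) * b + (1/2) * b = b" for b :: real by simp
    let ?h = "\<lambda>s. (1/2) *\<^sub>R w j s + (1/2) *\<^sub>R w (Suc j) s"
    have "norm (integral {0..t} ?h - g t) \<le> 1 / real (Suc (q j))" if t: "t \<in> {0..1}" for t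
    proof -
      have int: "w i integrable_on {0..t}" for i
        using t by (intro integrable_on_subinterval[OF L2_controlsD(1)[OF wL]]) auto
      have "integral {0..t} ?h = (1/2) *\<^sub>R integral {0..t} (w j) + (1/2) *\<^sub>R integral {0..t} (w (Suc j))"
        using Henstock_Kurzweil_Integration.integral_add[OF integrable_cmul[OF int, of "1/2" j] integrable_cmul[OF int, of "1/2" "Suc j"]] by simp
      then have "integral {0..t} ?h - g t = (1/2) *\<^sub>R (integral {0..t} (w j) - g t) + (1/2) *\<^sub>R (integral {0..t} (w (Suc j)) - g t)"
        by (simp add: algebra_simps flip: scaleR_add_left)
      also have "norm \<dots> \<le> (1/2) * (1 / real (Suc (q j))) + (1/2) * (1 / real (Suc (q j)))"
      proof (rule norm_triangle_mono)
        have half: "norm ((1/2) *\<^sub>R x) \<le> (1/2) * b" if "norm x \<le> b" for x :: "real ^ 'l" and b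
          using that by simp
        have "w (Suc j) \<in> near (q j)" using w(1) near_antimono[OF q(3)] by blast
        then show "norm ((1/2) *\<^sub>R (integral {0..t} (w (Suc j)) - g t)) \<le> (1/2) * (1 / real (Suc (q j)))"
          using t unfolding near_def by (intro half) blast
        show "norm ((1/2) *\<^sub>R (integral {0..t} (w j) - g t)) \<le> (1/2) * (1 / real (Suc (q j)))"
          using t w(1)[of j] unfolding near_def by (intro half) blast
      qed
      also have "\<dots> = 1 / real (Suc (q j))" by (simp only: two)
      finally show ?thesis .
    qed
    then have "?h \<in> near (q j)" using L2_controls_linear[OF wL wL] by (simp add: near_def)
    then have "I (q j) \<le> L2_norm_sq ?h" by (rule I_le)
    moreover have "0 \<le> (1/4::real) ^ j" by simp
    moreover have Nq: "N j \<le> q (Suc j)" using q[of j] by linarith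
    ultimately show ?thesis
      using L2_parallelogram[OF wL[of j] wL[of "Suc j"]] w(2)[of j] w(2)[of "Suc j"] J(2)[of "q (Suc j)"]
        N(1)[OF q(1)[of j]] N(2)[OF q(1)[of j]] N(2)[OF Nq] by linarith
  qed
  have inv_le: "1 / real (Suc (q j)) \<le> 1 / real (Suc j)" for j using q(2)[of j] by (simp add: frac_le)
  have zero: "(\<lambda>j. 1 / real (Suc j)) \<longlonglongrightarrow> 0" using LIMSEQ_inverse_real_of_nat by (simp add: inverse_eq_divide)
  have norms: "L2_norm_sq (w j) \<le> \<gamma> + 1 / real (Suc j)" for j
    using w(2)[of j] I_l[of "q j"] inv_le[of j] by linarith
  have climit: "(\<lambda>j. \<gamma> + 1 / real (Suc j)) \<longlonglongrightarrow> \<gamma>" using tendsto_add[OF tendsto_const[of \<gamma>] zero] by simp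
  obtain v where v: "v \<in> L2_controls" "L2_norm_sq v \<le> \<gamma>"
    "\<And>t. t \<in> {0..1} \<Longrightarrow> (\<lambda>j. integral {0..t} (w j)) \<longlonglongrightarrow> integral {0..t} v"
    using L2_rapid_limit[OF wL rapid norms climit] by blast
  have "integral {0..t} v = g t" if t: "t \<in> {0..1}" for t
  proof (rule LIMSEQ_unique[OF v(3)[OF t]])
    have "(\<lambda>j. integral {0..t} (w j) - g t) \<longlonglongrightarrow> 0"
    proof (rule Lim_null_comparison[OF _ zero])
      show "\<forall>\<^sub>F j in sequentially. norm (integral {0..t} (w j) - g t) \<le> 1 / real (Suc j)"
        using w(1) t inv_le unfolding near_def by (intro always_eventually allI) (blast intro: order_trans)
    qed
    then show "(\<lambda>j. integral {0..t} (w j)) \<longlonglongrightarrow> g t" by (simp add: LIM_zero_iff)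
  qed
  then show thesis using that[OF v(1) r v(2)] gl unfolding V_def by (metis (no_types, lifting))
qed

section \<open>Flows depend weakly continuously on the control\<close>

text \<open>If the primitive of \<open>w\<close> is small, then \<open>w\<close> integrates to almost nothing against a continuous function
  \<open>y\<close>: on each of \<open>N\<close> short intervals \<open>y\<close> is replaced by its value at the left end point. The threshold
  \<open>\<delta>\<close> depends on \<open>y\<close> and \<open>\<epsilon>\<close> only, the \<open>L\<^sup>1\<close> norm of \<open>w\<close> enters the bound.\<close>

lemma integral_oscillating:
  fixes y :: "real \<Rightarrow> 'a::euclidean_space"
  assumes y: "continuous_on {0..1} y" and "0 < \<epsilon>"
  obtains \<delta> where "0 < \<delta>"
    "\<And>w t. w absolutely_integrable_on {0..1} \<Longrightarrow> (\<And>t. t \<in> {0..1} \<Longrightarrow> \<bar>integral {0..t} w\<bar> \<le> \<delta>) \<Longrightarrow> t \<in> {0..1} \<Longrightarrow>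
       norm (integral {0..t} (\<lambda>s. w s *\<^sub>R y s)) \<le> \<epsilon> * (1 + integral {0..1} (\<lambda>s. \<bar>w s\<bar>))"
proof -
  obtain Y where Y: "0 < Y" "\<And>s. s \<in> {0..1} \<Longrightarrow> norm (y s) \<le> Y"
    using compact_norm_bound[OF compact_Icc y] by blast
  obtain \<eta> where \<eta>: "0 < \<eta>" "\<And>s r. s \<in> {0..1} \<Longrightarrow> r \<in> {0..1} \<Longrightarrow> dist r s < \<eta> \<Longrightarrow> dist (y r) (y s) < \<epsilon>"
    using compact_uniformly_continuous[OF y compact_Icc] \<open>0 < \<epsilon>\<close> unfolding uniformly_continuous_on_def by metis
  obtain n where n: "inverse (real (Suc n)) < \<eta>" using reals_Archimedean[OF \<eta>(1)] by blast
  define N where "N = real (Suc n)"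
  have N: "0 < N" "1 / N < \<eta>" using n by (auto simp: N_def inverse_eq_divide)
  define \<delta> where "\<delta> = \<epsilon> / (2 * Y * N)"
  have "0 < \<delta>" using \<open>0 < \<epsilon>\<close> Y(1) N(1) by (simp add: \<delta>_def)
  show thesis
  proof (rule that[OF \<open>0 < \<delta>\<close>])
    fix w :: "real \<Rightarrow> real" and t :: real
    assume w: "w absolutely_integrable_on {0..1}" and small: "\<And>t. t \<in> {0..1} \<Longrightarrow> \<bar>integral {0..t} w\<bar> \<le> \<delta>" and t: "t \<in> {0..1}"
    have wi: "w integrable_on {0..1}" and wa: "(\<lambda>s. \<bar>w s\<bar>) integrable_on {0..1}"
      using w by (auto simp: absolutely_integrable_on_def)
    have wy: "(\<lambda>s. w s *\<^sub>R y s) integrable_on {0..1}"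
      by (rule set_lebesgue_integral_eq_integral(1)[OF absolutely_integrable_scaleR_continuous[OF y w]])
    have claim: "\<forall>t\<in>{0..real j / N}. norm (integral {0..t} (\<lambda>s. w s *\<^sub>R y s)) \<le> \<epsilon> * integral {0..t} (\<lambda>s. \<bar>w s\<bar>) + 2 * \<delta> * Y * real j"
      if "j \<le> Suc n" for j
      using that
    proof (induction j)
      case (Suc j)
      define a where "a = real j / N"
      have a: "0 \<le> a" "real (Suc j) / N = a + 1 / N" using N(1) by (auto simp: a_def add_divide_distrib)
      have "real (Suc j) / N \<le> 1" using Suc.prems N(1) by (simp add: N_def)
      then have a1: "a + 1 / N \<le> 1" by (simp only: a(2))
      show ?case
      proof
        fix t assume t: "t \<in> {0..real (Suc j) / N}"
        show "norm (integral {0..t} (\<lambda>s. w s *\<^sub>R y s)) \<le> \<epsilon> * integral {0..t} (\<lambda>s. \<bar>w s\<bar>) + 2 * \<delta> * Y * real (Suc j)"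
        proof (cases "t \<le> a")
          case True
          then have "norm (integral {0..t} (\<lambda>s. w s *\<^sub>R y s)) \<le> \<epsilon> * integral {0..t} (\<lambda>s. \<bar>w s\<bar>) + 2 * \<delta> * Y * real j"
            using Suc t by (auto simp: a_def)
          also have "2 * \<delta> * Y * real j \<le> 2 * \<delta> * Y * real (Suc j)" using \<open>0 < \<delta>\<close> Y(1) by (intro mult_left_mono) auto
          finally show ?thesis by simp
        next
          case False
          then have at: "a \<le> t" "t \<le> 1" "t - a \<le> 1 / N" using t a a1 by auto
          have sub: "f integrable_on {a..t}" if "f integrable_on {0..1}" for f :: "real \<Rightarrow> 'b::euclidean_space"
            using at a by (intro integrable_on_subinterval[OF that]) auto
          have "(\<lambda>s. w s *\<^sub>R (y s - y a)) integrable_on {a..t}" "(\<lambda>s. w s *\<^sub>R y a) integrable_on {a..t}"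
          proof -
            show 1: "(\<lambda>s. w s *\<^sub>R y a) integrable_on {a..t}"
              using integrable_linear[OF sub[OF wi] bounded_linear_scaleR_left[of "y a"]] by (simp add: o_def)
            show "(\<lambda>s. w s *\<^sub>R (y s - y a)) integrable_on {a..t}"
              using integrable_diff[OF sub[OF wy] 1] by (simp add: scaleR_diff_right)
          qed
          note ints = this
          have "integral {a..t} (\<lambda>s. w s *\<^sub>R y s) = integral {a..t} (\<lambda>s. w s *\<^sub>R (y s - y a)) + integral {a..t} (\<lambda>s. w s *\<^sub>R y a)"
            using Henstock_Kurzweil_Integration.integral_add[OF ints] by (simp add: scaleR_diff_right)
          also have "integral {a..t} (\<lambda>s. w s *\<^sub>R y a) = integral {a..t} w *\<^sub>R y a"
            using integral_linear[OF sub[OF wi] bounded_linear_scaleR_left[of "y a"]] by (simp add: o_def)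
          also have "norm (integral {a..t} (\<lambda>s. w s *\<^sub>R (y s - y a)) + integral {a..t} w *\<^sub>R y a)
              \<le> \<epsilon> * integral {a..t} (\<lambda>s. \<bar>w s\<bar>) + 2 * \<delta> * Y"
          proof (rule norm_triangle_mono)
            have "norm (integral {a..t} (\<lambda>s. w s *\<^sub>R (y s - y a))) \<le> integral {a..t} (\<lambda>s. \<epsilon> * \<bar>w s\<bar>)"
            proof (rule integral_norm_bound_integral[OF ints(1) integrable_on_mult_right[OF sub[OF wa]]])
              fix s assume s: "s \<in> {a..t}"
              then have "dist s a < \<eta>" using at N(2) by (simp add: dist_real_def)
              then have "norm (y s - y a) \<le> \<epsilon>" using \<eta>(2)[of a s] s at a by (simp add: dist_norm)
              then show "norm (w s *\<^sub>R (y s - y a)) \<le> \<epsilon> * \<bar>w s\<bar>" 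
                using mult_left_mono[of _ _ "\<bar>w s\<bar>"] by (simp add: mult.commute[of \<epsilon>])
            qed
            then show "norm (integral {a..t} (\<lambda>s. w s *\<^sub>R (y s - y a))) \<le> \<epsilon> * integral {a..t} (\<lambda>s. \<bar>w s\<bar>)" by simp
            have "\<bar>integral {a..t} w\<bar> \<le> 2 * \<delta>"
              using integral_combine_real[OF wi a(1) at(1,2)] small[of a] small[of t] a at by auto
            then have "\<bar>integral {a..t} w\<bar> * norm (y a) \<le> 2 * \<delta> * Y"
              using Y(2)[of a] a at \<open>0 < \<delta>\<close> by (intro mult_mono) auto
            then show "norm (integral {a..t} w *\<^sub>R y a) \<le> 2 * \<delta> * Y" by simp
          qed
          finally have "norm (integral {a..t} (\<lambda>s. w s *\<^sub>R y s)) \<le> \<epsilon> * integral {a..t} (\<lambda>s. \<bar>w s\<bar>) + 2 * \<delta> * Y" .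
          moreover have "norm (integral {0..a} (\<lambda>s. w s *\<^sub>R y s)) \<le> \<epsilon> * integral {0..a} (\<lambda>s. \<bar>w s\<bar>) + 2 * \<delta> * Y * real j"
            using Suc a by (auto simp: a_def)
          moreover have "integral {0..t} (\<lambda>s. w s *\<^sub>R y s) = integral {0..a} (\<lambda>s. w s *\<^sub>R y s) + integral {a..t} (\<lambda>s. w s *\<^sub>R y s)"
            using integral_combine_real[OF wy a(1) at(1,2)] by (simp add: algebra_simps)
          moreover have "integral {0..t} (\<lambda>s. \<bar>w s\<bar>) = integral {0..a} (\<lambda>s. \<bar>w s\<bar>) + integral {a..t} (\<lambda>s. \<bar>w s\<bar>)"
            using integral_combine_real[OF wa a(1) at(1,2)] by simp
          ultimately show ?thesis
            using norm_triangle_ineq[of "integral {0..a} (\<lambda>s. w s *\<^sub>R y s)" "integral {a..t} (\<lambda>s. w s *\<^sub>R y s)"]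
            by (simp add: distrib_left)
        qed
      qed
    qed simp
    have "norm (integral {0..t} (\<lambda>s. w s *\<^sub>R y s)) \<le> \<epsilon> * integral {0..t} (\<lambda>s. \<bar>w s\<bar>) + 2 * \<delta> * Y * N"
      using claim[of "Suc n"] t N(1) by (auto simp: N_def)
    also have "2 * \<delta> * Y * N = \<epsilon>" using N(1) Y(1) by (simp add: \<delta>_def)
    also have "\<epsilon> * integral {0..t} (\<lambda>s. \<bar>w s\<bar>) \<le> \<epsilon> * integral {0..1} (\<lambda>s. \<bar>w s\<bar>)"
      using t \<open>0 < \<epsilon>\<close> by (intro mult_left_mono integral_nonneg_mono(1)[OF wa]) auto
    finally show "norm (integral {0..t} (\<lambda>s. w s *\<^sub>R y s)) \<le> \<epsilon> * (1 + integral {0..1} (\<lambda>s. \<bar>w s\<bar>))"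
      by (simp add: distrib_left)
  qed
qed

context control_system
begin

text \<open>The trajectory \<open>x\<close> of the limit control solves the equation of \<open>u n\<close> up to the term
  \<open>\<integral> \<Sum>\<^sub>i (u n - v)\<^sub>i F i (x s)\<close>, in which \<open>x\<close> does not depend on \<open>n\<close>; this tends to 0 by
  \<open>integral_oscillating\<close>.\<close>

lemma flow_weakly_continuous:
  assumes u: "\<And>n. u n \<in> L2_controls" and v: "v \<in> L2_controls" and A: "\<And>n. L2_norm_sq (u n) \<le> A"
    and lim: "\<And>e. 0 < e \<Longrightarrow> \<exists>N. \<forall>n\<ge>N. \<forall>t\<in>{0..1}. norm (integral {0..t} (u n) - integral {0..t} v) < e"
  shows "(\<lambda>n. flow F (u n) x0) \<longlonglongrightarrow> flow F v x0"
proof (rule LIMSEQ_I)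
  fix \<epsilon> :: real assume "0 < \<epsilon>"
  define x where "x = traj v x0"
  note x = integral_solutionD[OF traj[OF v, of x0], folded x_def]
  have "0 \<le> A" using A[of 0] L2_norm_sq_nonneg[of "u 0"] by linarith
  define A' where "A' = 1 + (1 + A) + (1 + L2_norm_sq v)"
  define E where "E = 2 * real CARD('l) * A' * exp (2 * \<Lambda> * (1 + A)) + 1"
  have "0 < A'" using \<open>0 \<le> A\<close> L2_norm_sq_nonneg[of v] by (simp add: A'_def add_pos_nonneg)
  then have "0 < E" by (simp add: E_def add_nonneg_pos)
  define \<kappa> where "\<kappa> = \<epsilon> / E"
  have "0 < \<kappa>" using \<open>0 < \<epsilon>\<close> \<open>0 < E\<close> by (simp add: \<kappa>_def)
  have Fx: "continuous_on {0..1} (\<lambda>s. F i (x s))" for i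
    using continuous_on_compose2[OF F_continuous x(1)] by blast
  define damps where "damps i \<delta> \<longleftrightarrow> 0 < \<delta> \<and> (\<forall>w t. w absolutely_integrable_on {0..1} \<longrightarrow>
      (\<forall>t\<in>{0..1}. \<bar>integral {0..t} w\<bar> \<le> \<delta>) \<longrightarrow> t \<in> {0..1} \<longrightarrow>
       norm (integral {0..t} (\<lambda>s. w s *\<^sub>R F i (x s))) \<le> \<kappa> * (1 + integral {0..1} (\<lambda>s. \<bar>w s\<bar>)))" for i \<delta>
  have "\<exists>\<delta>. damps i \<delta>" for i
  proof (rule integral_oscillating[OF Fx[of i] \<open>0 < \<kappa>\<close>])
    fix \<delta> :: real assume "0 < \<delta>" "\<And>w t. w absolutely_integrable_on {0..1} \<Longrightarrow> (\<And>t. t \<in> {0..1} \<Longrightarrow> \<bar>integral {0..t} w\<bar> \<le> \<delta>) \<Longrightarrow> t \<in> {0..1} \<Longrightarrow>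
       norm (integral {0..t} (\<lambda>s. w s *\<^sub>R F i (x s))) \<le> \<kappa> * (1 + integral {0..1} (\<lambda>s. \<bar>w s\<bar>))"
    then have "damps i \<delta>" unfolding damps_def by blast
    then show "\<exists>\<delta>. damps i \<delta>" ..
  qed
  then obtain \<delta> where "\<And>i. damps i (\<delta> i)" by metis
  then have \<delta>: "\<And>i. 0 < \<delta> i" "\<And>i w t. w absolutely_integrable_on {0..1} \<Longrightarrow> (\<And>t. t \<in> {0..1} \<Longrightarrow> \<bar>integral {0..t} w\<bar> \<le> \<delta> i) \<Longrightarrow> t \<in> {0..1} \<Longrightarrow>
       norm (integral {0..t} (\<lambda>s. w s *\<^sub>R F i (x s))) \<le> \<kappa> * (1 + integral {0..1} (\<lambda>s. \<bar>w s\<bar>))"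
    unfolding damps_def by blast+
  define d where "d = Min (range \<delta>)"
  have d: "0 < d" "d \<le> \<delta> i" for i using \<delta>(1) by (auto simp: d_def)
  obtain N where N: "\<And>n t. n \<ge> N \<Longrightarrow> t \<in> {0..1} \<Longrightarrow> norm (integral {0..t} (u n) - integral {0..t} v) < d"
    using lim[OF d(1)] by blast
  have "norm (flow F (u n) x0 - flow F v x0) < \<epsilon>" if n: "n \<ge> N" for n
  proof -
    define y where "y = traj (u n) x0"
    note y = integral_solutionD[OF traj[OF u[of n], of x0], folded y_def]
    have w: "(\<lambda>s. u n s - v s) \<in> L2_controls"
      using L2_controls_linear[OF u[of n] v, of 1 "-1"] by simp
    have wa: "(\<lambda>s. (u n s - v s) $ i) absolutely_integrable_on {0..1}" for i
      using absolutely_integrable_component[OF L2_controlsD(4)[OF w], of "axis i 1"] by (simp add: inner_axis)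
    have L1: "integral {0..1} (\<lambda>s. \<bar>(u n s - v s) $ i\<bar>) \<le> (1 + A) + (1 + L2_norm_sq v)" for i
    proof -
      have "integral {0..1} (\<lambda>s. \<bar>(u n s - v s) $ i\<bar>) \<le> integral {0..1} (\<lambda>s. norm (u n s) + norm (v s))"
      proof (rule integral_le)
        show "(\<lambda>s. \<bar>(u n s - v s) $ i\<bar>) integrable_on {0..1}" using wa[of i] by (simp add: absolutely_integrable_on_def)
        show "(\<lambda>s. norm (u n s) + norm (v s)) integrable_on {0..1}"
          by (intro integrable_add L2_controlsD(2) u v)
        show "\<bar>(u n s - v s) $ i\<bar> \<le> norm (u n s) + norm (v s)" for s
          using component_le_norm_cart[of "u n s - v s" i] norm_triangle_ineq4[of "u n s" "v s"] by linarith
      qed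
      also have "\<dots> = integral {0..1} (\<lambda>s. norm (u n s)) + integral {0..1} (\<lambda>s. norm (v s))"
        by (rule Henstock_Kurzweil_Integration.integral_add[OF L2_controlsD(2)[OF u] L2_controlsD(2)[OF v]])
      finally show ?thesis using L1_norm_le[OF u[of n]] L1_norm_le[OF v] A[of n] by linarith
    qed
    have prim: "\<bar>integral {0..t} (\<lambda>s. (u n s - v s) $ i)\<bar> \<le> \<delta> i" if t: "t \<in> {0..1}" for i t
    proof -
      have sub: "f integrable_on {0..t}" if "f integrable_on {0..1}" for f :: "real \<Rightarrow> real ^ 'l"
        using t by (intro integrable_on_subinterval[OF that]) auto
      have "integral {0..t} (\<lambda>s. (u n s - v s) $ i) = integral {0..t} (\<lambda>s. u n s - v s) $ i"
        using integral_linear[OF sub[OF L2_controlsD(1)[OF w]] bounded_linear_vec_nth[of i]] by (simp add: o_def)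
      also have "integral {0..t} (\<lambda>s. u n s - v s) = integral {0..t} (u n) - integral {0..t} v"
        by (rule Henstock_Kurzweil_Integration.integral_diff[OF sub[OF L2_controlsD(1)[OF u]] sub[OF L2_controlsD(1)[OF v]]])
      also have "\<bar>(integral {0..t} (u n) - integral {0..t} v) $ i\<bar> \<le> \<delta> i"
        using component_le_norm_cart[of "integral {0..t} (u n) - integral {0..t} v" i] N[OF n t] d(2)[of i] by linarith
      finally show ?thesis .
    qed
    have "norm (y 1 - x 1) \<le> 2 * (real CARD('l) * (\<kappa> * A')) * exp (2 * \<Lambda> * integral {0..1} (\<lambda>s. norm (u n s)))"
    proof (rule trajectories_close[OF u y(1) x(1)])
      show "0 \<le> real CARD('l) * (\<kappa> * A')" using \<open>0 < \<kappa>\<close> \<open>0 < A'\<close> by simp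
      fix t :: real assume t: "t \<in> {0..1}"
      have vy: "(\<lambda>s. velocity (u n s) (y s)) integrable_on {0..t}" and vx: "(\<lambda>s. velocity (u n s) (x s)) integrable_on {0..t}"
        and vv: "(\<lambda>s. velocity (v s) (x s)) integrable_on {0..t}"
        using t by (auto intro!: velocity_integrable(2) u v x(1) y(1))
      have wF: "(\<lambda>s. (u n s - v s) $ i *\<^sub>R F i (x s)) integrable_on {0..t}" for i
        using set_lebesgue_integral_eq_integral(1)[OF absolutely_integrable_scaleR_continuous[OF Fx wa[of i], of i]] t
        by (rule_tac integrable_on_subinterval) auto
      have "(y t - x t) - integral {0..t} (\<lambda>s. velocity (u n s) (y s) - velocity (u n s) (x s))
          = integral {0..t} (\<lambda>s. velocity (u n s) (x s)) - integral {0..t} (\<lambda>s. velocity (v s) (x s))"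
        using y(3)[OF t] x(3)[OF t] Henstock_Kurzweil_Integration.integral_diff[OF vy vx] by (simp only: add_diff_cancel_left) simp
      also have "\<dots> = integral {0..t} (\<lambda>s. velocity (u n s) (x s) - velocity (v s) (x s))"
        by (rule Henstock_Kurzweil_Integration.integral_diff[OF vx vv, symmetric])
      also have "\<dots> = integral {0..t} (\<lambda>s. \<Sum>i\<in>UNIV. (u n s - v s) $ i *\<^sub>R F i (x s))"
        by (simp add: velocity_def scaleR_diff_left sum_subtractf)
      also have "\<dots> = (\<Sum>i\<in>UNIV. integral {0..t} (\<lambda>s. (u n s - v s) $ i *\<^sub>R F i (x s)))"
        by (rule integral_sum) (auto simp del: vector_minus_component intro: wF)
      also have "norm \<dots> \<le> (\<Sum>i\<in>(UNIV::'l set). \<kappa> * A')"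
      proof (rule sum_norm_le)
        fix i
        have "norm (integral {0..t} (\<lambda>s. (u n s - v s) $ i *\<^sub>R F i (x s))) \<le> \<kappa> * (1 + integral {0..1} (\<lambda>s. \<bar>(u n s - v s) $ i\<bar>))"
          by (rule \<delta>(2)[OF wa prim t])
        also have "\<dots> \<le> \<kappa> * A'" using L1[of i] \<open>0 < \<kappa>\<close> by (intro mult_left_mono) (auto simp: A'_def)
        finally show "norm (integral {0..t} (\<lambda>s. (u n s - v s) $ i *\<^sub>R F i (x s))) \<le> \<kappa> * A'" .
      qed
      finally show "norm ((y t - x t) - integral {0..t} (\<lambda>s. velocity (u n s) (y s) - velocity (u n s) (x s))) \<le> real CARD('l) * (\<kappa> * A')"
        by simp
    qed simp
    also have "\<dots> \<le> 2 * (real CARD('l) * (\<kappa> * A')) * exp (2 * \<Lambda> * (1 + A))"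
      using L1_norm_le[OF u[of n]] A[of n] \<Lambda>_nonneg \<open>0 < \<kappa>\<close> \<open>0 < A'\<close> by (intro mult_left_mono) (auto intro: mult_left_mono)
    also have "\<dots> = \<kappa> * (E - 1)" by (simp add: E_def)
    also have "\<dots> < \<kappa> * E" using \<open>0 < \<kappa>\<close> by simp
    also have "\<dots> = \<epsilon>" using \<open>0 < E\<close> by (simp add: \<kappa>_def)
    finally show ?thesis by (simp add: flow_traj[OF u] flow_traj[OF v] x_def y_def)
  qed
  then show "\<exists>no. \<forall>n\<ge>no. norm (flow F (u n) x0 - flow F v x0) < \<epsilon>" by blast
qed

end

section \<open>Minimisers and the limit of vanishing regularisation\<close>

locale ensemble_problem = control_system F M L
  for F :: "'l::finite \<Rightarrow> 'a \<Rightarrow> 'a::euclidean_space" and M L +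
  fixes \<Psi> :: "'a \<Rightarrow> 'a" and a :: "'a \<Rightarrow> real" and \<mu> :: "'a measure" and K :: "'a set"
  assumes \<Psi>: "continuous_on UNIV \<Psi>" and a: "continuous_on UNIV a" and a_nonneg: "\<And>x. 0 \<le> a x" and a_zero: "a 0 = 0"
    and K: "compact K" and prob: "prob_space \<mu>" and sets: "sets \<mu> = sets borel" and supp: "emeasure \<mu> (- K) = 0"
begin

sublocale \<mu>: prob_space \<mu> by (rule prob)

lemma AE_K: "AE x in \<mu>. x \<in> K"
proof (rule AE_I)
  show "emeasure \<mu> (- K) = 0" by (rule supp)
  show "- K \<in> sets \<mu>" using K by (simp add: sets compact_imp_closed)
qed auto

definition end_cost :: "(real \<Rightarrow> real ^ 'l) \<Rightarrow> real" where
  "end_cost u = (\<integral>x. a (flow F u x - \<Psi> x) \<partial>\<mu>)"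

lemma cost_eq: "cost F \<Psi> a \<mu> \<beta> u = end_cost u + \<beta> / 2 * L2_norm_sq u"
  by (simp add: cost_def end_cost_def)

lemma integrand_measurable:
  assumes "u \<in> L2_controls"
  shows "(\<lambda>x. a (flow F u x - \<Psi> x)) \<in> borel_measurable \<mu>"
proof -
  have "continuous_on UNIV (\<lambda>x. a (flow F u x - \<Psi> x))"
    by (intro continuous_on_compose2[OF a] continuous_intros flow_continuous[OF assms] \<Psi>) auto
  then show ?thesis
    using measurable_cong_sets[OF sets refl] borel_measurable_continuous_onI by blast
qed

lemma integrand_bound:
  obtains W where "\<And>u x. u \<in> L2_controls \<Longrightarrow> L2_norm_sq u \<le> A \<Longrightarrow> x \<in> K \<Longrightarrow> a (flow F u x - \<Psi> x) \<le> W"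
proof -
  have "continuous_on K (\<lambda>x. x - \<Psi> x)"
    by (intro continuous_intros continuous_on_subset[OF \<Psi> subset_UNIV])
  then obtain K1 where K1: "\<And>x. x \<in> K \<Longrightarrow> norm (x - \<Psi> x) \<le> K1"
    using compact_norm_bound[OF K] by blast
  obtain W where W: "\<And>y. y \<in> cball 0 (K1 + B * (1 + A)) \<Longrightarrow> norm (a y) \<le> W"
    using compact_norm_bound[OF compact_cball continuous_on_subset[OF a subset_UNIV], of 0 "K1 + B * (1 + A)"] by blast
  show thesis
  proof (rule that[of W])
    fix u :: "real \<Rightarrow> real ^ 'l" and x assume u: "u \<in> L2_controls" "L2_norm_sq u \<le> A" and x: "x \<in> K"
    have "norm (flow F u x - x) \<le> B * integral {0..1} (\<lambda>s. norm (u s))"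
      using traj_displacement[OF u(1), of 1 x] by (simp add: flow_traj[OF u(1)])
    also have "\<dots> \<le> B * (1 + A)" using L1_norm_le[OF u(1)] u(2) B_nonneg by (intro mult_left_mono) auto
    finally have "norm (flow F u x - \<Psi> x) \<le> K1 + B * (1 + A)"
      using norm_triangle_ineq[of "flow F u x - x" "x - \<Psi> x"] K1[OF x] by simp
    then show "a (flow F u x - \<Psi> x) \<le> W" using W[of "flow F u x - \<Psi> x"] by simp
  qed
qed

lemma integrand_integrable:
  assumes u: "u \<in> L2_controls"
  shows "integrable \<mu> (\<lambda>x. a (flow F u x - \<Psi> x))"
proof -
  obtain W where W: "\<And>u' x. u' \<in> L2_controls \<Longrightarrow> L2_norm_sq u' \<le> L2_norm_sq u \<Longrightarrow> x \<in> K \<Longrightarrow> a (flow F u' x - \<Psi> x) \<le> W"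
    using integrand_bound[of "L2_norm_sq u"] by blast
  show ?thesis
  proof (rule \<mu>.integrable_const_bound[OF _ integrand_measurable[OF u]])
    show "AE x in \<mu>. norm (a (flow F u x - \<Psi> x)) \<le> W"
      using AE_K by eventually_elim (use W[OF u order_refl] a_nonneg in auto)
  qed
qed

lemma end_cost_nonneg: "0 \<le> end_cost u"
  unfolding end_cost_def using a_nonneg by (intro integral_nonneg_AE) auto

lemma end_cost_K: "(LINT x:K|\<mu>. a (flow F u x - \<Psi> x)) = end_cost u" if "u \<in> L2_controls"
  unfolding end_cost_def set_lebesgue_integral_def
proof (rule integral_cong_AE)
  show "(\<lambda>x. a (flow F u x - \<Psi> x)) \<in> borel_measurable \<mu>" by (rule integrand_measurable[OF that])
  have "K \<in> sets \<mu>" using K by (simp add: sets compact_imp_closed)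
  then show "(\<lambda>x. indicat_real K x *\<^sub>R a (flow F u x - \<Psi> x)) \<in> borel_measurable \<mu>"
    using integrand_measurable[OF that] by measurable
  show "AE x in \<mu>. indicat_real K x *\<^sub>R a (flow F u x - \<Psi> x) = a (flow F u x - \<Psi> x)"
    using AE_K by eventually_elim simp
qed

lemma end_cost_weakly_continuous:
  assumes u: "\<And>n. u n \<in> L2_controls" and v: "v \<in> L2_controls" and A: "\<And>n. L2_norm_sq (u n) \<le> A"
    and lim: "\<And>e. 0 < e \<Longrightarrow> \<exists>N. \<forall>n\<ge>N. \<forall>t\<in>{0..1}. norm (integral {0..t} (u n) - integral {0..t} v) < e"
  shows "(\<lambda>n. end_cost (u n)) \<longlonglongrightarrow> end_cost v"
proof -
  obtain W where W: "\<And>u x. u \<in> L2_controls \<Longrightarrow> L2_norm_sq u \<le> A \<Longrightarrow> x \<in> K \<Longrightarrow> a (flow F u x - \<Psi> x) \<le> W"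
    using integrand_bound by blast
  show ?thesis
    unfolding end_cost_def
  proof (rule integral_dominated_convergence[where w = "\<lambda>_. W"])
    show "AE x in \<mu>. (\<lambda>n. a (flow F (u n) x - \<Psi> x)) \<longlonglongrightarrow> a (flow F v x - \<Psi> x)"
    proof (intro AE_I2)
      fix x
      have "(\<lambda>n. flow F (u n) x - \<Psi> x) \<longlonglongrightarrow> flow F v x - \<Psi> x"
        by (intro tendsto_diff tendsto_const flow_weakly_continuous[OF u v A lim])
      moreover have "isCont a (flow F v x - \<Psi> x)" using a by (simp add: continuous_on_eq_continuous_at)
      ultimately show "(\<lambda>n. a (flow F (u n) x - \<Psi> x)) \<longlonglongrightarrow> a (flow F v x - \<Psi> x)"
        by (rule isCont_tendsto_compose[rotated])
    qed
    show "AE x in \<mu>. norm (a (flow F (u n) x - \<Psi> x)) \<le> W" for n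
      using AE_K by eventually_elim (use W[OF u A] a_nonneg in auto)
  qed (use integrand_measurable u v in auto)
qed

text \<open>The direct method: the end cost is weakly continuous, the squared norm is weakly lower
  semicontinuous and coercive.\<close>

lemma minimizer_exists:
  assumes "0 < \<beta>"
  shows "\<exists>u. u \<in> minimizers F \<Psi> a \<mu> \<beta>"
proof -
  define J where "J = cost F \<Psi> a \<mu> \<beta>"
  have J: "J u = end_cost u + \<beta> / 2 * L2_norm_sq u" for u by (simp add: J_def cost_eq)
  have J0: "0 \<le> J u" for u
    unfolding J using end_cost_nonneg assms by (simp add: L2_norm_sq_nonneg)
  define m where "m = Inf (J ` L2_controls)"
  have bdd: "bdd_below (J ` L2_controls)" using J0 by (intro bdd_belowI[of _ 0]) auto
  have ne: "J ` L2_controls \<noteq> {}" using const_control_L2 by blast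
  have "\<exists>u\<in>L2_controls. J u < m + 1 / real (Suc n)" for n
    using cInf_lessD[OF ne, of "m + 1 / real (Suc n)"] by (auto simp: m_def)
  then obtain u where u: "\<And>n. u n \<in> L2_controls" and Ju: "\<And>n. J (u n) < m + 1 / real (Suc n)"
    by metis
  define A where "A = 2 * (m + 1) / \<beta>"
  have uA: "L2_norm_sq (u n) \<le> A" for n
  proof -
    have "1 / real (Suc n) \<le> 1" by simp
    then have "\<beta> / 2 * L2_norm_sq (u n) \<le> m + 1"
      using Ju[of n] end_cost_nonneg[of "u n"] unfolding J by linarith
    then show ?thesis using assms by (simp add: A_def field_simps)
  qed
  have "\<forall>n. L2_norm_sq (u n) \<in> {0..A}" using uA by (simp add: L2_norm_sq_nonneg)
  then have "\<exists>l\<in>{0..A}. \<exists>r. strict_mono (r :: nat \<Rightarrow> nat) \<and> ((\<lambda>n. L2_norm_sq (u n)) \<circ> r) \<longlonglongrightarrow> l"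
    by (rule compact_Icc[of 0 A, unfolded compact_def, THEN spec, THEN mp])
  then obtain l r0 where r0: "strict_mono (r0 :: nat \<Rightarrow> nat)" "((\<lambda>n. L2_norm_sq (u n)) \<circ> r0) \<longlonglongrightarrow> l"
    by blast
  obtain v r where v: "v \<in> L2_controls" "strict_mono (r :: nat \<Rightarrow> nat)" "L2_norm_sq v \<le> l"
    and conv: "\<And>e. 0 < e \<Longrightarrow> \<exists>N. \<forall>n\<ge>N. \<forall>t\<in>{0..1}. norm (integral {0..t} (u (r0 (r n))) - integral {0..t} v) < e"
    using L2_weak_compactness[of "\<lambda>n. u (r0 n)" l, OF u r0(2)[unfolded o_def]] by blast
  have "(\<lambda>n. end_cost (u (r0 (r n)))) \<longlonglongrightarrow> end_cost v"
    by (rule end_cost_weakly_continuous[OF u v(1) uA conv])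
  moreover have "(\<lambda>n. L2_norm_sq (u (r0 (r n)))) \<longlonglongrightarrow> l"
    using LIMSEQ_subseq_LIMSEQ[OF r0(2) v(2)] by (simp add: o_def)
  ultimately have limJ: "(\<lambda>n. J (u (r0 (r n)))) \<longlonglongrightarrow> end_cost v + \<beta> / 2 * l"
    unfolding J by (intro tendsto_add tendsto_mult tendsto_const)
  have limm: "(\<lambda>n. m + inverse (real (Suc n))) \<longlonglongrightarrow> m + 0"
    by (intro tendsto_add tendsto_const LIMSEQ_inverse_real_of_nat)
  have "J (u (r0 (r n))) \<le> m + inverse (real (Suc n))" for n
  proof -
    have "n \<le> r0 (r n)" using seq_suble[OF v(2), of n] seq_suble[OF r0(1), of "r n"] by linarith
    then have "1 / real (Suc (r0 (r n))) \<le> inverse (real (Suc n))" by (simp add: inverse_eq_divide frac_le)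
    then show ?thesis using Ju[of "r0 (r n)"] by linarith
  qed
  then have "end_cost v + \<beta> / 2 * l \<le> m" using LIMSEQ_le[OF limJ limm] by auto
  moreover have "\<beta> / 2 * L2_norm_sq v \<le> \<beta> / 2 * l" using v(3) assms by (intro mult_left_mono) auto
  ultimately have "J v \<le> m" unfolding J by linarith
  moreover have "m \<le> J w" if "w \<in> L2_controls" for w
    unfolding m_def using that bdd by (intro cInf_lower) auto
  ultimately have "v \<in> minimizers F \<Psi> a \<mu> \<beta>"
    using v(1) unfolding minimizers_def is_arg_min_def J_def[symmetric] by (force simp: not_less)
  then show ?thesis by blast
qed

text \<open>Every minimiser has at most the total cost of a fixed control with small end cost, whose
  regularisation term vanishes with \<open>\<beta>\<close>. Existence of minimisers gives the bound from below.\<close>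

lemma kappa_tendsto_zero:
  assumes dense: "\<And>\<epsilon>. 0 < \<epsilon> \<Longrightarrow> \<exists>u\<in>L2_controls. end_cost u \<le> \<epsilon>"
  shows "((\<lambda>\<beta>. kappa F \<Psi> a \<mu> K \<beta>) \<longlongrightarrow> 0) (at_right 0)"
proof -
  have lower: "0 \<le> kappa F \<Psi> a \<mu> K \<beta>" if \<beta>: "0 < \<beta>" for \<beta>
  proof -
    obtain u where u: "u \<in> minimizers F \<Psi> a \<mu> \<beta>" using minimizer_exists[OF \<beta>] by blast
    then have "u \<in> L2_controls" by (simp add: minimizers_def is_arg_min_def)
    then have "0 \<le> ereal (LINT x:K|\<mu>. a (flow F u x - \<Psi> x))" by (simp add: end_cost_K end_cost_nonneg)
    also have "\<dots> \<le> kappa F \<Psi> a \<mu> K \<beta>" unfolding kappa_def using u by (rule SUP_upper)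
    finally show ?thesis .
  qed
  have upper: "kappa F \<Psi> a \<mu> K \<beta> \<le> ereal (end_cost u + \<beta> / 2 * L2_norm_sq u)" if \<beta>: "0 < \<beta>" and u: "u \<in> L2_controls" for \<beta> u
    unfolding kappa_def
  proof (rule SUP_least)
    fix v assume "v \<in> minimizers F \<Psi> a \<mu> \<beta>"
    then have v: "v \<in> L2_controls" and "cost F \<Psi> a \<mu> \<beta> v \<le> cost F \<Psi> a \<mu> \<beta> u"
      using u by (auto simp: minimizers_def is_arg_min_def not_less)
    moreover have "0 \<le> \<beta> / 2 * L2_norm_sq v" using \<beta> by (simp add: L2_norm_sq_nonneg)
    ultimately have "end_cost v \<le> end_cost u + \<beta> / 2 * L2_norm_sq u" unfolding cost_eq by linarith
    then show "ereal (LINT x:K|\<mu>. a (flow F v x - \<Psi> x)) \<le> ereal (end_cost u + \<beta> / 2 * L2_norm_sq u)"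
      by (simp add: end_cost_K[OF v])
  qed
  show ?thesis
  proof (rule order_tendstoI)
    fix y :: ereal assume "y < 0"
    then have "y < kappa F \<Psi> a \<mu> K \<beta>" if "0 < \<beta>" for \<beta> using lower[OF that] by (rule less_le_trans)
    then show "\<forall>\<^sub>F \<beta> in at_right 0. y < kappa F \<Psi> a \<mu> K \<beta>"
      by (rule eventually_mono[OF eventually_at_right_less])
  next
    fix y :: ereal assume "0 < y"
    then obtain \<epsilon> where \<epsilon>: "0 < \<epsilon>" "ereal \<epsilon> < y" using ereal_dense2[of 0 y] by auto
    obtain u where u: "u \<in> L2_controls" "end_cost u \<le> \<epsilon> / 2" using dense[of "\<epsilon> / 2"] \<epsilon>(1) by auto
    define \<beta>0 where "\<beta>0 = \<epsilon> / (L2_norm_sq u + 1)"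
    have "0 < \<beta>0" using \<epsilon>(1) L2_norm_sq_nonneg[of u] by (simp add: \<beta>0_def)
    have "kappa F \<Psi> a \<mu> K \<beta> < y" if \<beta>: "0 < \<beta>" "\<beta> < \<beta>0" for \<beta>
    proof -
      have "\<beta> * L2_norm_sq u \<le> \<beta>0 * (L2_norm_sq u + 1)"
        using \<beta> L2_norm_sq_nonneg[of u] by (intro mult_mono) auto
      also have "\<dots> = \<epsilon>" using L2_norm_sq_nonneg[of u] by (simp add: \<beta>0_def)
      finally have "end_cost u + \<beta> / 2 * L2_norm_sq u \<le> \<epsilon>" using u(2) by simp
      then have "kappa F \<Psi> a \<mu> K \<beta> \<le> ereal \<epsilon>"
        using upper[OF \<beta>(1) u(1)] by (meson ereal_less_eq(3) order_trans)
      then show ?thesis using \<epsilon>(2) by (rule le_less_trans)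
    qed
    then show "\<forall>\<^sub>F \<beta> in at_right 0. kappa F \<Psi> a \<mu> K \<beta> < y"
      using \<open>0 < \<beta>0\<close> unfolding eventually_at_right_field by blast
  qed
qed

lemma end_cost_small:
  assumes approx: "\<And>\<epsilon>. 0 < \<epsilon> \<Longrightarrow> \<exists>g\<in>attainable. \<forall>x\<in>K. norm (g x - \<Psi> x) \<le> \<epsilon>" and "0 < \<epsilon>"
  shows "\<exists>u\<in>L2_controls. end_cost u \<le> \<epsilon>"
proof -
  have "isCont a 0" using a by (simp add: continuous_on_eq_continuous_at)
  then obtain d where d: "0 < d" "\<And>y. dist y 0 < d \<Longrightarrow> dist (a y) (a 0) < \<epsilon>"
    using \<open>0 < \<epsilon>\<close> unfolding continuous_at_eps_delta by blast
  obtain u where u: "u \<in> L2_controls" "\<And>x. x \<in> K \<Longrightarrow> norm (flow F u x - \<Psi> x) \<le> d / 2"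
    using approx[of "d / 2"] d(1) by (auto simp: attainable_def)
  have "end_cost u \<le> (\<integral>x. \<epsilon> \<partial>\<mu>)"
    unfolding end_cost_def
  proof (rule integral_mono_AE[OF integrand_integrable[OF u(1)]])
    show "AE x in \<mu>. a (flow F u x - \<Psi> x) \<le> \<epsilon>"
      using AE_K
    proof eventually_elim
      case (elim x)
      then have "dist (flow F u x - \<Psi> x) 0 < d" using u(2)[OF elim] d(1) by simp
      from d(2)[OF this] show ?case by (simp add: a_zero)
    qed
  qed simp
  then show ?thesis using u(1) \<mu>.prob_space by auto
qed

end

lemma smooth_bounded_imp_control_system:
  fixes F :: "'l::finite \<Rightarrow> 'a::euclidean_space \<Rightarrow> 'a"
  assumes F: "\<And>i. smooth_bounded (F i)"
  obtains M L where "control_system F M L"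
proof -
  have smooth: "Ck_on (Suc 0) UNIV (F i)" for i using F unfolding smooth_bounded_def smooth_on_def by blast
  have "\<exists>M. \<forall>x. norm (F i x) \<le> M" for i
  proof -
    have "[] \<in> lists (Basis :: 'a set)" by simp
    then have "bounded (range (iter_deriv [] (F i)))" using F unfolding smooth_bounded_def by blast
    then show ?thesis by (auto simp: bounded_iff)
  qed
  then obtain M where M: "\<And>i x. norm (F i x) \<le> M i" by metis
  have "\<exists>N. \<forall>x. norm (dir_deriv e (F i) x) \<le> N" if "e \<in> Basis" for i e
  proof -
    have "[e] \<in> lists Basis" using that by simp
    then have "bounded (range (iter_deriv [e] (F i)))" using F unfolding smooth_bounded_def by blast
    then show ?thesis by (auto simp: bounded_iff)
  qed
  note derivative_bounded = this
  define N where "N i e = (SOME N. \<forall>x. norm (dir_deriv e (F i) x) \<le> N)" for i e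
  have N: "norm (dir_deriv e (F i) x) \<le> N i e" if "e \<in> Basis" for i e x
    using someI_ex[OF derivative_bounded[OF that, of i]] unfolding N_def by blast
  define L where "L i = (\<Sum>e\<in>Basis. \<bar>N i e\<bar>)" for i
  have lip: "norm (F i x - F i y) \<le> L i * norm (x - y)" for i x y
  proof (rule differentiable_bound[where S = UNIV])
    fix z
    show "(F i has_derivative frechet_derivative (F i) (at z)) (at z within UNIV)"
      using Ck_on_SucD(1)[OF smooth] by simp
    show "onorm (frechet_derivative (F i) (at z)) \<le> L i"
    proof (rule onorm_bound)
      fix v
      have "norm (dir_deriv e (F i) z) \<le> \<bar>N i e\<bar>" if "e \<in> Basis" for e
        using N[OF that, of i z] by linarith
      then show "norm (frechet_derivative (F i) (at z) v) \<le> L i * norm v"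
        unfolding L_def
        by (intro bounded_linear_basis_bound has_derivative_bounded_linear[OF Ck_on_SucD(1)[OF smooth UNIV_I]])
    qed (simp add: L_def sum_nonneg)
  qed auto
  have fin: "f i \<le> (\<Sum>j\<in>UNIV. \<bar>f j\<bar>)" for f :: "'l \<Rightarrow> real" and i
    using member_le_sum[of i UNIV "\<lambda>j. \<bar>f j\<bar>"] by simp
  have "control_system F (\<Sum>j\<in>UNIV. \<bar>M j\<bar>) (\<Sum>j\<in>UNIV. \<bar>L j\<bar>)"
  proof
    show "norm (F i x) \<le> (\<Sum>j\<in>UNIV. \<bar>M j\<bar>)" for i x using M[of i x] fin[of M i] by linarith
    show "norm (F i x - F i y) \<le> (\<Sum>j\<in>UNIV. \<bar>L j\<bar>) * norm (x - y)" for i x y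
      using lip[of i x y] mult_right_mono[OF fin[of L i] norm_ge_zero[of "x - y"]] by linarith
  qed (simp add: sum_nonneg)
  then show thesis by (rule that)
qed

theorem proposition5p3:
  fixes F :: "'l::finite \<Rightarrow> real ^ 'n \<Rightarrow> real ^ 'n"
    and \<Psi> :: "real ^ 'n \<Rightarrow> real ^ 'n"
    and a :: "real ^ 'n \<Rightarrow> real"
    and \<mu> :: "(real ^ 'n) measure"
    and K :: "(real ^ 'n) set"
  assumes F_smooth: "\<And>i. smooth_bounded (F i)"
    and F_approx: "lie_strong_approximating F"
    and \<Psi>_diffeo: "diffeomorphism \<Psi>"
    and \<Psi>_diffeotopic: "diffeotopic_to_id \<Psi>"
    and a_smooth: "smooth_on UNIV a"
    and a_nonneg: "\<And>x. a x \<ge> 0"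
    and a_zero: "a 0 = 0"
    and K_compact: "compact K"
    and \<mu>_prob: "prob_space \<mu>"
    and \<mu>_borel: "sets \<mu> = sets borel"
    and \<mu>_supp: "emeasure \<mu> (- K) = 0"
  shows "((\<lambda>\<beta>. kappa F \<Psi> a \<mu> K \<beta>) \<longlongrightarrow> 0) (at_right 0)"
proof -
  obtain M L where "control_system F M L"
    by (rule smooth_bounded_imp_control_system[OF F_smooth])
  then interpret control_system F M L .
  have smooth: "smooth_on UNIV (F i)" for i using F_smooth by (simp add: smooth_bounded_def)
  obtain H :: "real \<Rightarrow> real ^ 'n \<Rightarrow> real ^ 'n" and T where H: "open T" "{0..1} \<times> UNIV \<subseteq> T" "smooth_on T (\<lambda>(s, x). H s x)"
    "\<And>s. s \<in> {0..1} \<Longrightarrow> diffeomorphism (H s)" "H 0 = id" "H 1 = \<Psi>"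
    using \<Psi>_diffeotopic unfolding diffeotopic_to_id_def by blast
  interpret steered_diffeotopy F M L H T
  proof
    show "tangent Y" if "smooth_on UNIV Y" for Y
      using smooth F_approx that by (rule lie_approximating_imp_tangent)
  qed (fact H)+
  have cont: "continuous_on UNIV \<Psi>" "continuous_on UNIV a"
    using \<Psi>_diffeo a_smooth Ck_on_imp_continuous_on unfolding diffeomorphism_def smooth_on_def by blast+
  interpret ensemble_problem F M L \<Psi> a \<mu> K
    by (intro ensemble_problem.intro ensemble_problem_axioms.intro control_system_axioms
        cont a_nonneg a_zero K_compact \<mu>_prob \<mu>_borel \<mu>_supp)
  have "\<exists>g\<in>attainable. \<forall>x\<in>K. norm (g x - \<Psi> x) \<le> \<epsilon>" if "0 < \<epsilon>" for \<epsilon>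
    using diffeotopy_attainable[OF H(5) K_compact that] by (simp only: H(6))
  from kappa_tendsto_zero[OF end_cost_small[OF this]]
  show ?thesis by simp
qed


end
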